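(* Let $G$ be a group acting on a CAT(0) cube complex $X$ and $A \lhd G$ a normal finitely generated abelian subgroup. Assume that a non-trivial element of $A$ is never elliptic. Then $A$ is a direct factor of some finite-index subgroup of $G$; that is, there exist a finite-index subgroup $H\leq G$ containing $A$ and a subgroup $K \leq H$ such that $H = A \times K$ (internal direct product).
   Context: CAT(0) cube complexes may be infinite-dimensional; groups act on them by cubical automorphisms. An element of $G$ is elliptic if its orbits in $X$ are bounded (equivalently, it stabilises a cube of $X$). *)

theory Defs
  imports "HOL-Analysis.Analysis" "HOL-Algebra.Group_Action" "HOL-Algebra.Generated_Groups"
begin

section \<open>Standard cubes\<close>

definition unit_cube :: "nat \<Rightarrow> (nat \<Rightarrow> real) set" where
  "unit_cube n = {..<n} \<rightarrow>\<^sub>E {0..1}"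

definition open_cube :: "nat \<Rightarrow> (nat \<Rightarrow> real) set" where
  "open_cube n = {..<n} \<rightarrow>\<^sub>E {0<..<1}"

definition cube_topology :: "nat \<Rightarrow> (nat \<Rightarrow> real) topology" where
  "cube_topology n = product_topology (\<lambda>_. top_of_set {0..1}) {..<n}"

definition cube_dist :: "nat \<Rightarrow> (nat \<Rightarrow> real) \<Rightarrow> (nat \<Rightarrow> real) \<Rightarrow> real" where
  "cube_dist n p q = L2_set (\<lambda>i. p i - q i) {..<n}"

definition cube_origin :: "nat \<Rightarrow> (nat \<Rightarrow> real)" where
  "cube_origin n = (\<lambda>i\<in>{..<n}. 0)"

text \<open>The empty set of constraints is allowed, so the whole cube is one of its faces.\<close>

definition is_cube_face :: "nat \<Rightarrow> (nat \<Rightarrow> real) set \<Rightarrow> bool" where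
  "is_cube_face n F \<longleftrightarrow>
     (\<exists>J \<epsilon>. J \<subseteq> {..<n} \<and> \<epsilon> \<in> J \<rightarrow> {0, 1} \<and> F = {p \<in> unit_cube n. \<forall>j\<in>J. p j = \<epsilon> j})"

definition face_isometry :: "nat \<Rightarrow> nat \<Rightarrow> ((nat \<Rightarrow> real) \<Rightarrow> (nat \<Rightarrow> real)) \<Rightarrow> bool" where
  "face_isometry m n h \<longleftrightarrow>
     h \<in> extensional (unit_cube m) \<and> is_cube_face n (h ` unit_cube m) \<and>
     (\<forall>p\<in>unit_cube m. \<forall>q\<in>unit_cube m. cube_dist n (h p) (h q) = cube_dist m p q)"

section \<open>Cube complexes\<close>

text \<open>
  A cube complex is presented as a CW complex with point set \<open>X\<close> by all its characteristic maps:
  \<open>\<Phi> n\<close> consists of the parametrisations of its \<open>n\<close>-cubes by the standard \<open>n\<close>-cube, an \<open>n\<close>-cube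
  having one parametrisation for each isometry of the standard cube. That cubes are glued along faces
  by isometries says that the restriction of a parametrisation to a face of the standard cube is
  a parametrisation of a cube. Cubes need not be embedded: only open cubes are. There is no bound
  on the dimension and no local finiteness condition.
\<close>

locale cube_complex =
  fixes X :: "'x set" and \<Phi> :: "nat \<Rightarrow> ((nat \<Rightarrow> real) \<Rightarrow> 'x) set"
  assumes chart_fun: "\<phi> \<in> \<Phi> n \<Longrightarrow> \<phi> \<in> unit_cube n \<rightarrow>\<^sub>E X"
    and chart_face: "\<phi> \<in> \<Phi> n \<Longrightarrow> face_isometry m n h \<Longrightarrow> compose (unit_cube m) \<phi> h \<in> \<Phi> m"
    and chart_inj: "\<phi> \<in> \<Phi> n \<Longrightarrow> inj_on \<phi> (open_cube n)"
    and open_cubes_cover: "x \<in> X \<Longrightarrow> \<exists>n. \<exists>\<phi>\<in>\<Phi> n. x \<in> \<phi> ` open_cube n"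
    and open_cubes_disjoint:
      "\<phi> \<in> \<Phi> n \<Longrightarrow> \<psi> \<in> \<Phi> m \<Longrightarrow> \<phi> ` open_cube n \<inter> \<psi> ` open_cube m \<noteq> {} \<Longrightarrow>
       n = m \<and> (\<exists>h. face_isometry n n h \<and> \<psi> = compose (unit_cube n) \<phi> h)"

text \<open>The weak (CW) topology.\<close>

definition complex_topology ::
    "'x set \<Rightarrow> (nat \<Rightarrow> ((nat \<Rightarrow> real) \<Rightarrow> 'x) set) \<Rightarrow> 'x topology" where
  "complex_topology X \<Phi> = topology (\<lambda>U. U \<subseteq> X \<and>
     (\<forall>n. \<forall>\<phi>\<in>\<Phi> n. openin (cube_topology n) {p \<in> unit_cube n. \<phi> p \<in> U}))"

lemma topspace_cube_topology: "topspace (cube_topology n) = unit_cube n"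
  by (simp add: cube_topology_def unit_cube_def)

lemma openin_complex_topology:
  "openin (complex_topology X \<Phi>) U \<longleftrightarrow>
     U \<subseteq> X \<and> (\<forall>n. \<forall>\<phi>\<in>\<Phi> n. openin (cube_topology n) {p \<in> unit_cube n. \<phi> p \<in> U})"
proof -
  define Q where "Q = (\<lambda>U. U \<subseteq> X \<and>
     (\<forall>n. \<forall>\<phi>\<in>\<Phi> n. openin (cube_topology n) {p \<in> unit_cube n. \<phi> p \<in> U}))"
  have "istopology Q"
    unfolding istopology_def
  proof (intro conjI allI impI)
    fix S T assume "Q S" "Q T"
    moreover have "{p \<in> unit_cube n. \<phi> p \<in> S \<inter> T} =
        {p \<in> unit_cube n. \<phi> p \<in> S} \<inter> {p \<in> unit_cube n. \<phi> p \<in> T}"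
      for n and \<phi> :: "(nat \<Rightarrow> real) \<Rightarrow> 'a"
      by auto
    ultimately show "Q (S \<inter> T)"
      unfolding Q_def by auto
  next
    fix K assume K: "\<forall>S\<in>K. Q S"
    have "{p \<in> unit_cube n. \<phi> p \<in> \<Union>K} = (\<Union>S\<in>K. {p \<in> unit_cube n. \<phi> p \<in> S})"
      for n and \<phi> :: "(nat \<Rightarrow> real) \<Rightarrow> 'a"
      by auto
    with K show "Q (\<Union>K)"
      unfolding Q_def by auto
  qed
  then show ?thesis
    by (simp add: complex_topology_def topology_inverse' Q_def)
qed

lemma (in cube_complex) topspace_complex_topology: "topspace (complex_topology X \<Phi>) = X"
proof -
  have "{p \<in> unit_cube n. \<phi> p \<in> X} = unit_cube n" if "\<phi> \<in> \<Phi> n" for n \<phi>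
    using chart_fun[OF that] by auto
  then have "openin (complex_topology X \<Phi>) X"
    by (auto simp: openin_complex_topology simp flip: topspace_cube_topology)
  then show ?thesis
    by (metis openin_complex_topology openin_subset openin_topspace subset_antisym)
qed

text \<open>
  The intrinsic metric: the infimum of the lengths of strings, that is, of finite sequences of points
  in which consecutive points lie in a common cube, the length being measured in these cubes.
\<close>

inductive joined_by_string ::
    "'x set \<Rightarrow> (nat \<Rightarrow> ((nat \<Rightarrow> real) \<Rightarrow> 'x) set) \<Rightarrow> 'x \<Rightarrow> 'x \<Rightarrow> real \<Rightarrow> bool"
  for X \<Phi> x where
  refl: "x \<in> X \<Longrightarrow> joined_by_string X \<Phi> x x 0"
| step: "joined_by_string X \<Phi> x (\<phi> p) l \<Longrightarrow> \<phi> \<in> \<Phi> n \<Longrightarrow> p \<in> unit_cube n \<Longrightarrow> q \<in> unit_cube n \<Longrightarrow>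
         joined_by_string X \<Phi> x (\<phi> q) (l + cube_dist n p q)"

definition complex_dist ::
    "'x set \<Rightarrow> (nat \<Rightarrow> ((nat \<Rightarrow> real) \<Rightarrow> 'x) set) \<Rightarrow> 'x \<Rightarrow> 'x \<Rightarrow> real" where
  "complex_dist X \<Phi> x y = Inf {l. joined_by_string X \<Phi> x y l}"

section \<open>Links and the CAT(0) condition\<close>

text \<open>
  A cube with a chosen corner at the vertex \<open>v\<close> is recorded by the parametrisations sending the origin
  to \<open>v\<close>; two of them define the same corner iff they differ by an isometry fixing the origin.
  The vertices of the link of \<open>v\<close> are the edges with a chosen end at \<open>v\<close>, that is, the corners of
  dimension 1 (so a loop at \<open>v\<close> gives two of them), and an \<open>n\<close>-dimensional corner spans a simplex
  on the \<open>n\<close> edges issuing from it.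
\<close>

definition corners :: "(nat \<Rightarrow> ((nat \<Rightarrow> real) \<Rightarrow> 'x) set) \<Rightarrow> 'x \<Rightarrow> nat \<Rightarrow> ((nat \<Rightarrow> real) \<Rightarrow> 'x) set"
  where "corners \<Phi> v n = {\<phi> \<in> \<Phi> n. \<phi> (cube_origin n) = v}"

definition corner_edge :: "nat \<Rightarrow> ((nat \<Rightarrow> real) \<Rightarrow> 'x) \<Rightarrow> nat \<Rightarrow> ((nat \<Rightarrow> real) \<Rightarrow> 'x)" where
  "corner_edge n \<phi> i = (\<lambda>t\<in>unit_cube 1. \<phi> (\<lambda>j\<in>{..<n}. if j = i then t 0 else 0))"

definition link_simplices ::
    "(nat \<Rightarrow> ((nat \<Rightarrow> real) \<Rightarrow> 'x) set) \<Rightarrow> 'x \<Rightarrow> ((nat \<Rightarrow> real) \<Rightarrow> 'x) set set" where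
  "link_simplices \<Phi> v = {corner_edge n \<phi> ` {..<n} | n \<phi>. \<phi> \<in> corners \<Phi> v n}"

text \<open>
  The link is a simplicial complex: the vertices of each simplex are distinct, and a simplex is
  determined by its vertices.
\<close>

definition link_simplicial :: "(nat \<Rightarrow> ((nat \<Rightarrow> real) \<Rightarrow> 'x) set) \<Rightarrow> 'x \<Rightarrow> bool" where
  "link_simplicial \<Phi> v \<longleftrightarrow>
     (\<forall>n. \<forall>\<phi>\<in>corners \<Phi> v n. inj_on (corner_edge n \<phi>) {..<n}) \<and>
     (\<forall>n. \<forall>\<phi>\<in>corners \<Phi> v n. \<forall>\<psi>\<in>corners \<Phi> v n.
        corner_edge n \<phi> ` {..<n} = corner_edge n \<psi> ` {..<n} \<longrightarrow>
        (\<exists>h. face_isometry n n h \<and> h (cube_origin n) = cube_origin n \<and>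
             \<psi> = compose (unit_cube n) \<phi> h))"

definition link_flag :: "(nat \<Rightarrow> ((nat \<Rightarrow> real) \<Rightarrow> 'x) set) \<Rightarrow> 'x \<Rightarrow> bool" where
  "link_flag \<Phi> v \<longleftrightarrow>
     (\<forall>S. finite S \<and> S \<noteq> {} \<and> S \<subseteq> corners \<Phi> v 1 \<and>
          (\<forall>a\<in>S. \<forall>b\<in>S. a \<noteq> b \<longrightarrow> {a, b} \<in> link_simplices \<Phi> v)
          \<longrightarrow> S \<in> link_simplices \<Phi> v)"

definition vertices :: "(nat \<Rightarrow> ((nat \<Rightarrow> real) \<Rightarrow> 'x) set) \<Rightarrow> 'x set" where
  "vertices \<Phi> = {\<phi> (cube_origin 0) | \<phi>. \<phi> \<in> \<Phi> 0}"

definition simply_connected_space :: "'x topology \<Rightarrow> bool" where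
  "simply_connected_space T \<longleftrightarrow>
     topspace T \<noteq> {} \<and> path_connected_space T \<and>
     (\<forall>\<gamma>. pathin T \<gamma> \<and> \<gamma> 0 = \<gamma> 1 \<longrightarrow>
        homotopic_with (\<lambda>\<delta>. \<delta> 0 = \<gamma> 0 \<and> \<delta> 1 = \<gamma> 0) (top_of_set {0..1}) T \<gamma> (\<lambda>_. \<gamma> 0))"

locale cat0_cube_complex = cube_complex X \<Phi>
  for X :: "'x set" and \<Phi> :: "nat \<Rightarrow> ((nat \<Rightarrow> real) \<Rightarrow> 'x) set" +
  assumes links_simplicial: "v \<in> vertices \<Phi> \<Longrightarrow> link_simplicial \<Phi> v"
    and links_flag: "v \<in> vertices \<Phi> \<Longrightarrow> link_flag \<Phi> v"
    and simply_connected: "simply_connected_space (complex_topology X \<Phi>)"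

section \<open>Actions by cubical automorphisms\<close>

definition cubical_automorphism ::
    "'x set \<Rightarrow> (nat \<Rightarrow> ((nat \<Rightarrow> real) \<Rightarrow> 'x) set) \<Rightarrow> ('x \<Rightarrow> 'x) \<Rightarrow> bool" where
  "cubical_automorphism X \<Phi> f \<longleftrightarrow>
     bij_betw f X X \<and> (\<forall>n. (\<lambda>\<phi>. compose (unit_cube n) f \<phi>) ` \<Phi> n = \<Phi> n)"

locale cubical_action = group_action G X \<alpha>
  for G :: "('g, 'b) monoid_scheme" (structure)
    and X :: "'x set" and \<Phi> :: "nat \<Rightarrow> ((nat \<Rightarrow> real) \<Rightarrow> 'x) set" and \<alpha> :: "'g \<Rightarrow> 'x \<Rightarrow> 'x" +
  assumes cubical: "g \<in> carrier G \<Longrightarrow> cubical_automorphism X \<Phi> (\<alpha> g)"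

definition elliptic ::
    "('g, 'b) monoid_scheme \<Rightarrow> 'x set \<Rightarrow> (nat \<Rightarrow> ((nat \<Rightarrow> real) \<Rightarrow> 'x) set) \<Rightarrow>
     ('g \<Rightarrow> 'x \<Rightarrow> 'x) \<Rightarrow> 'g \<Rightarrow> bool" where
  "elliptic G X \<Phi> \<alpha> g \<longleftrightarrow>
     (\<forall>x\<in>X. \<exists>B. \<forall>y\<in>orbit (G\<lparr>carrier := generate G {g}\<rparr>) \<alpha> x.
                  \<forall>z\<in>orbit (G\<lparr>carrier := generate G {g}\<rparr>) \<alpha> x. complex_dist X \<Phi> y z \<le> B)"

section \<open>Group-theoretic notions\<close>

definition finitely_generated :: "('g, 'b) monoid_scheme \<Rightarrow> bool" where
  "finitely_generated G \<longleftrightarrow> (\<exists>S. finite S \<and> S \<subseteq> carrier G \<and> generate G S = carrier G)"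

definition internal_direct_product :: "('g, 'b) monoid_scheme \<Rightarrow> 'g set \<Rightarrow> 'g set \<Rightarrow> bool" where
  "internal_direct_product G A K \<longleftrightarrow>
     A \<lhd> G \<and> K \<lhd> G \<and> A \<inter> K = {\<one>\<^bsub>G\<^esub>} \<and> A <#>\<^bsub>G\<^esub> K = carrier G"

end

theory Submission
  imports Defs
begin

text \<open>
  Simple connectedness says that local systems on \<open>X\<close>, for instance coverings, have trivial monodromy
  along edge paths. Apply this to the local system whose fibre at a vertex consists of the
  reduced edge paths to a base point, taken up to pushing them across squares. Flagness of the links
  makes this a local system, just as in the solution of the word problem for right-angled Coxeter
  groups. So every vertex is joined to the base point by a unique reduced class. It follows that
  two vertices are separated by only finitely many, and by at least \<open>d\<close>, of the half-spaces
  \<open>{y. d(y, w) < d(y, v)}\<close> of edges \<open>vw\<close>, where \<open>d\<close> is their distance in the graph.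

  For a set \<open>Q\<close> of half-spaces and a base vertex \<open>x\<close> let \<open>\<epsilon>\<^sub>Q(g)\<close> be the number of elements
  of \<open>Q\<close> that contain \<open>g x\<close> but not \<open>x\<close>, minus the number of those that contain \<open>x\<close> but not
  \<open>g x\<close>. It is a homomorphism on the stabiliser of \<open>Q\<close>. Only finitely many \<open>A\<close>-orbits \<open>Q\<close> have
  \<open>\<epsilon>\<^sub>Q\<close> nontrivial on the finitely generated group \<open>A\<close>, and they are permuted by \<open>G\<close>, so a
  subgroup of finite index stabilises all of them. An element of \<open>A\<close> on which all these \<open>\<epsilon>\<^sub>Q\<close> vanish
  has bounded orbits and hence is trivial. Therefore the subgroup centralises \<open>A\<close>, as commutators are killed
  by homomorphisms to the integers, and the \<open>\<epsilon>\<^sub>Q\<close> split \<open>A\<close> off up to finite index.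
\<close>

section \<open>Paths up to squares\<close>

text \<open>No CAT(0) metric is used: \<open>X\<close> may be infinite-dimensional and locally
  infinite, so half-spaces take the place of geodesics and axes. Topology enters only through
  connectedness and through trivial monodromy. The latter must be extracted from null-homotopies in
  the weak topology, hence the explicit star neighbourhoods and the lifting over a square. Why
  vanishing of all \<open>eps\<close> bounds the orbit of \<open>a\<close>: every half-space crossed
  by the orbit of the base vertex is a translate of one of the finitely many that separate
  \<open>x0\<close> from \<open>a x0\<close>. If the orbit is unbounded, some such \<open>D\<close>
  contains all late points of the orbit and no early ones, or conversely; otherwise each would
  contribute boundedly many translates. This tail behaviour does not depend on the base vertex, so
  the translates of \<open>D\<close> under the abelian group \<open>A\<close> inherit it, and the
  signed count over this \<open>A\<close>-orbit grows linearly. Whole \<open>A\<close>-orbits are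
  taken because by normality \<open>G\<close> permutes them, and because an \<open>eps\<close> that
  is nonzero on \<open>A\<close> is nonzero on a generator \<open>s\<close>, which leaves only
  orbits meeting the finite set that separates \<open>x0\<close> from \<open>s x0\<close>.\<close>

text \<open>Darts are oriented edges, \<open>perp a b\<close> says that two darts issuing from one
  vertex span a square, and \<open>tr a b\<close> is the side of it parallel to \<open>b\<close>
  that issues from the end of \<open>a\<close>. The last two axioms are what flag links contribute:
  three pairwise perpendicular darts behave as in a 3-cube.\<close>

locale dart_complex =
  fixes E :: "'e set" and src :: "'e \<Rightarrow> 'v" and rev :: "'e \<Rightarrow> 'e"
    and perp :: "'e \<Rightarrow> 'e \<Rightarrow> bool" and tr :: "'e \<Rightarrow> 'e \<Rightarrow> 'e"
  assumes rev_in: "e \<in> E \<Longrightarrow> rev e \<in> E"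
    and rev_rev: "e \<in> E \<Longrightarrow> rev (rev e) = e"
    and perp_dart: "perp a b \<Longrightarrow> a \<in> E"
    and perp_src: "perp a b \<Longrightarrow> src a = src b"
    and perp_neq: "perp a b \<Longrightarrow> a \<noteq> b"
    and perp_sym: "perp a b \<Longrightarrow> perp b a"
    and perp_tr: "perp a b \<Longrightarrow> perp (rev a) (tr a b)"
    and tr_rev: "perp a b \<Longrightarrow> tr (rev a) (tr a b) = b"
    and tr_tr_rev: "perp a b \<Longrightarrow> tr (tr a b) (rev a) = rev (tr b a)"
    and cube_perp: "perp a b \<Longrightarrow> perp b c \<Longrightarrow> perp a c \<Longrightarrow> perp (tr a b) (tr a c)"
    and cube_tr: "perp a b \<Longrightarrow> perp b c \<Longrightarrow> perp a c \<Longrightarrow>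
                  tr (tr a b) (tr a c) = tr (tr b a) (tr b c)"
begin

abbreviation tgt :: "'e \<Rightarrow> 'v" where "tgt e \<equiv> src (rev e)"

lemma perp_dart2: "perp a b \<Longrightarrow> b \<in> E"
  using perp_dart perp_sym by blast

lemma tr_dart: "perp a b \<Longrightarrow> tr a b \<in> E"
  using perp_dart2 perp_tr by blast

lemma src_tr: "perp a b \<Longrightarrow> src (tr a b) = tgt a"
  using perp_src perp_tr by fastforce

lemma tgt_tr: "perp a b \<Longrightarrow> tgt (tr a b) = tgt (tr b a)"
  by (metis perp_sym perp_tr src_tr tr_tr_rev)

lemma tr_inj: "perp a b \<Longrightarrow> perp a c \<Longrightarrow> tr a b = tr a c \<Longrightarrow> b = c"
  by (metis tr_rev)

fun dpath :: "'v \<Rightarrow> 'e list \<Rightarrow> 'v \<Rightarrow> bool" where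
  "dpath x [] y \<longleftrightarrow> x = y"
| "dpath x (d # p) y \<longleftrightarrow> d \<in> E \<and> src d = x \<and> dpath (tgt d) p y"

text \<open>
  Paths are identified when they differ by pushing them across squares. The relation is introduced
  in the form of its exchange property, which makes transitivity the only thing to prove.
\<close>

inductive eqv :: "'e list \<Rightarrow> 'e list \<Rightarrow> bool" where
  eqv_Nil: "eqv [] []"
| eqv_Cons: "eqv p q \<Longrightarrow> eqv (d # p) (d # q)"
| eqv_swap: "perp d c \<Longrightarrow> eqv p (tr d c # z) \<Longrightarrow> eqv q (tr c d # z) \<Longrightarrow> eqv (d # p) (c # q)"

lemma eqv_refl [simp]: "eqv p p"
  by (induction p) (auto intro: eqv.intros)

lemma eqv_sym: "eqv p q \<Longrightarrow> eqv q p"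
  by (induction rule: eqv.induct) (auto intro: eqv.intros perp_sym)

lemma eqv_length: "eqv p q \<Longrightarrow> length p = length q"
  by (induction rule: eqv.induct) auto

lemma eqv_dpath: "eqv p q \<Longrightarrow> dpath x p y \<longleftrightarrow> dpath x q y"
proof (induction arbitrary: x rule: eqv.induct)
  case (eqv_swap d c p z q)
  then show ?case
    using perp_dart[OF eqv_swap(1)] perp_dart2[OF eqv_swap(1)] perp_src[OF eqv_swap(1)]
      tgt_tr[OF eqv_swap(1)] src_tr[OF eqv_swap(1)] src_tr[OF perp_sym[OF eqv_swap(1)]]
      tr_dart[OF eqv_swap(1)] tr_dart[OF perp_sym[OF eqv_swap(1)]]
    by auto
qed auto

lemma eqv_NilD: "eqv [] q \<Longrightarrow> q = []"
  using eqv_length by fastforce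

lemma eqv_ConsE:
  assumes "eqv (d # p) (c # q)"
  obtains "d = c" "eqv p q" | z where "perp d c" "eqv p (tr d c # z)" "eqv q (tr c d # z)"
  using assms by (cases rule: eqv.cases) auto

lemma swap: "perp d c \<Longrightarrow> eqv (d # tr d c # z) (c # tr c d # z)"
  by (rule eqv_swap[where z = z]) auto

text \<open>By induction on the length. The one hard case is two exchanges, \<open>d\<close> for
  \<open>c\<close> and \<open>c\<close> for \<open>b\<close>. The two forms of the tail of the
  middle path make \<open>d\<close> and \<open>b\<close> equal or perpendicular, and in the second
  case the three darts span a cube, around which \<open>d\<close> is exchanged for \<open>b\<close>
  directly.\<close>

lemma eqv_trans: "eqv p q \<Longrightarrow> eqv q r \<Longrightarrow> eqv p r"
proof (induction "length p" arbitrary: p q r)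
  case 0
  then show ?case using eqv_NilD by (metis length_0_conv)
next
  case (Suc n)
  have IH: "eqv p r" if "eqv p q" "eqv q r" "length p = n" for p q r
    using Suc.hyps that by blast
  obtain d p' where p: "p = d # p'" using Suc.hyps(2) by (cases p) auto
  obtain c q' where q: "q = c # q'" using Suc.hyps(2) eqv_length[OF Suc.prems(1)] by (cases q) auto
  obtain b r' where r: "r = b # r'"
    using Suc.hyps(2) eqv_length[OF Suc.prems(1)] eqv_length[OF Suc.prems(2)] by (cases r) auto
  have lp: "length p' = n" and lq: "length q' = n" and lr: "length r' = n"
    using Suc.hyps(2) eqv_length[OF Suc.prems(1)] eqv_length[OF Suc.prems(2)] p q r by auto
  have pq: "eqv (d # p') (c # q')" and qr: "eqv (c # q') (b # r')" using Suc.prems p q r by auto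
  show ?case
  proof (rule eqv_ConsE[OF pq]; rule eqv_ConsE[OF qr])
    assume "d = c" "eqv p' q'" "c = b" "eqv q' r'"
    then show ?thesis using IH lp p r by (auto intro: eqv_Cons)
  next
    fix z assume "d = c" "eqv p' q'" "perp c b" "eqv q' (tr c b # z)" "eqv r' (tr b c # z)"
    then show ?thesis using IH[OF \<open>eqv p' q'\<close> _ lp] p r by (auto intro: eqv_swap)
  next
    fix z assume "perp d c" "eqv p' (tr d c # z)" "eqv q' (tr c d # z)" "c = b" "eqv q' r'"
    then show ?thesis using IH[OF eqv_sym[OF \<open>eqv q' r'\<close>] _ lr] p r by (auto intro: eqv_swap)
  next
    fix z1 z2
    assume dc: "perp d c" and p1: "eqv p' (tr d c # z1)" and q1: "eqv q' (tr c d # z1)"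
      and cb: "perp c b" and q2: "eqv q' (tr c b # z2)" and r2: "eqv r' (tr b c # z2)"
    have cd: "perp c d" and bc: "perp b c" using dc cb perp_sym by auto
    have "eqv (tr c d # z1) (tr c b # z2)"
      using IH[OF eqv_sym[OF q1] q2] eqv_length[OF q1] lq by simp
    then show ?thesis
    proof (rule eqv_ConsE)
      assume "tr c d = tr c b" and z: "eqv z1 z2"
      then have "d = b" using tr_inj[OF cd cb] by simp
      then have "eqv (tr d c # z1) r'"
        using IH[OF eqv_Cons[OF z, of "tr d c"] , of r'] eqv_sym[OF r2] eqv_length[OF p1] lp by simp
      then have "eqv p' r'" using IH[OF p1 _ lp] by simp
      then show ?thesis using \<open>d = b\<close> p r by (simp add: eqv_Cons)
    next
      fix y assume pp: "perp (tr c d) (tr c b)"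
        and z1: "eqv z1 (tr (tr c d) (tr c b) # y)" and z2: "eqv z2 (tr (tr c b) (tr c d) # y)"
      \<comment> \<open>\<open>rev c\<close>, \<open>tr c d\<close> and \<open>tr c b\<close> are
        pairwise perpendicular at the end of \<open>c\<close>; transport along \<open>rev c\<close>
        carries the last two back to \<open>d\<close> and \<open>b\<close>.\<close>
      have db: "perp d b"
        using cube_perp[OF perp_tr[OF cd] pp perp_tr[OF cb]] tr_rev[OF cd] tr_rev[OF cb] by simp
      have bd: "perp b d" using db perp_sym by simp
      let ?w = "tr (tr d b) (tr d c) # y"
      have "eqv p' (tr d b # ?w)"
      proof -
        have "tr (tr c d) (tr c b) = tr (tr d c) (tr d b)" using cube_tr[OF cd db cb] .
        then have a: "eqv (tr d c # z1) (tr d c # tr (tr d c) (tr d b) # y)"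
          using z1 by (simp add: eqv_Cons)
        have "eqv (tr d c # tr (tr d c) (tr d b) # y) (tr d b # ?w)"
          by (rule swap) (use cube_perp[OF dc cb db] in auto)
        then show ?thesis using IH[OF p1 IH[OF a]] eqv_length[OF p1] lp by auto
      qed
      moreover have "eqv r' (tr b d # ?w)"
      proof -
        have e: "tr (tr d b) (tr d c) = tr (tr b d) (tr b c)" using cube_tr[OF db bc dc] .
        have "tr (tr c b) (tr c d) = tr (tr b c) (tr b d)" using cube_tr[OF cb bd cd] .
        then have a: "eqv (tr b c # z2) (tr b c # tr (tr b c) (tr b d) # y)"
          using z2 by (simp add: eqv_Cons)
        have "eqv (tr b c # tr (tr b c) (tr b d) # y) (tr b d # ?w)"
          unfolding e by (rule swap) (use cube_perp[OF bc cd bd] in auto)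
        then show ?thesis using IH[OF r2 IH[OF a]] eqv_length[OF r2] lr by auto
      qed
      ultimately show ?thesis using db p r eqv_swap by blast
    qed
  qed
qed

section \<open>Reduced paths and their invariance under pushes across squares\<close>

definition descends :: "'e \<Rightarrow> 'e list \<Rightarrow> bool" where
  "descends e p \<longleftrightarrow> (\<exists>q. eqv p (e # q))"

lemma descends_eqv: "eqv p q \<Longrightarrow> descends e p \<longleftrightarrow> descends e q"
  unfolding descends_def by (meson eqv_sym eqv_trans)

fun reduced :: "'e list \<Rightarrow> bool" where
  "reduced [] \<longleftrightarrow> True"
| "reduced (d # p) \<longleftrightarrow> reduced p \<and> \<not> descends (rev d) p"

lemma eqv_cancel: "eqv (d # p) (d # q) \<Longrightarrow> eqv p q"
  by (erule eqv_ConsE) (auto dest: perp_neq)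

text \<open>The square of \<open>d\<close> and \<open>c\<close> seen from the end of
  \<open>d\<close>, where its two sides are \<open>tr d c\<close> and \<open>rev d\<close>.\<close>

lemma square_back:
  assumes "perp d c"
  shows "eqv (tr d c # rev (tr c d) # y) (rev d # c # y)"
  using swap[OF perp_sym[OF perp_tr[OF assms]], of y] tr_rev[OF assms] tr_tr_rev[OF assms] by simp

text \<open>A backtrack in the path after an exchange, along \<open>c\<close> or along
  \<open>tr c d\<close>, could be pushed across the square of \<open>d\<close> and \<open>c\<close>
  to a backtrack in the path before it.\<close>

lemma reduced_eqv: "reduced p \<Longrightarrow> eqv p q \<Longrightarrow> reduced q"
proof (induction "length p" arbitrary: p q)
  case 0
  then show ?case using eqv_NilD by fastforce
next
  case (Suc n)
  have IH: "reduced q" if "reduced p" "eqv p q" "length p = n" for p q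
    using Suc.hyps that by blast
  obtain d p' where p: "p = d # p'" using Suc.hyps(2) by (cases p) auto
  obtain c q' where q: "q = c # q'" using Suc.hyps(2) eqv_length[OF Suc.prems(2)] by (cases q) auto
  have lp: "length p' = n" and lq: "length q' = n"
    using Suc.hyps(2) eqv_length[OF Suc.prems(2)] p q by auto
  have rp: "reduced p'" and nd: "\<not> descends (rev d) p'" using Suc.prems(1) p by auto
  have "eqv (d # p') (c # q')" using Suc.prems p q by simp
  then show ?case
  proof (rule eqv_ConsE)
    assume "d = c" "eqv p' q'"
    then show ?thesis using IH[OF rp _ lp] nd q descends_eqv by auto
  next
    fix z assume dc: "perp d c" and pz: "eqv p' (tr d c # z)" and qz: "eqv q' (tr c d # z)"
    have rz: "reduced z" "\<not> descends (rev (tr d c)) z" using IH[OF rp pz lp] by auto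
    have "\<not> descends (rev (tr c d)) z"
    proof
      assume "descends (rev (tr c d)) z"
      then obtain y where "eqv z (rev (tr c d) # y)" unfolding descends_def by blast
      then have "eqv p' (tr d c # rev (tr c d) # y)" using pz eqv_Cons eqv_trans by blast
      then have "eqv p' (rev d # c # y)" using square_back[OF dc] eqv_trans by blast
      then show False using nd descends_def by blast
    qed
    then have "reduced (tr c d # z)" using rz by simp
    then have rq: "reduced q'" using IH[OF _ eqv_sym[OF qz]] eqv_length[OF qz] lq by simp
    have "\<not> descends (rev c) q'"
    proof
      assume "descends (rev c) q'"
      then obtain y where "eqv q' (rev c # y)" unfolding descends_def by blast
      then have "eqv (rev c # y) (tr c d # z)" using qz eqv_sym eqv_trans by blast
      then show False
      proof (rule eqv_ConsE)
        assume "rev c = tr c d" then show False using perp_neq[OF perp_tr[OF perp_sym[OF dc]]] by simp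
      next
        fix y' assume "eqv z (tr (tr c d) (rev c) # y')"
        then have "descends (rev (tr d c)) z"
          using tr_tr_rev[OF perp_sym[OF dc]] descends_def by auto
        then show False using rz by simp
      qed
    qed
    then show ?thesis using rq q by simp
  qed
qed

section \<open>Parallel transport of path classes along darts\<close>

definition cls :: "'e list \<Rightarrow> 'e list set" where "cls p = {q. eqv p q}"

lemma cls_eq: "cls p = cls q \<longleftrightarrow> eqv p q"
  unfolding cls_def by (metis (mono_tags, lifting) Collect_cong eqv_refl eqv_sym eqv_trans mem_Collect_eq)

text \<open>Modelled on a Coxeter generator acting on reduced words: the dart \<open>e\<close>
  cancels if the path can be pushed so as to begin with it, and otherwise \<open>rev e\<close> is
  prepended. The choice is unique up to \<open>eqv\<close> by \<open>eqv_cancel\<close>.\<close>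

definition move :: "'e \<Rightarrow> 'e list \<Rightarrow> 'e list" where
  "move e p = (if descends e p then SOME q. eqv p (e # q) else rev e # p)"

definition act :: "'e \<Rightarrow> 'e list set \<Rightarrow> 'e list set" where
  "act e S = cls (move e (SOME p. p \<in> S))"

lemma move_descends: "descends e p \<Longrightarrow> eqv p (e # move e p)"
  by (simp add: move_def, unfold descends_def, rule someI_ex)

lemma move_eq: "eqv p (e # q) \<Longrightarrow> eqv (move e p) q"
  by (meson descends_def eqv_cancel eqv_sym eqv_trans move_descends)

lemma move_eqv: "eqv p q \<Longrightarrow> eqv (move e p) (move e q)"
proof (cases "descends e p")
  case True
  assume "eqv p q"
  with True have "descends e q" using descends_eqv by blast
  then show ?thesis using \<open>eqv p q\<close> move_eq move_descends eqv_trans by blast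
next
  case False
  assume "eqv p q"
  with False have "\<not> descends e q" using descends_eqv by blast
  then show ?thesis using False \<open>eqv p q\<close> by (simp add: move_def eqv_Cons)
qed

lemma act_cls: "act e (cls p) = cls (move e p)"
proof -
  have "eqv p (SOME q. q \<in> cls p)" using someI[of "\<lambda>q. q \<in> cls p" p] by (simp add: cls_def)
  then show ?thesis unfolding act_def cls_eq using eqv_sym move_eqv by blast
qed

lemma move_ascends: "\<not> descends e p \<Longrightarrow> move e p = rev e # p"
  by (simp add: move_def)

lemma reduced_move: "e \<in> E \<Longrightarrow> reduced p \<Longrightarrow> reduced (move e p)"
proof (cases "descends e p")
  case True
  assume "reduced p"
  then show ?thesis using reduced_eqv[OF _ move_descends[OF True]] by simp
next
  case False
  assume "reduced p" "e \<in> E"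
  then show ?thesis using False by (simp add: move_ascends rev_rev)
qed

lemma dpath_move: "e \<in> E \<Longrightarrow> src e = x \<Longrightarrow> dpath x p y \<Longrightarrow> dpath (tgt e) (move e p) y"
proof (cases "descends e p")
  case True
  assume "dpath x p y"
  then show ?thesis using eqv_dpath[OF move_descends[OF True]] by simp
next
  case False
  assume "dpath x p y" "e \<in> E" "src e = x"
  then show ?thesis using False by (simp add: move_ascends rev_rev rev_in)
qed

text \<open>If \<open>e\<close> was cancelled, reducedness of \<open>e # move e p\<close> keeps
  \<open>rev e\<close> from cancelling in turn, so the way back prepends \<open>e\<close>
  again.\<close>

lemma move_rev:
  assumes "e \<in> E" "reduced p"
  shows "eqv (move (rev e) (move e p)) p"
proof (cases "descends e p")
  case True
  have "eqv p (e # move e p)" using move_descends[OF True] .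
  then have "reduced (e # move e p)" using assms reduced_eqv by blast
  then have "\<not> descends (rev e) (move e p)" by simp
  then show ?thesis
    using eqv_sym[OF move_descends[OF True]] by (simp add: move_ascends assms rev_rev)
next
  case False
  then show ?thesis using move_eq[of "rev e # p" "rev e" p] by (simp add: move_ascends)
qed

text \<open>Transport around a square is trivial; the cases are how many of its two sides at the
  start shorten the path. If only \<open>e\<close> does, the prepended \<open>rev f\<close> and the
  leading \<open>e\<close> are exchanged across the square.\<close>

lemma move_square1:
  assumes "perp e f" "descends e p" "\<not> descends f p"
  shows "\<not> descends (tr e f) (move e p)"
    and "descends (tr f e) (move f p)"
    and "eqv (move (tr e f) (move e p)) (move (tr f e) (move f p))"
proof -
  have pe: "eqv p (e # move e p)" using assms move_descends by blast
  show 1: "\<not> descends (tr e f) (move e p)"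
  proof
    assume "descends (tr e f) (move e p)"
    then obtain z where "eqv (move e p) (tr e f # z)" by (auto simp: descends_def)
    then have "eqv p (e # tr e f # z)" using pe eqv_Cons eqv_trans by blast
    then have "eqv p (f # tr f e # z)" using swap[OF assms(1)] eqv_trans by blast
    then show False using assms descends_def by blast
  qed
  have "eqv (rev f # e # move e p) (tr f e # rev (tr e f) # move e p)"
    using square_back[OF perp_sym[OF assms(1)], of "move e p"] eqv_sym by blast
  moreover have "eqv (move f p) (rev f # e # move e p)"
    using assms pe by (simp add: move_ascends eqv_Cons)
  ultimately have 2: "eqv (move f p) (tr f e # rev (tr e f) # move e p)" using eqv_trans by blast
  then show "descends (tr f e) (move f p)" using descends_def by blast
  show "eqv (move (tr e f) (move e p)) (move (tr f e) (move f p))"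
    using move_eq[OF 2] eqv_sym by (simp add: move_ascends[OF 1])
qed

text \<open>If both sides shorten the path, the exchange property pushes it through the opposite
  corner of the square, and both routes leave the same remainder \<open>z\<close>.\<close>

lemma move_square2:
  assumes "perp e f" "descends e p" "descends f p"
  shows "descends (tr e f) (move e p)"
    and "eqv (move (tr e f) (move e p)) (move (tr f e) (move f p))"
proof -
  have "eqv (e # move e p) (f # move f p)"
    using assms move_descends eqv_sym eqv_trans by blast
  then obtain z where z: "eqv (move e p) (tr e f # z)" "eqv (move f p) (tr f e # z)"
    using perp_neq[OF assms(1)] by (auto elim: eqv_ConsE)
  then show "descends (tr e f) (move e p)" using descends_def by blast
  show "eqv (move (tr e f) (move e p)) (move (tr f e) (move f p))"
    using move_eq[OF z(1)] move_eq[OF z(2)] eqv_sym eqv_trans by blast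
qed

text \<open>If neither side shortens the path, both routes prepend two sides, and these are
  exchanged across the same square seen from the corner opposite to the start.\<close>

lemma move_square3:
  assumes "perp e f" "\<not> descends e p" "\<not> descends f p"
  shows "\<not> descends (tr e f) (move e p)"
    and "eqv (move (tr e f) (move e p)) (move (tr f e) (move f p))"
proof -
  have *: "\<not> descends (tr e f) (move e p)"
    if ef: "perp e f" and na: "\<not> descends e p" and nf: "\<not> descends f p" for e f
  proof
    assume "descends (tr e f) (move e p)"
    then obtain z where "eqv (rev e # p) (tr e f # z)"
      using na move_ascends[of e p] by (auto simp: descends_def)
    then show False
    proof (rule eqv_ConsE)
      assume "rev e = tr e f" then show False using perp_neq[OF perp_tr[OF ef]] by simp
    next
      fix y assume "eqv p (tr (rev e) (tr e f) # y)"
      then show False using nf tr_rev[OF ef] by (auto simp: descends_def)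
    qed
  qed
  show 1: "\<not> descends (tr e f) (move e p)" using * assms by blast
  have 2: "\<not> descends (tr f e) (move f p)" using * assms perp_sym by blast
  let ?a = "rev (tr e f)" and ?b = "rev (tr f e)"
  have fe: "perp f e" using assms perp_sym by blast
  have q: "perp (tr e f) (rev e)" using perp_sym[OF perp_tr[OF assms(1)]] .
  have ab: "perp ?a ?b" using perp_tr[OF q] tr_tr_rev[OF assms(1)] by simp
  have "tr ?a ?b = rev e" using tr_rev[OF q] tr_tr_rev[OF assms(1)] by simp
  moreover have "tr ?b ?a = rev f"
    using tr_rev[OF perp_sym[OF perp_tr[OF fe]]] tr_tr_rev[OF fe] by simp
  ultimately show "eqv (move (tr e f) (move e p)) (move (tr f e) (move f p))"
    using swap[OF ab, of p]
    by (subst move_ascends[OF 1], subst move_ascends[OF 2]) (simp add: move_ascends assms)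
qed

lemma move_square:
  assumes "perp e f"
  shows "eqv (move (tr e f) (move e p)) (move (tr f e) (move f p))"
proof (cases "descends e p"; cases "descends f p")
  assume "\<not> descends e p" "descends f p"
  then show ?thesis using move_square1(3)[OF perp_sym[OF assms]] eqv_sym by blast
qed (use move_square1(3)[OF assms] move_square2(2)[OF assms] move_square3(2)[OF assms] in blast)+

text \<open>The origin of half-spaces: opposite sides of a square agree on whether they lead towards
  the base point.\<close>

lemma descends_parallel:
  assumes "perp e f"
  shows "descends (tr f e) (move f p) \<longleftrightarrow> descends e p"
proof (cases "descends e p"; cases "descends f p")
  assume "descends e p" "descends f p"
  then show ?thesis using move_square2(1)[OF perp_sym[OF assms]] by blast
next
  assume "descends e p" "\<not> descends f p"
  then show ?thesis using move_square1(2)[OF assms] by blast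
next
  assume "\<not> descends e p" "descends f p"
  then show ?thesis using move_square1(1)[OF perp_sym[OF assms]] by blast
next
  assume "\<not> descends e p" "\<not> descends f p"
  then show ?thesis using move_square3(1)[OF perp_sym[OF assms]] by blast
qed

text \<open>Only squares are tested, because the 2-skeleton carries the fundamental group.\<close>

definition local_system :: "('v \<Rightarrow> 's set) \<Rightarrow> ('e \<Rightarrow> 's \<Rightarrow> 's) \<Rightarrow> bool" where
  "local_system M t \<longleftrightarrow>
     (\<forall>e\<in>E. \<forall>s\<in>M (src e). t e s \<in> M (tgt e) \<and> t (rev e) (t e s) = s) \<and>
     (\<forall>e f. perp e f \<longrightarrow> (\<forall>s\<in>M (src e). t (tr e f) (t e s) = t (tr f e) (t f s)))"

definition reduced_classes :: "'v \<Rightarrow> 'v \<Rightarrow> 'e list set set" where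
  "reduced_classes y x = {cls p | p. dpath x p y \<and> reduced p}"

lemma local_system_reduced: "local_system (reduced_classes y) act"
  unfolding local_system_def
proof (intro conjI ballI allI impI)
  fix e s assume e: "e \<in> E" and "s \<in> reduced_classes y (src e)"
  then obtain p where p: "s = cls p" "dpath (src e) p y" "reduced p"
    by (auto simp: reduced_classes_def)
  show "act e s \<in> reduced_classes y (tgt e)"
    using p e reduced_move dpath_move by (auto simp: reduced_classes_def act_cls)
  show "act (rev e) (act e s) = s" using p e move_rev by (simp add: act_cls cls_eq)
next
  fix e f s assume "perp e f" "s \<in> reduced_classes y (src e)"
  then obtain p where "s = cls p" unfolding reduced_classes_def by blast
  then show "act (tr e f) (act e s) = act (tr f e) (act f s)"
    using move_square[OF \<open>perp e f\<close>] by (simp add: act_cls cls_eq)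
qed

end

text \<open>In \<open>monodromy\<close> the type of \<open>s\<close> is fixed, since an assumption
  of a locale cannot quantify over types. It is chosen to fit the system of classes of reduced paths
  to a base point.\<close>

locale simply_connected_dart_complex = dart_complex E src rev perp tr
  for E :: "'e set" and src :: "'e \<Rightarrow> 'v" and rev perp tr +
  fixes V :: "'v set"
  assumes src_V: "e \<in> E \<Longrightarrow> src e \<in> V"
    and connected: "x \<in> V \<Longrightarrow> y \<in> V \<Longrightarrow> \<exists>p. dpath x p y"
    and monodromy: "local_system M t \<Longrightarrow> dpath x p x \<Longrightarrow> (s :: 'e list set) \<in> M x \<Longrightarrow> fold t p s = s"
begin

lemma dpath_append: "dpath x (p @ q) y \<longleftrightarrow> (\<exists>z. dpath x p z \<and> dpath z q y)"
  by (induction p arbitrary: x) auto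

definition backward :: "'e list \<Rightarrow> 'e list" where "backward p = map rev (List.rev p)"

lemma dpath_backward: "dpath x p y \<Longrightarrow> dpath y (backward p) x"
  by (induction p arbitrary: x) (auto simp: backward_def dpath_append rev_in rev_rev)

lemma length_backward: "length (backward p) = length p"
  by (simp add: backward_def)

text \<open>Walking back along a reduced path rebuilds it dart by dart, as nothing ever
  cancels.\<close>

lemma fold_act_reduced:
  assumes "reduced p" "dpath x p y"
  shows "fold act (backward p) (cls []) = cls p"
  using assms
proof (induction p arbitrary: x)
  case (Cons d p)
  then show ?case using rev_rev by (auto simp: backward_def act_cls move_ascends)
qed (simp add: backward_def)

text \<open>The class of \<open>p\<close> has trivial holonomy along \<open>q\<close> and back, and
  the empty path along \<open>p\<close> backwards followed by \<open>q\<close>. By the second,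
  \<open>q\<close> carries \<open>p\<close> to the empty path; going back along \<open>q\<close>
  rebuilds \<open>q\<close>, and by the first it also returns to \<open>p\<close>.\<close>

lemma reduced_unique:
  assumes "reduced p" "dpath x p y" "reduced q" "dpath x q y"
  shows "eqv p q"
proof -
  have s: "cls p \<in> reduced_classes y x" using assms by (auto simp: reduced_classes_def)
  have "fold act (q @ backward q) (cls p) = cls p"
    using monodromy[OF local_system_reduced _ s] assms dpath_append dpath_backward by blast
  then have 1: "fold act (backward q) (fold act q (cls p)) = cls p" by simp
  have "cls [] \<in> reduced_classes y y"
    unfolding reduced_classes_def by (intro CollectI exI[of _ "[]"]) simp
  moreover have "dpath y (backward p @ q) y" using assms dpath_append dpath_backward by blast
  ultimately have "fold act (backward p @ q) (cls []) = cls []"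
    using monodromy[OF local_system_reduced] by blast
  then have "fold act q (cls p) = cls []" using fold_act_reduced[OF assms(1,2)] by simp
  then have "cls p = cls q" using 1 fold_act_reduced[OF assms(3,4)] by simp
  then show ?thesis by (simp only: cls_eq)
qed

lemma reduced_exists:
  assumes "x \<in> V" "y \<in> V"
  obtains p where "reduced p" "dpath x p y"
proof -
  obtain q where q: "dpath x q y" using connected assms by blast
  have "\<exists>p. reduced p \<and> dpath x p y" using q
  proof (induction q arbitrary: x)
    case Nil
    then show ?case by (intro exI[of _ "[]"]) auto
  next
    case (Cons d q)
    then obtain p where p: "reduced p" "dpath (tgt d) p y" by auto
    then have "reduced (move (rev d) p)" "dpath x (move (rev d) p) y"
      using Cons.prems reduced_move[of "rev d" p] dpath_move[of "rev d" "tgt d" p y]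
      by (auto simp: rev_rev rev_in)
    then show ?case by blast
  qed
  then show thesis using that by blast
qed

section \<open>The graph distance and its change along a dart\<close>

definition gdist :: "'v \<Rightarrow> 'v \<Rightarrow> nat" where
  "gdist x y = (LEAST n. \<exists>p. dpath x p y \<and> length p = n)"

lemma gdist_le: "dpath x p y \<Longrightarrow> gdist x y \<le> length p"
  unfolding gdist_def by (rule Least_le) blast

lemma dpath_V: "dpath x p y \<Longrightarrow> y \<in> V \<Longrightarrow> x \<in> V"
  by (cases p) (auto simp: src_V)

lemma gdist_path:
  assumes "x \<in> V" "y \<in> V"
  obtains p where "dpath x p y" "length p = gdist x y"
proof -
  obtain p where "dpath x p y" using connected assms by blast
  then have "\<exists>n p. dpath x p y \<and> length p = n" by blast
  from LeastI_ex[OF this] show thesis using that unfolding gdist_def by blast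
qed

lemma gdist_sym: "x \<in> V \<Longrightarrow> y \<in> V \<Longrightarrow> gdist x y = gdist y x"
  by (metis antisym dpath_backward gdist_le gdist_path length_backward)

lemma gdist_refl [simp]: "gdist x x = 0"
  using gdist_le[of x "[]" x] by simp

lemma gdist_triangle: "x \<in> V \<Longrightarrow> y \<in> V \<Longrightarrow> z \<in> V \<Longrightarrow> gdist x z \<le> gdist x y + gdist y z"
proof -
  assume V: "x \<in> V" "y \<in> V" "z \<in> V"
  obtain p where p: "dpath x p y" "length p = gdist x y" using gdist_path V by blast
  obtain q where q: "dpath y q z" "length q = gdist y z" using gdist_path V by blast
  have "dpath x (p @ q) z" using p q dpath_append by blast
  from gdist_le[OF this] show ?thesis using p q by simp
qed

lemma gdist_eq_0: "x \<in> V \<Longrightarrow> y \<in> V \<Longrightarrow> gdist x y = 0 \<Longrightarrow> x = y"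
  by (metis dpath.simps(1) gdist_path length_0_conv)

lemma gdist_dart: "e \<in> E \<Longrightarrow> gdist (src e) (tgt e) \<le> 1"
  using gdist_le[of "src e" "[e]" "tgt e"] by simp

text \<open>Any path can be made reduced without getting longer, and reduced paths with the same
  ends have equal length by uniqueness.\<close>

lemma gdist_reduced:
  assumes "y \<in> V" "reduced p" "dpath x p y"
  shows "gdist x y = length p"
proof -
  have *: "\<exists>r. reduced r \<and> dpath x r y \<and> length r \<le> length q" if "dpath x q y" for q x
    using that
  proof (induction q arbitrary: x)
    case Nil
    then show ?case by (intro exI[of _ "[]"]) auto
  next
    case (Cons d q)
    then obtain p where p: "reduced p" "dpath (tgt d) p y" "length p \<le> length q" by auto
    have "length (move (rev d) p) \<le> Suc (length p)"
      using eqv_length[OF move_descends, of "rev d" p] move_ascends[of "rev d" p]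
      by (cases "descends (rev d) p") auto
    moreover have "reduced (move (rev d) p)" "dpath x (move (rev d) p) y"
      using p Cons.prems reduced_move[of "rev d" p] dpath_move[of "rev d" "tgt d" p y]
      by (auto simp: rev_rev rev_in)
    ultimately show ?case using p by (metis (no_types) Suc_le_mono le_trans length_Cons)
  qed
  obtain q where q: "dpath x q y" "length q = gdist x y"
    using gdist_path assms dpath_V by metis
  obtain r where "reduced r" "dpath x r y" "length r \<le> length q" using * q by blast
  then have "length p \<le> gdist x y"
    using reduced_unique[OF assms(2,3)] eqv_length q by fastforce
  then show ?thesis using gdist_le[OF assms(3)] by simp
qed

definition toward :: "'v \<Rightarrow> 'e \<Rightarrow> bool" where
  "toward y e \<longleftrightarrow> gdist (tgt e) y < gdist (src e) y"

text \<open>Moving along \<open>e\<close> removes or adds exactly one dart of the reduced path. In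
  particular the two ends of a dart are never equidistant from \<open>y\<close>: the graph is
  bipartite.\<close>

lemma toward_iff_descends:
  assumes "e \<in> E" "y \<in> V" "reduced p" "dpath (src e) p y"
  shows "toward y e \<longleftrightarrow> descends e p"
    and "toward y e \<Longrightarrow> gdist (src e) y = Suc (gdist (tgt e) y)"
    and "\<not> toward y e \<Longrightarrow> gdist (tgt e) y = Suc (gdist (src e) y)"
proof -
  have 1: "gdist (src e) y = length p" using gdist_reduced assms by blast
  have 2: "gdist (tgt e) y = length (move e p)"
    using gdist_reduced assms reduced_move dpath_move by blast
  have 3: "descends e p \<Longrightarrow> length p = Suc (length (move e p))"
    using eqv_length[OF move_descends] by simp
  have 4: "\<not> descends e p \<Longrightarrow> length (move e p) = Suc (length p)"
    by (simp add: move_ascends)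
  show 5: "toward y e \<longleftrightarrow> descends e p"
    using 3 4 by (cases "descends e p") (simp_all add: toward_def 1 2)
  show "toward y e \<Longrightarrow> gdist (src e) y = Suc (gdist (tgt e) y)"
    "\<not> toward y e \<Longrightarrow> gdist (tgt e) y = Suc (gdist (src e) y)"
    using 3 4 5 by (simp_all add: 1 2)
qed

lemma toward_Suc: "e \<in> E \<Longrightarrow> y \<in> V \<Longrightarrow> toward y e \<Longrightarrow> gdist (src e) y = Suc (gdist (tgt e) y)"
  using reduced_exists[OF src_V] toward_iff_descends(2) by metis

lemma away_Suc: "e \<in> E \<Longrightarrow> y \<in> V \<Longrightarrow> \<not> toward y e \<Longrightarrow> gdist (tgt e) y = Suc (gdist (src e) y)"
  using reduced_exists[OF src_V] toward_iff_descends(3) by metis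

lemma toward_rev: "e \<in> E \<Longrightarrow> y \<in> V \<Longrightarrow> toward y (rev e) \<longleftrightarrow> \<not> toward y e"
  using toward_Suc away_Suc rev_rev unfolding toward_def by fastforce

lemma toward_parallel:
  assumes "perp e f" "y \<in> V"
  shows "toward y (tr f e) \<longleftrightarrow> toward y e"
proof -
  have E: "e \<in> E" "f \<in> E" "tr f e \<in> E" "src e = src f" "src (tr f e) = tgt f"
    using perp_dart perp_dart2 tr_dart perp_src src_tr perp_sym assms by blast+
  obtain p where p: "reduced p" "dpath (src e) p y"
    using reduced_exists src_V E assms by metis
  have "reduced (move f p)" "dpath (src (tr f e)) (move f p) y"
    using p E reduced_move dpath_move by auto
  then show ?thesis
    using toward_iff_descends(1) E assms p descends_parallel by metis
qed

text \<open>The quadrangle condition of median graphs. Both \<open>e\<close> and \<open>f\<close>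
  can be made the first dart of one reduced path, so the exchange property puts a square between
  them and the path through its opposite corner.\<close>

lemma quadrangle:
  assumes "e \<in> E" "f \<in> E" "src e = src f" "e \<noteq> f" "y \<in> V" "toward y e" "toward y f"
  shows "perp e f" "gdist (src e) y = Suc (Suc (gdist (tgt (tr e f)) y))"
proof -
  obtain p where p: "reduced p" "dpath (src e) p y"
    using reduced_exists src_V assms by metis
  have d: "descends e p" "descends f p"
    using p toward_iff_descends(1) assms by metis+
  then have "eqv (e # move e p) (f # move f p)"
    using move_descends eqv_sym eqv_trans by blast
  then obtain z where ef: "perp e f" and "eqv (move e p) (tr e f # z)"
    using assms(4) by (auto elim: eqv_ConsE)
  then have r: "eqv p (e # tr e f # z)" using move_descends[OF d(1)] eqv_Cons eqv_trans by blast
  then have "reduced (e # tr e f # z)" "dpath (src e) (e # tr e f # z) y"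
    using p reduced_eqv eqv_dpath by blast+
  then have "gdist (tgt (tr e f)) y = length z" by (auto intro: gdist_reduced[OF assms(5)])
  moreover have "gdist (src e) y = Suc (Suc (length z))"
    using gdist_reduced[OF assms(5) p] eqv_length[OF r] by simp
  ultimately show "perp e f" "gdist (src e) y = Suc (Suc (gdist (tgt (tr e f)) y))"
    using ef by auto
qed

section \<open>Half-spaces of darts and the half-spaces that separate two vertices\<close>

definition halfspace :: "'e \<Rightarrow> 'v set" where
  "halfspace e = {y \<in> V. toward y e}"

definition halfspaces :: "'v set set" where
  "halfspaces = halfspace ` E"

lemma halfspace_parallel: "perp e f \<Longrightarrow> halfspace (tr f e) = halfspace e"
  unfolding halfspace_def using toward_parallel by blast

lemma tgt_in_halfspace: "e \<in> E \<Longrightarrow> tgt e \<in> halfspace e"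
  and src_notin_halfspace: "src e \<notin> halfspace e"
proof -
  assume e: "e \<in> E"
  have "\<not> toward (tgt e) (rev e)" by (simp add: toward_def)
  then show "tgt e \<in> halfspace e" using toward_rev e by (simp add: halfspace_def src_V rev_in)
next
  show "src e \<notin> halfspace e" by (simp add: halfspace_def toward_def)
qed

text \<open>The dart \<open>e\<close> is pushed across squares towards \<open>a\<close>, along a
  geodesic from \<open>src e\<close> to \<open>src a\<close>, until it coincides with
  \<open>a\<close>; each push preserves its half-space.\<close>

lemma separating_dart_unique:
  assumes "a \<in> E" "e \<in> E" "src a \<notin> halfspace e" "tgt a \<in> halfspace e"
  shows "halfspace e = halfspace a"
  using assms(2-)
proof (induction "gdist (src e) (src a)" arbitrary: e)
  have V: "src a \<in> V" "tgt a \<in> V" using assms src_V rev_in by auto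
  \<comment> \<open>Crossing \<open>a\<close> changes a distance by at most 1, yet it turns
    \<open>e\<close> from pointing away to pointing towards; this forces both equations.\<close>
  have key: "gdist (src e) (tgt a) = Suc (gdist (src e) (src a))"
    "gdist (tgt e) (tgt a) = gdist (src e) (src a)"
    if "e \<in> E" "src a \<notin> halfspace e" "tgt a \<in> halfspace e" for e
  proof -
    have e: "src e \<in> V" "tgt e \<in> V" "\<not> toward (src a) e" "toward (tgt a) e"
      using that V src_V rev_in by (auto simp: halfspace_def)
    have "gdist (src e) (tgt a) \<le> gdist (src e) (src a) + 1"
      using gdist_triangle[of "src e" "src a" "tgt a"] gdist_dart assms e V by fastforce
    moreover have "gdist (tgt a) (src a) \<le> 1"
      using gdist_dart[of "rev a"] assms rev_in rev_rev by simp
    then have "gdist (tgt e) (src a) \<le> gdist (tgt e) (tgt a) + 1"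
      using gdist_triangle[of "tgt e" "tgt a" "src a"] assms e V by fastforce
    ultimately show "gdist (src e) (tgt a) = Suc (gdist (src e) (src a))"
      "gdist (tgt e) (tgt a) = gdist (src e) (src a)"
      using toward_Suc[of e "tgt a"] away_Suc[of e "src a"] that e V by linarith+
  qed
  {
    case 0
    have "src e = src a" "tgt e = tgt a"
      using gdist_eq_0 key[OF 0(2-)] 0 V src_V rev_in by metis+
    \<comment> \<open>Two different darts with the same ends would span a square by
      \<open>quadrangle\<close>, which puts \<open>src e\<close> at distance at least 2 from
      \<open>tgt a\<close>, whereas \<open>key\<close> gives 1.\<close>
    have "e = a"
    proof (rule ccontr)
      assume "e \<noteq> a"
      moreover have "toward (tgt a) a" "toward (tgt a) e"
        using 0 tgt_in_halfspace[OF assms(1)] by (auto simp: halfspace_def)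
      ultimately show False
        using quadrangle(2)[of e a "tgt a"] 0 assms V key[OF 0(2-)] \<open>src e = src a\<close> by simp
    qed
    then show ?case by simp
  next
    case (Suc k)
    have eV: "src e \<in> V" using Suc src_V by auto
    obtain p where p: "dpath (src e) p (src a)" "length p = gdist (src e) (src a)"
      using gdist_path eV V by blast
    then obtain f p' where f: "p = f # p'" using Suc.hyps(2) by (cases p) auto
    then have fE: "f \<in> E" "src f = src e" and "gdist (tgt f) (src a) \<le> k"
      using p gdist_le[of "tgt f" p' "src a"] Suc.hyps(2) by auto
    then have tf: "toward (src a) f" "gdist (tgt f) (src a) = k"
      using Suc.hyps(2) toward_Suc[OF fE(1) V(1)] by (auto simp: toward_def)
    have "gdist (tgt f) (tgt a) \<le> gdist (tgt f) (src a) + 1"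
      using gdist_triangle[of "tgt f" "src a" "tgt a"] gdist_dart[OF assms(1)] V src_V rev_in fE
      by fastforce
    then have "toward (tgt a) f"
      using key(1)[OF Suc.prems] tf Suc.hyps(2) fE by (simp add: toward_def)
    moreover have "toward (tgt a) e" "\<not> toward (src a) e" using Suc.prems V by (auto simp: halfspace_def)
    \<comment> \<open>Both \<open>e\<close> and \<open>f\<close> lead towards \<open>tgt a\<close>,
      and they differ because only \<open>f\<close> leads towards \<open>src a\<close>.\<close>
    ultimately have "perp e f" using quadrangle(1)[of e f "tgt a"] tf fE Suc.prems V by auto
    then have "halfspace (tr f e) = halfspace e" "tr f e \<in> E" "src (tr f e) = tgt f"
      using halfspace_parallel tr_dart src_tr perp_sym by blast+
    then show ?case using Suc.hyps(1)[of "tr f e"] tf Suc.prems by simp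
  }
qed

lemma separating_halfspaces_dart:
  assumes "a \<in> E"
  shows "{D \<in> halfspaces. tgt a \<in> D \<and> src a \<notin> D} = {halfspace a}"
proof
  show "{D \<in> halfspaces. tgt a \<in> D \<and> src a \<notin> D} \<subseteq> {halfspace a}"
    unfolding halfspaces_def using separating_dart_unique[OF assms] by blast
  show "{halfspace a} \<subseteq> {D \<in> halfspaces. tgt a \<in> D \<and> src a \<notin> D}"
    unfolding halfspaces_def using tgt_in_halfspace[OF assms] src_notin_halfspace[of a] assms by blast
qed

lemma finite_separating:
  assumes "x \<in> V" "y \<in> V"
  shows "finite {D \<in> halfspaces. y \<in> D \<and> x \<notin> D}"
proof -
  obtain p where "dpath x p y" using connected assms by blast
  then show ?thesis
  proof (induction p arbitrary: x)
    case (Cons d p)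
    have "{D \<in> halfspaces. y \<in> D \<and> x \<notin> D} \<subseteq>
        {D \<in> halfspaces. tgt d \<in> D \<and> src d \<notin> D} \<union> {D \<in> halfspaces. y \<in> D \<and> tgt d \<notin> D}"
      using Cons by auto
    moreover have "d \<in> E" using Cons by simp
    moreover have "finite {D \<in> halfspaces. y \<in> D \<and> tgt d \<notin> D}" using Cons by auto
    ultimately show ?case
      unfolding separating_halfspaces_dart[OF \<open>d \<in> E\<close>] using finite_subset by blast
  qed auto
qed

text \<open>The first dart \<open>d\<close> of a geodesic from \<open>x\<close> contributes the new
  half-space \<open>halfspace d\<close>. The half-spaces for the rest still omit \<open>x\<close>,
  since the only one left by walking along \<open>d\<close> is that of \<open>rev d\<close>, which
  does not contain \<open>y\<close>.\<close>

lemma gdist_le_card_separating: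
  assumes "x \<in> V" "y \<in> V"
  shows "gdist x y \<le> card {D \<in> halfspaces. y \<in> D \<and> x \<notin> D}"
  using assms
proof (induction "gdist x y" arbitrary: x)
  case (Suc n)
  obtain p where p: "dpath x p y" "length p = gdist x y" using gdist_path Suc by blast
  then obtain d p' where d: "p = d # p'" using Suc.hyps(2) by (cases p) auto
  then have dE: "d \<in> E" "src d = x" "tgt d \<in> V" and "gdist (tgt d) y \<le> n"
    using p gdist_le[of "tgt d" p' y] Suc.hyps(2) rev_in src_V by auto
  then have td: "toward y d" "gdist (tgt d) y = n"
    using Suc.hyps(2) toward_Suc[OF dE(1) Suc.prems(2)] by (auto simp: toward_def)
  let ?S = "{D \<in> halfspaces. y \<in> D \<and> tgt d \<notin> D}"
  have "D \<noteq> halfspace (rev d)" if "y \<in> D" for D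
    using that td toward_rev[OF dE(1)] Suc.prems by (auto simp: halfspace_def)
  have "x \<notin> D" if D: "D \<in> ?S" for D
  proof
    assume "x \<in> D"
    then have "D \<in> {D \<in> halfspaces. tgt (rev d) \<in> D \<and> src (rev d) \<notin> D}"
      using D dE rev_rev[OF dE(1)] by simp
    then have "D = halfspace (rev d)"
      unfolding separating_halfspaces_dart[OF rev_in[OF dE(1)]] by simp
    then show False using D \<open>\<And>D. y \<in> D \<Longrightarrow> D \<noteq> halfspace (rev d)\<close> by blast
  qed
  moreover have "halfspace d \<in> halfspaces" using dE by (simp add: halfspaces_def)
  moreover have "y \<in> halfspace d" using td Suc.prems by (simp add: halfspace_def)
  moreover have "x \<notin> halfspace d" using dE src_notin_halfspace[of d] by simp
  ultimately have "insert (halfspace d) ?S \<subseteq> {D \<in> halfspaces. y \<in> D \<and> x \<notin> D}" by auto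
  then have "card (insert (halfspace d) ?S) \<le> card {D \<in> halfspaces. y \<in> D \<and> x \<notin> D}"
    by (rule card_mono[OF finite_separating[OF Suc.prems]])
  moreover have "card (insert (halfspace d) ?S) = Suc (card ?S)"
  proof (rule card_insert_disjoint)
    show "finite ?S" using finite_separating dE Suc.prems by blast
    show "halfspace d \<notin> ?S" using tgt_in_halfspace[OF dE(1)] by blast
  qed
  moreover have "n \<le> card ?S" using Suc.hyps(1)[of "tgt d"] td dE Suc.prems by simp
  ultimately show ?case using Suc.hyps(2) by simp
qed simp

end

section \<open>Faces of the standard cube\<close>

definition cube_corners :: "nat \<Rightarrow> (nat \<Rightarrow> real) set" where
  "cube_corners n = {..<n} \<rightarrow>\<^sub>E {0, 1}"

text \<open>
  Faces in coordinates: coordinate \<open>i\<close> of a point of the face is coordinate \<open>c i\<close> of its parameter,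
  reflected if \<open>u i = 1\<close>. It has the constant value \<open>u i\<close> if \<open>c i \<ge> k\<close>.
\<close>

definition emb :: "nat \<Rightarrow> nat \<Rightarrow> (nat \<Rightarrow> nat) \<Rightarrow> (nat \<Rightarrow> real) \<Rightarrow> (nat \<Rightarrow> real) \<Rightarrow> (nat \<Rightarrow> real)" where
  "emb k m c u = (\<lambda>r\<in>unit_cube k. \<lambda>i\<in>{..<m}. \<bar>u i - (if c i < k then r (c i) else 0)\<bar>)"

definition emb_data :: "nat \<Rightarrow> nat \<Rightarrow> (nat \<Rightarrow> nat) \<Rightarrow> (nat \<Rightarrow> real) \<Rightarrow> bool" where
  "emb_data k m c u \<longleftrightarrow> u \<in> cube_corners m \<and> bij_betw c {i. i < m \<and> c i < k} {..<k}"

lemma unit_cubeD: "r \<in> unit_cube k \<Longrightarrow> j < k \<Longrightarrow> 0 \<le> r j \<and> r j \<le> 1"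
  unfolding unit_cube_def PiE_iff by auto

lemma cube_cornersD: "r \<in> cube_corners k \<Longrightarrow> j < k \<Longrightarrow> r j = 0 \<or> r j = 1"
  unfolding cube_corners_def PiE_iff by auto

lemma open_cubeD: "r \<in> open_cube k \<Longrightarrow> j < k \<Longrightarrow> 0 < r j \<and> r j < 1"
  unfolding open_cube_def PiE_iff by auto

lemma corners_in_cube: "r \<in> cube_corners k \<Longrightarrow> r \<in> unit_cube k"
proof -
  assume r: "r \<in> cube_corners k"
  have "0 \<le> r j \<and> r j \<le> 1" if "j < k" for j using cube_cornersD[OF r that] by auto
  then show ?thesis using r by (simp add: cube_corners_def unit_cube_def PiE_iff)
qed

lemma open_in_cube: "r \<in> open_cube k \<Longrightarrow> r \<in> unit_cube k"
  unfolding open_cube_def unit_cube_def PiE_iff greaterThanLessThan_iff atLeastAtMost_iff by (simp add: less_imp_le)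

lemma unit_cube_eqI:
  "p \<in> unit_cube m \<Longrightarrow> q \<in> unit_cube m \<Longrightarrow> (\<And>i. i < m \<Longrightarrow> p i = q i) \<Longrightarrow> p = q"
  unfolding unit_cube_def by (rule PiE_ext) auto

lemma origin_corner: "cube_origin n \<in> cube_corners n"
  by (auto simp: cube_origin_def cube_corners_def)

lemma origin_apply [simp]: "i < n \<Longrightarrow> cube_origin n i = 0"
  by (simp add: cube_origin_def)

lemma emb_apply [simp]:
  "r \<in> unit_cube k \<Longrightarrow> i < m \<Longrightarrow> emb k m c u r i = \<bar>u i - (if c i < k then r (c i) else 0)\<bar>"
  by (simp add: emb_def)

lemma emb_data_corner: "emb_data k m c u \<Longrightarrow> u \<in> cube_corners m"
  by (simp add: emb_data_def)

lemma emb_in_cube: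
  assumes "emb_data k m c u" "r \<in> unit_cube k"
  shows "emb k m c u r \<in> unit_cube m"
proof -
  have "emb k m c u r i \<in> {0..1}" if "i < m" for i
  proof -
    have "u i = 0 \<or> u i = 1" using assms that cube_cornersD by (auto simp: emb_data_def)
    then show ?thesis using unit_cubeD[OF assms(2), of "c i"] assms(2) that by auto
  qed
  then show ?thesis using assms(2) by (auto simp: unit_cube_def emb_def)
qed

lemma emb_corner:
  assumes "emb_data k m c u" "r \<in> cube_corners k"
  shows "emb k m c u r \<in> cube_corners m"
proof -
  have r: "r \<in> unit_cube k" using assms corners_in_cube by blast
  have "emb k m c u r i \<in> {0,1}" if "i < m" for i
  proof -
    have "u i = 0 \<or> u i = 1" using assms that cube_cornersD by (auto simp: emb_data_def)
    then show ?thesis using cube_cornersD[OF assms(2), of "c i"] r that by auto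
  qed
  then show ?thesis using r by (auto simp: cube_corners_def emb_def)
qed

lemma emb_origin:
  assumes "emb_data k m c u"
  shows "emb k m c u (cube_origin k) = u"
proof (rule unit_cube_eqI)
  fix i assume "i < m"
  moreover have "u i = 0 \<or> u i = 1" using assms \<open>i < m\<close> cube_cornersD by (auto simp: emb_data_def)
  ultimately show "emb k m c u (cube_origin k) i = u i"
    using corners_in_cube[OF origin_corner] by auto
qed (use assms emb_in_cube corners_in_cube origin_corner emb_data_corner in blast)+

lemma emb_dist:
  assumes "emb_data k m c u" "p \<in> unit_cube k" "q \<in> unit_cube k"
  shows "cube_dist m (emb k m c u p) (emb k m c u q) = cube_dist k p q"
proof -
  let ?I = "{i. i < m \<and> c i < k}"
  have *: "(emb k m c u p i - emb k m c u q i)\<^sup>2 = (if c i < k then (p (c i) - q (c i))\<^sup>2 else 0)"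
    if "i < m" for i
  proof -
    have "u i = 0 \<or> u i = 1" using assms that cube_cornersD by (auto simp: emb_data_def)
    then show ?thesis
      using unit_cubeD[OF assms(2), of "c i"] unit_cubeD[OF assms(3), of "c i"] assms that
      by (auto simp: power2_commute)
  qed
  have "(\<Sum>i<m. (emb k m c u p i - emb k m c u q i)\<^sup>2) =
      (\<Sum>i<m. if c i < k then (p (c i) - q (c i))\<^sup>2 else 0)"
    using * by (intro sum.cong) auto
  also have "\<dots> = (\<Sum>i\<in>?I. (p (c i) - q (c i))\<^sup>2)"
    by (intro sum.mono_neutral_cong_right) auto
  also have "\<dots> = (\<Sum>j<k. (p j - q j)\<^sup>2)"
    using assms(1) by (intro sum.reindex_bij_betw) (simp add: emb_data_def)
  finally show ?thesis by (simp add: cube_dist_def L2_set_def)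
qed

lemma emb_surj_face:
  assumes "emb_data k m c u" "q \<in> unit_cube m" "\<And>i. i < m \<Longrightarrow> \<not> c i < k \<Longrightarrow> q i = u i"
  obtains r where "r \<in> unit_cube k" "emb k m c u r = q"
    "(\<And>i. i < m \<Longrightarrow> c i < k \<Longrightarrow> 0 < q i \<and> q i < 1) \<Longrightarrow> r \<in> open_cube k"
proof -
  let ?I = "{i. i < m \<and> c i < k}"
  define d where "d = inv_into ?I c"
  define r where "r = (\<lambda>j\<in>{..<k}. \<bar>u (d j) - q (d j)\<bar>)"
  have bij: "bij_betw c ?I {..<k}" using assms(1) by (simp add: emb_data_def)
  have u01: "u i = 0 \<or> u i = 1" if "i < m" for i
    using assms(1) that cube_cornersD by (auto simp: emb_data_def)
  have d: "d j < m" "c (d j) = j" if "j < k" for j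
    using that bij bij_betw_inv_into_right[OF bij, of j] inv_into_into[of j c ?I]
    by (auto simp: d_def bij_betw_def)
  have dc: "d (c i) = i" if "i < m" "c i < k" for i
    using bij_betw_inv_into_left[OF bij, of i] that by (simp add: d_def)
  have r: "r \<in> unit_cube k"
    using u01[OF d(1)] unit_cubeD[OF assms(2) d(1)] by (fastforce simp: unit_cube_def r_def)
  moreover have "emb k m c u r = q"
  proof (rule unit_cube_eqI[OF emb_in_cube[OF assms(1) r] assms(2)])
    fix i assume i: "i < m"
    show "emb k m c u r i = q i"
    proof (cases "c i < k")
      case True
      then show ?thesis
        using r i dc[OF i True] u01[OF i] unit_cubeD[OF assms(2) i] by (auto simp: r_def)
    next
      case False
      then show ?thesis using r i assms(3) u01[OF i] by auto
    qed
  qed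
  moreover have "r \<in> open_cube k" if op: "\<And>i. i < m \<Longrightarrow> c i < k \<Longrightarrow> 0 < q i \<and> q i < 1"
  proof -
    have "0 < r j \<and> r j < 1" if "j < k" for j
      using u01[OF d(1)[OF that]] op[OF d(1)[OF that]] d(2)[OF that] that by (auto simp: r_def)
    then show ?thesis by (auto simp: open_cube_def r_def)
  qed
  ultimately show thesis using that by blast
qed

lemma emb_face_isometry:
  assumes "emb_data k m c u"
  shows "face_isometry k m (emb k m c u)"
proof -
  have u01: "u i = 0 \<or> u i = 1" if "i < m" for i
    using assms that cube_cornersD by (auto simp: emb_data_def)
  let ?J = "{i. i < m \<and> \<not> c i < k}"
  have "emb k m c u ` unit_cube k = {p \<in> unit_cube m. \<forall>j\<in>?J. p j = u j}"
  proof (intro subset_antisym subsetI)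
    fix p assume "p \<in> emb k m c u ` unit_cube k"
    then obtain r where r: "r \<in> unit_cube k" "p = emb k m c u r" by blast
    then show "p \<in> {p \<in> unit_cube m. \<forall>j\<in>?J. p j = u j}"
      using emb_in_cube[OF assms r(1)] u01 by fastforce
  next
    fix p assume "p \<in> {p \<in> unit_cube m. \<forall>j\<in>?J. p j = u j}"
    then show "p \<in> emb k m c u ` unit_cube k"
      using emb_surj_face[OF assms, of p] by blast
  qed
  moreover have "?J \<subseteq> {..<m}" "u \<in> ?J \<rightarrow> {0,1}" using u01 by auto
  ultimately have "is_cube_face m (emb k m c u ` unit_cube k)"
    unfolding is_cube_face_def by blast
  then show ?thesis
    using emb_dist[OF assms] by (auto simp: face_isometry_def emb_def)
qed

text \<open>The value \<open>l\<close> is out of range and so marks a coordinate that is already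
  constant on the larger face.\<close>

definition emb_comp_dir :: "nat \<Rightarrow> nat \<Rightarrow> (nat \<Rightarrow> nat) \<Rightarrow> (nat \<Rightarrow> nat) \<Rightarrow> nat \<Rightarrow> nat" where
  "emb_comp_dir l k c c' = (\<lambda>i. if c i < k then c' (c i) else l)"

lemma emb_comp_data:
  assumes "emb_data k m c u" "emb_data l k c' u'"
  shows "emb_data l m (emb_comp_dir l k c c') (emb k m c u u')"
proof -
  have "bij_betw (c' \<circ> c) {i. i < m \<and> c i < k \<and> c' (c i) < l} {..<l}"
  proof (rule bij_betw_trans)
    show "bij_betw c' {i. i < k \<and> c' i < l} {..<l}" using assms by (simp add: emb_data_def)
    show "bij_betw c {i. i < m \<and> c i < k \<and> c' (c i) < l} {i. i < k \<and> c' i < l}"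
    proof (rule bij_betw_subset[of c "{i. i < m \<and> c i < k}" "{..<k}"])
      show bij: "bij_betw c {i. i < m \<and> c i < k} {..<k}" using assms by (simp add: emb_data_def)
      show "c ` {i. i < m \<and> c i < k \<and> c' (c i) < l} = {i. i < k \<and> c' i < l}"
      proof (intro subset_antisym subsetI)
        fix j assume j: "j \<in> {i. i < k \<and> c' i < l}"
        then have "j \<in> c ` {i. i < m \<and> c i < k}" using bij by (auto simp: bij_betw_def)
        then show "j \<in> c ` {i. i < m \<and> c i < k \<and> c' (c i) < l}" using j by auto
      qed auto
    qed auto
  qed
  moreover have "{i. i < m \<and> emb_comp_dir l k c c' i < l} = {i. i < m \<and> c i < k \<and> c' (c i) < l}"
    by (auto simp: emb_comp_dir_def)
  moreover have "bij_betw (emb_comp_dir l k c c') S T \<longleftrightarrow> bij_betw (c' \<circ> c) S T"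
    if "S = {i. i < m \<and> c i < k \<and> c' (c i) < l}" for S T
    by (rule bij_betw_cong) (auto simp: that emb_comp_dir_def)
  ultimately show ?thesis
    using emb_corner[OF assms(1) emb_data_corner[OF assms(2)]] by (simp add: emb_data_def)
qed

lemma emb_comp:
  assumes "emb_data k m c u" "emb_data l k c' u'" "r \<in> unit_cube l"
  shows "emb k m c u (emb l k c' u' r) = emb l m (emb_comp_dir l k c c') (emb k m c u u') r"
proof (rule unit_cube_eqI)
  have r': "emb l k c' u' r \<in> unit_cube k" using assms emb_in_cube by blast
  have u': "u' \<in> unit_cube k" using assms emb_data_corner corners_in_cube by blast
  fix i assume i: "i < m"
  have u01: "u i = 0 \<or> u i = 1"
    using assms(1) i cube_cornersD by (auto simp: emb_data_def)
  show "emb k m c u (emb l k c' u' r) i = emb l m (emb_comp_dir l k c c') (emb k m c u u') r i"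
  proof (cases "c i < k")
    case True
    have "u' (c i) = 0 \<or> u' (c i) = 1"
      using assms(2) True cube_cornersD by (auto simp: emb_data_def)
    then show ?thesis
      using True u01 i assms(3) r' u' unit_cubeD[OF assms(3), of "c' (c i)"]
      by (auto simp: emb_comp_dir_def)
  next
    case False
    then show ?thesis using u01 i assms(3) r' u' by (auto simp: emb_comp_dir_def)
  qed
qed (use assms emb_in_cube emb_comp_data in blast)+

lemma emb_full:
  assumes "emb_data n n c u"
  shows "i < n \<Longrightarrow> c i < n"
proof -
  have "card {i. i < n \<and> c i < n} = n"
    using assms bij_betw_same_card[of c] by (fastforce simp: emb_data_def)
  then have "{i. i < n \<and> c i < n} = {..<n}"
    by (intro card_subset_eq) auto
  then show "i < n \<Longrightarrow> c i < n" by blast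
qed

lemma emb_open:
  assumes "emb_data n n c u" "r \<in> open_cube n"
  shows "emb n n c u r \<in> open_cube n"
proof -
  have r: "r \<in> unit_cube n" using assms open_in_cube by blast
  have "emb n n c u r i \<in> {0<..<1}" if "i < n" for i
  proof -
    have "u i = 0 \<or> u i = 1" using assms that cube_cornersD by (auto simp: emb_data_def)
    then show ?thesis
      using open_cubeD[OF assms(2) emb_full[OF assms(1) that]] emb_full[OF assms(1) that] r that by auto
  qed
  then show ?thesis using r by (auto simp: open_cube_def emb_def)
qed

lemma minimal_face:
  assumes q: "q \<in> unit_cube m"
  obtains k c u r where "emb_data k m c u" "r \<in> open_cube k" "emb k m c u r = q"
proof -
  define I where "I = {i. i < m \<and> q i \<noteq> 0 \<and> q i \<noteq> 1}"
  have "finite I" by (simp add: I_def)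
  then obtain c0 where c0: "bij_betw c0 I {..<card I}"
    by (metis bij_betw_iff_card card_lessThan finite_lessThan)
  define c where "c = (\<lambda>i. if i \<in> I then c0 i else card I)"
  define u where "u = (\<lambda>i\<in>{..<m}. if i \<in> I then 0 else q i)"
  have cI: "{i. i < m \<and> c i < card I} = I"
    using c0 by (auto simp: c_def I_def bij_betw_def)
  have "bij_betw c I {..<card I}"
    using c0 by (subst bij_betw_cong[of I c c0]) (auto simp: c_def)
  moreover have "u \<in> cube_corners m" by (auto simp: cube_corners_def u_def I_def)
  ultimately have data: "emb_data (card I) m c u" by (simp add: emb_data_def cI)
  have cI': "c i < card I \<longleftrightarrow> i \<in> I" if "i < m" for i using cI that by blast
  obtain r where "emb (card I) m c u r = q"
    "(\<And>i. i < m \<Longrightarrow> c i < card I \<Longrightarrow> 0 < q i \<and> q i < 1) \<Longrightarrow> r \<in> open_cube (card I)"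
  proof (rule emb_surj_face[OF data q])
    fix i assume "i < m" "\<not> c i < card I"
    then show "q i = u i" using cI' by (simp add: u_def)
  qed blast
  moreover have "0 < q i \<and> q i < 1" if "i < m" "c i < card I" for i
    using that cI' unit_cubeD[OF q, of i] by (force simp: I_def)
  ultimately show thesis using that data by blast
qed

text \<open>Isometries of the cube are signed permutations. Corners go to corners because antipodal
  corners realise the greatest distance; the neighbours \<open>b j\<close> of the origin go to
  neighbours of its image \<open>u\<close>, which defines the permutation \<open>\<pi>\<close>; and
  the distances to these corners determine every coordinate.\<close>

lemma face_isometry_emb:
  assumes h: "face_isometry n n h"
  obtains c u where "emb_data n n c u" "h = emb n n c u"
proof -
  have hin: "h p \<in> unit_cube n" if "p \<in> unit_cube n" for p
    using h that by (auto simp: face_isometry_def is_cube_face_def)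
  have sq: "(\<Sum>i<n. (h p i - h q i)\<^sup>2) = (\<Sum>i<n. (p i - q i)\<^sup>2)"
    if "p \<in> unit_cube n" "q \<in> unit_cube n" for p q
    using h that by (auto simp: face_isometry_def cube_dist_def L2_set_def)
  have hcorner: "h p i = 0 \<or> h p i = 1" if p: "p \<in> cube_corners n" and i: "i < n" for p i
  proof -
    define p' where "p' = (\<lambda>i\<in>{..<n}. 1 - p i)"
    have p': "p' \<in> unit_cube n"
      using cube_cornersD[OF p] by (fastforce simp: p'_def unit_cube_def)
    have pc: "p \<in> unit_cube n" using p corners_in_cube by blast
    have "(p i - p' i)\<^sup>2 = 1" if "i < n" for i
      using cube_cornersD[OF p that] that by (auto simp: p'_def)
    then have "(\<Sum>i<n. (h p i - h p' i)\<^sup>2) = (\<Sum>i<n. 1)"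
      using sq[OF pc p'] by simp
    moreover have le: "(h p i - h p' i)\<^sup>2 \<le> 1" if "i < n" for i
      using unit_cubeD[OF hin[OF pc] that] unit_cubeD[OF hin[OF p'] that]
      by (simp add: abs_square_le_1 abs_le_iff)
    ultimately have "(h p i - h p' i)\<^sup>2 = 1"
      using sum_mono_inv[of "\<lambda>i. (h p i - h p' i)\<^sup>2" "{..<n}" "\<lambda>i. 1" i] i by simp
    then have "h p i - h p' i = 1 \<or> h p i - h p' i = -1" by (simp add: power2_eq_1_iff)
    then show ?thesis using unit_cubeD[OF hin[OF pc] i] unit_cubeD[OF hin[OF p'] i] by auto
  qed
  define u where "u = h (cube_origin n)"
  have o: "cube_origin n \<in> unit_cube n" using origin_corner corners_in_cube by blast
  have uc: "u \<in> cube_corners n"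
    using hcorner[OF origin_corner] hin[OF o] by (fastforce simp: u_def cube_corners_def unit_cube_def)
  have u01: "u i = 0 \<or> u i = 1" if "i < n" for i using cube_cornersD[OF uc that] .
  define b where "b = (\<lambda>j. \<lambda>i\<in>{..<n}. if i = j then 1 else 0 :: real)"
  have bc: "b j \<in> cube_corners n" for j by (auto simp: b_def cube_corners_def)
  have bu: "b j \<in> unit_cube n" for j using bc corners_in_cube by blast
  have "\<exists>i<n. \<forall>i'<n. (h (b j) i' = u i') \<longleftrightarrow> i' \<noteq> i" if j: "j < n" for j
  proof -
    let ?S = "{i. i < n \<and> h (b j) i \<noteq> u i}"
    have "(\<Sum>i<n. (b j i - cube_origin n i)\<^sup>2) = (\<Sum>i<n. if i = j then 1 else 0)"
      by (intro sum.cong) (auto simp: b_def)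
    also have "\<dots> = 1" using j by simp
    finally have "(\<Sum>i<n. (h (b j) i - u i)\<^sup>2) = 1"
      using sq[OF bu o] by (simp add: u_def)
    moreover have "(\<Sum>i<n. (h (b j) i - u i)\<^sup>2) = (\<Sum>i<n. if h (b j) i \<noteq> u i then 1 else 0)"
    proof (rule sum.cong)
      show "{..<n} = {..<n}" ..
      fix i assume "i \<in> {..<n}"
      then show "(h (b j) i - u i)\<^sup>2 = (if h (b j) i \<noteq> u i then 1 else 0)"
        using hcorner[OF bc[of j], of i] u01[of i] by auto
    qed
    moreover have "\<dots> = (\<Sum>i\<in>?S. 1)" by (intro sum.mono_neutral_cong_right) auto
    ultimately have "card ?S = 1" by simp
    then obtain i where "?S = {i}" by (auto simp: card_1_singleton_iff)
    then show ?thesis by blast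
  qed
  then obtain \<pi> where \<pi>: "\<And>j. j < n \<Longrightarrow> \<pi> j < n"
    "\<And>j i. j < n \<Longrightarrow> i < n \<Longrightarrow> h (b j) i = u i \<longleftrightarrow> i \<noteq> \<pi> j" by metis
  \<comment> \<open>Polarisation: \<open>u\<close> and \<open>h (b j)\<close> differ only in
    coordinate \<open>\<pi> j\<close>, so the difference of the squared distances to them isolates
    that coordinate of \<open>h r\<close>.\<close>
  have key: "h r (\<pi> j) = \<bar>u (\<pi> j) - r j\<bar>" if r: "r \<in> unit_cube n" and j: "j < n" for r j
  proof -
    have split: "(\<Sum>i<n. f i) = f a + (\<Sum>i\<in>{..<n} - {a}. f i)" if "a < n" for f :: "nat \<Rightarrow> real" and a
      using that by (intro sum.remove) auto
    have 1: "(h r (\<pi> j) - u (\<pi> j))\<^sup>2 + (\<Sum>i\<in>{..<n} - {\<pi> j}. (h r i - u i)\<^sup>2) =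
        (r j)\<^sup>2 + (\<Sum>i\<in>{..<n} - {j}. (r i)\<^sup>2)"
      using sq[OF r o] split[OF \<pi>(1)[OF j], of "\<lambda>i. (h r i - u i)\<^sup>2"] split[OF j, of "\<lambda>i. (r i)\<^sup>2"]
      by (simp add: u_def)
    have 2: "(\<Sum>i<n. (h r i - h (b j) i)\<^sup>2) = (\<Sum>i<n. (r i - b j i)\<^sup>2)" using sq[OF r bu] .
    have 3: "(\<Sum>i\<in>{..<n} - {\<pi> j}. (h r i - h (b j) i)\<^sup>2) = (\<Sum>i\<in>{..<n} - {\<pi> j}. (h r i - u i)\<^sup>2)"
    proof (rule sum.cong)
      show "{..<n} - {\<pi> j} = {..<n} - {\<pi> j}" ..
      fix i assume "i \<in> {..<n} - {\<pi> j}"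
      then have "h (b j) i = u i" using \<pi>(2)[OF j, of i] by simp
      then show "(h r i - h (b j) i)\<^sup>2 = (h r i - u i)\<^sup>2" by simp
    qed
    have 4: "(\<Sum>i\<in>{..<n} - {j}. (r i - b j i)\<^sup>2) = (\<Sum>i\<in>{..<n} - {j}. (r i)\<^sup>2)"
      by (intro sum.cong) (auto simp: b_def)
    have 5: "h (b j) (\<pi> j) = 1 - u (\<pi> j)" "b j j = 1"
      using \<pi>(2)[OF j \<pi>(1)[OF j]] hcorner[OF bc[of j] \<pi>(1)[OF j]] u01[OF \<pi>(1)[OF j]] j
      by (auto simp: b_def)
    have "(h r (\<pi> j) - (1 - u (\<pi> j)))\<^sup>2 + (\<Sum>i\<in>{..<n} - {\<pi> j}. (h r i - u i)\<^sup>2) =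
        (r j - 1)\<^sup>2 + (\<Sum>i\<in>{..<n} - {j}. (r i)\<^sup>2)"
      using 2 split[OF \<pi>(1)[OF j], of "\<lambda>i. (h r i - h (b j) i)\<^sup>2"] split[OF j, of "\<lambda>i. (r i - b j i)\<^sup>2"]
      by (simp add: 3 4 5)
    with 1 have "(h r (\<pi> j) - u (\<pi> j))\<^sup>2 - (h r (\<pi> j) - (1 - u (\<pi> j)))\<^sup>2 = (r j)\<^sup>2 - (r j - 1)\<^sup>2"
      by linarith
    then show ?thesis
      using u01[OF \<pi>(1)[OF j]] unit_cubeD[OF r j] by (auto simp: power2_eq_square algebra_simps)
  qed
  have inj: "inj_on \<pi> {..<n}"
  proof (rule inj_onI)
    fix i j assume ij: "i \<in> {..<n}" "j \<in> {..<n}" "\<pi> i = \<pi> j"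
    show "i = j"
    proof (rule ccontr)
      assume "i \<noteq> j"
      then show False
        using key[OF bu[of i], of i] key[OF bu[of i], of j] ij u01[OF \<pi>(1), of i] by (auto simp: b_def)
    qed
  qed
  then have bij: "bij_betw \<pi> {..<n} {..<n}"
    using \<pi>(1) by (simp add: bij_betw_def endo_inj_surj image_subset_iff)
  define c where "c = inv_into {..<n} \<pi>"
  have c: "bij_betw c {..<n} {..<n}" unfolding c_def by (rule bij_betw_inv_into[OF bij])
  then have cn: "c i < n" if "i < n" for i using that by (auto simp: bij_betw_def)
  have \<pi>c: "\<pi> (c i) = i" if "i < n" for i
    using bij_betw_inv_into_right[OF bij, of i] that by (simp add: c_def)
  have "{i. i < n \<and> c i < n} = {..<n}" using cn by auto
  then have data: "emb_data n n c u" using c uc by (simp add: emb_data_def)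
  have "h = emb n n c u"
  proof
    fix r show "h r = emb n n c u r"
    proof (cases "r \<in> unit_cube n")
      case True
      show ?thesis
      proof (rule unit_cube_eqI[OF hin[OF True] emb_in_cube[OF data True]])
        fix i assume i: "i < n"
        show "h r i = emb n n c u r i"
          using key[OF True cn[OF i]] \<pi>c[OF i] cn[OF i] i True by simp
      qed
    next
      case False
      then show ?thesis
        using h by (simp add: face_isometry_def emb_def extensional_def)
    qed
  qed
  with data that show thesis by blast
qed

section \<open>Local systems on a cube complex\<close>

lemma emb_cong:
  assumes "\<And>i. i < m \<Longrightarrow> c i = c' i \<or> \<not> c i < k \<and> \<not> c' i < k"
  shows "emb k m c u = emb k m c' u"
  unfolding emb_def
proof (rule restrict_ext, rule restrict_ext)
  fix r i assume "i \<in> {..<m}"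
  then show "\<bar>u i - (if c i < k then r (c i) else 0)\<bar> = \<bar>u i - (if c' i < k then r (c' i) else 0)\<bar>"
    using assms[of i] by auto
qed

definition pull :: "nat \<Rightarrow> nat \<Rightarrow> ((nat \<Rightarrow> real) \<Rightarrow> 'x) \<Rightarrow> (nat \<Rightarrow> nat) \<Rightarrow> (nat \<Rightarrow> real) \<Rightarrow> (nat \<Rightarrow> real) \<Rightarrow> 'x" where
  "pull k m \<psi> c u = compose (unit_cube k) \<psi> (emb k m c u)"

lemma pull_apply [simp]: "r \<in> unit_cube k \<Longrightarrow> pull k m \<psi> c u r = \<psi> (emb k m c u r)"
  by (simp add: pull_def compose_def)

lemma pull_pull:
  assumes "emb_data k m c u" "emb_data l k c' u'"
  shows "pull l k (pull k m \<psi> c u) c' u' = pull l m \<psi> (emb_comp_dir l k c c') (emb k m c u u')"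
proof
  fix r show "pull l k (pull k m \<psi> c u) c' u' r = pull l m \<psi> (emb_comp_dir l k c c') (emb k m c u u') r"
  proof (cases "r \<in> unit_cube l")
    case True
    then show ?thesis using emb_comp[OF assms True] emb_in_cube[OF assms(2) True] by simp
  next
    case False
    then show ?thesis by (simp add: pull_def compose_def)
  qed
qed

definition single_axis :: "nat \<Rightarrow> nat \<Rightarrow> nat" where
  "single_axis i = (\<lambda>j. if j = i then 0 else 1)"

lemma single_axis_data: "i < m \<Longrightarrow> u \<in> cube_corners m \<Longrightarrow> emb_data 1 m (single_axis i) u"
proof -
  assume "i < m" "u \<in> cube_corners m"
  moreover have "{j. j < m \<and> single_axis i j < 1} = {i}" using \<open>i < m\<close> by (auto simp: single_axis_def)
  ultimately show ?thesis by (auto simp: emb_data_def single_axis_def bij_betw_def)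
qed

definition edge :: "nat \<Rightarrow> ((nat \<Rightarrow> real) \<Rightarrow> 'x) \<Rightarrow> (nat \<Rightarrow> real) \<Rightarrow> nat \<Rightarrow> (nat \<Rightarrow> real) \<Rightarrow> 'x" where
  "edge m \<psi> u i = pull 1 m \<psi> (single_axis i) u"

definition flip :: "nat \<Rightarrow> (nat \<Rightarrow> real) \<Rightarrow> (nat \<Rightarrow> real)" where
  "flip i u = u(i := 1 - u i)"

lemma flip_corner: "u \<in> cube_corners m \<Longrightarrow> i < m \<Longrightarrow> flip i u \<in> cube_corners m"
  using cube_cornersD[of u m i] by (auto simp: flip_def cube_corners_def PiE_iff extensional_def)

lemma flip_flip: "flip i (flip i u) = u"
  by (auto simp: flip_def)

lemma flip_other: "j \<noteq> i \<Longrightarrow> flip i u j = u j"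
  by (simp add: flip_def)

lemma flip_commute: "flip i (flip j u) = flip j (flip i u)"
  by (auto simp: flip_def)

abbreviation one1 :: "nat \<Rightarrow> real" where "one1 \<equiv> flip 0 (cube_origin 1)"

lemma one1_corner: "one1 \<in> cube_corners 1"
  by (simp add: flip_corner origin_corner)

lemma id_data: "u \<in> cube_corners m \<Longrightarrow> emb_data m m id u"
  by (simp add: emb_data_def lessThan_def)

definition dart_source :: "((nat \<Rightarrow> real) \<Rightarrow> 'x) \<Rightarrow> 'x" where
  "dart_source e = e (cube_origin 1)"

definition dart_rev :: "((nat \<Rightarrow> real) \<Rightarrow> 'x) \<Rightarrow> (nat \<Rightarrow> real) \<Rightarrow> 'x" where
  "dart_rev e = pull 1 1 e id one1"

lemma emb_single_axis_one:
  assumes "i < m" "u \<in> cube_corners m"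
  shows "emb 1 m (single_axis i) u one1 = flip i u"
proof (rule unit_cube_eqI)
  fix j assume "j < m"
  then show "emb 1 m (single_axis i) u one1 j = flip i u j"
    using cube_cornersD[OF assms(2), of j] corners_in_cube[OF one1_corner]
    by (auto simp: single_axis_def flip_def)
next
  show "emb 1 m (single_axis i) u one1 \<in> unit_cube m"
    by (intro emb_in_cube single_axis_data corners_in_cube one1_corner assms)
  show "flip i u \<in> unit_cube m" by (intro corners_in_cube flip_corner assms)
qed

lemma emb_flip:
  assumes "emb_data k m c u" "w \<in> cube_corners k" "i < m" "c i < k"
  shows "emb k m c u (flip (c i) w) = flip i (emb k m c u w)"
proof (rule unit_cube_eqI)
  have w: "w \<in> unit_cube k" "flip (c i) w \<in> unit_cube k"
    using assms corners_in_cube flip_corner by blast+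
  fix j assume j: "j < m"
  have "u j = 0 \<or> u j = 1" using cube_cornersD[OF emb_data_corner[OF assms(1)] j] .
  moreover have "w (c i) = 0 \<or> w (c i) = 1" using cube_cornersD[OF assms(2,4)] .
  moreover have "c j = c i \<Longrightarrow> j = i"
    using assms j by (auto simp: emb_data_def bij_betw_def dest: inj_onD)
  ultimately show "emb k m c u (flip (c i) w) j = flip i (emb k m c u w) j"
    using w j assms(3,4) by (auto simp: flip_def)
qed (use assms emb_corner corners_in_cube flip_corner in blast)+

lemma edge_pull:
  assumes "emb_data k m c u" "w \<in> cube_corners k" "i < m" "c i < k"
  shows "edge k (pull k m \<psi> c u) w (c i) = edge m \<psi> (emb k m c u w) i"
proof -
  have "emb 1 m (emb_comp_dir 1 k c (single_axis (c i))) v = emb 1 m (single_axis i) v" for v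
  proof (rule emb_cong)
    fix j assume "j < m"
    moreover have "c j = c i \<Longrightarrow> j = i"
      using assms \<open>j < m\<close> by (auto simp: emb_data_def bij_betw_def dest: inj_onD)
    ultimately show "emb_comp_dir 1 k c (single_axis (c i)) j = single_axis i j \<or>
      \<not> emb_comp_dir 1 k c (single_axis (c i)) j < 1 \<and> \<not> single_axis i j < 1"
      using assms(4) by (auto simp: emb_comp_dir_def single_axis_def)
  qed
  then show ?thesis
    unfolding edge_def pull_pull[OF assms(1) single_axis_data[OF assms(4,2)]] by (simp add: pull_def)
qed

lemma edge_flip:
  assumes "i < m" "u \<in> cube_corners m"
  shows "edge m \<psi> (flip i u) i = dart_rev (edge m \<psi> u i)"
proof -
  have "emb 1 m (emb_comp_dir 1 1 (single_axis i) id) v = emb 1 m (single_axis i) v" for v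
    by (rule emb_cong) (auto simp: emb_comp_dir_def single_axis_def)
  then show ?thesis
    unfolding edge_def dart_rev_def pull_pull[OF single_axis_data[OF assms] id_data[OF one1_corner]]
      emb_single_axis_one[OF assms] by (simp add: pull_def)
qed

lemma source_edge: "i < m \<Longrightarrow> u \<in> cube_corners m \<Longrightarrow> dart_source (edge m \<psi> u i) = \<psi> u"
  by (simp add: dart_source_def edge_def emb_origin[OF single_axis_data] corners_in_cube origin_corner
      del: One_nat_def)

lemma target_edge:
  "i < m \<Longrightarrow> u \<in> cube_corners m \<Longrightarrow> dart_source (dart_rev (edge m \<psi> u i)) = \<psi> (flip i u)"
  by (simp add: edge_flip[symmetric] source_edge flip_corner)

lemma dart_target: "dart_source (dart_rev e) = e one1"
  using corners_in_cube[OF origin_corner] emb_origin[OF id_data[OF one1_corner]]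
  by (simp add: dart_source_def dart_rev_def)

context cube_complex
begin

lemma pull_chart: "\<psi> \<in> \<Phi> m \<Longrightarrow> emb_data k m c u \<Longrightarrow> pull k m \<psi> c u \<in> \<Phi> k"
  unfolding pull_def using chart_face emb_face_isometry by blast

lemma edge_chart: "\<psi> \<in> \<Phi> m \<Longrightarrow> i < m \<Longrightarrow> u \<in> cube_corners m \<Longrightarrow> edge m \<psi> u i \<in> \<Phi> 1"
  unfolding edge_def using pull_chart single_axis_data by blast

lemma chart_in_space: "\<psi> \<in> \<Phi> m \<Longrightarrow> q \<in> unit_cube m \<Longrightarrow> \<psi> q \<in> X"
  using chart_fun PiE_mem by blast

lemma edge_self:
  assumes "e \<in> \<Phi> 1"
  shows "edge 1 e (cube_origin 1) 0 = e"
proof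
  fix r
  show "edge 1 e (cube_origin 1) 0 r = e r"
  proof (cases "r \<in> unit_cube 1")
    case True
    have "emb 1 1 (single_axis 0) (cube_origin 1) r = r"
      by (rule unit_cube_eqI[OF emb_in_cube[OF single_axis_data[OF _ origin_corner] True] True])
        (use True unit_cubeD[OF True] in \<open>auto simp: single_axis_def\<close>)
    then show ?thesis using True by (simp add: edge_def)
  next
    case False
    then show ?thesis using chart_fun[OF assms] by (auto simp: edge_def pull_def compose_def PiE_iff extensional_def)
  qed
qed

text \<open>Squares are tested only at the origin, because every corner of a square is the origin of
  another of its parametrisations.\<close>

definition cube_system :: "('x \<Rightarrow> 's set) \<Rightarrow> (((nat \<Rightarrow> real) \<Rightarrow> 'x) \<Rightarrow> 's \<Rightarrow> 's) \<Rightarrow> bool" where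
  "cube_system M t \<longleftrightarrow>
     (\<forall>e\<in>\<Phi> 1. \<forall>s\<in>M (dart_source e).
        t e s \<in> M (dart_source (dart_rev e)) \<and> t (dart_rev e) (t e s) = s) \<and>
     (\<forall>\<psi>\<in>\<Phi> 2. \<forall>s\<in>M (\<psi> (cube_origin 2)).
        t (edge 2 \<psi> (flip 0 (cube_origin 2)) 1) (t (edge 2 \<psi> (cube_origin 2) 0) s) =
        t (edge 2 \<psi> (flip 1 (cube_origin 2)) 0) (t (edge 2 \<psi> (cube_origin 2) 1) s))"

end

locale local_system_complex = cube_complex X \<Phi>
  for X :: "'x set" and \<Phi> :: "nat \<Rightarrow> ((nat \<Rightarrow> real) \<Rightarrow> 'x) set" +
  fixes M :: "'x \<Rightarrow> 's set" and t :: "((nat \<Rightarrow> real) \<Rightarrow> 'x) \<Rightarrow> 's \<Rightarrow> 's"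
  assumes system: "cube_system M t"
begin

lemma t_in: "e \<in> \<Phi> 1 \<Longrightarrow> s \<in> M (dart_source e) \<Longrightarrow> t e s \<in> M (dart_source (dart_rev e))"
  and t_rev: "e \<in> \<Phi> 1 \<Longrightarrow> s \<in> M (dart_source e) \<Longrightarrow> t (dart_rev e) (t e s) = s"
  using system by (auto simp: cube_system_def)

lemma t_square:
  assumes "\<psi> \<in> \<Phi> m" "u \<in> cube_corners m" "i < m" "j < m" "i \<noteq> j" "s \<in> M (\<psi> u)"
  shows "t (edge m \<psi> (flip i u) j) (t (edge m \<psi> u i) s) = t (edge m \<psi> (flip j u) i) (t (edge m \<psi> u j) s)"
proof -
  define c where "c = (\<lambda>l. if l = i then 0 else if l = j then 1 else (2::nat))"
  have "{l. l < m \<and> c l < 2} = {i, j}" using assms by (auto simp: c_def)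
  moreover have "bij_betw c {i, j} {..<2}" using assms(5) by (auto simp: c_def bij_betw_def lessThan_nat_numeral lessThan_Suc numeral_2_eq_2)
  ultimately have data: "emb_data 2 m c u" using assms by (simp add: emb_data_def)
  have ci: "c i = 0" "c j = 1" using assms by (auto simp: c_def)
  let ?o = "cube_origin 2"
  have o: "?o \<in> cube_corners 2" "flip 0 ?o \<in> cube_corners 2" "flip 1 ?o \<in> cube_corners 2"
    by (simp_all add: flip_corner origin_corner)
  have 1: "emb 2 m c u ?o = u" using emb_origin[OF data] .
  have 2: "emb 2 m c u (flip 0 ?o) = flip i u" "emb 2 m c u (flip 1 ?o) = flip j u"
    using emb_flip[OF data o(1), of i] emb_flip[OF data o(1), of j] ci assms 1 by auto
  have "pull 2 m \<psi> c u \<in> \<Phi> 2" using pull_chart assms data by blast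
  moreover have "s \<in> M (pull 2 m \<psi> c u ?o)" using assms 1 o(1) corners_in_cube by simp
  ultimately have "t (edge 2 (pull 2 m \<psi> c u) (flip 0 ?o) 1) (t (edge 2 (pull 2 m \<psi> c u) ?o 0) s) =
    t (edge 2 (pull 2 m \<psi> c u) (flip 1 ?o) 0) (t (edge 2 (pull 2 m \<psi> c u) ?o 1) s)"
    using system by (auto simp: cube_system_def)
  then show ?thesis
    using edge_pull[OF data o(1), of i \<psi>] edge_pull[OF data o(1), of j \<psi>]
      edge_pull[OF data o(2), of j \<psi>] edge_pull[OF data o(3), of i \<psi>] ci assms(3,4) 1 2 by simp
qed

text \<open>A parallel section over the corners of one cube. A covering is trivial over a cube, so
  such a family is determined by its value at one corner (\<open>flat_unique\<close>), and this
  value is arbitrary (\<open>flat_exists\<close>).\<close>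

definition flat_family :: "nat \<Rightarrow> ((nat \<Rightarrow> real) \<Rightarrow> 'x) \<Rightarrow> ((nat \<Rightarrow> real) \<Rightarrow> 's) \<Rightarrow> bool" where
  "flat_family m \<psi> F \<longleftrightarrow>
     (\<forall>u\<in>cube_corners m. F u \<in> M (\<psi> u) \<and> (\<forall>i<m. F (flip i u) = t (edge m \<psi> u i) (F u)))"

lemma flat_pull:
  assumes "flat_family m \<psi> F" "emb_data k m c u"
  shows "flat_family k (pull k m \<psi> c u) (\<lambda>w. F (emb k m c u w))"
  unfolding flat_family_def
proof (intro ballI conjI allI impI)
  fix w assume w: "w \<in> cube_corners k"
  have e: "emb k m c u w \<in> cube_corners m" using emb_corner assms w by blast
  show "F (emb k m c u w) \<in> M (pull k m \<psi> c u w)"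
    using assms(1) e corners_in_cube[OF w] by (simp add: flat_family_def)
  fix j assume "j < k"
  then have "j \<in> c ` {i. i < m \<and> c i < k}" using assms(2) by (simp add: emb_data_def bij_betw_def)
  then obtain i where i: "i < m" "c i = j" by blast
  then show "F (emb k m c u (flip j w)) = t (edge k (pull k m \<psi> c u) w j) (F (emb k m c u w))"
    using emb_flip[OF assms(2) w, of i] edge_pull[OF assms(2) w, of i \<psi>] \<open>j < k\<close> e assms(1)
    by (simp add: flat_family_def)
qed

text \<open>By induction on \<open>k\<close>, for corners that may differ from \<open>w\<close> only
  in the first \<open>k\<close> coordinates; one flip corrects the last of these.\<close>

lemma flat_unique:
  assumes "flat_family m \<psi> F" "flat_family m \<psi> F'" "w \<in> cube_corners m" "F w = F' w" "u \<in> cube_corners m"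
  shows "F u = F' u"
proof -
  have "F u = F' u" if "k \<le> m" "u \<in> cube_corners m" "\<And>i. k \<le> i \<Longrightarrow> i < m \<Longrightarrow> u i = w i" for k u
    using that
  proof (induction k arbitrary: u)
    case 0
    then have "u = w" using assms(3) corners_in_cube by (intro unit_cube_eqI) auto
    then show ?case using assms(4) by simp
  next
    case (Suc k)
    show ?case
    proof (cases "u k = w k")
      case True
      then have "u i = w i" if "k \<le> i" "i < m" for i using Suc.prems(3)[of i] that by (cases "i = k") auto
      then show ?thesis using Suc by simp
    next
      case False
      have k: "k < m" using Suc by simp
      have f: "flip k u \<in> cube_corners m" using flip_corner Suc k by blast
      have "flip k u i = w i" if "k \<le> i" "i < m" for i
        using Suc.prems(3)[of i] False that cube_cornersD[OF Suc.prems(2) k] cube_cornersD[OF assms(3) k]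
        by (cases "i = k") (auto simp: flip_def)
      then have "F (flip k u) = F' (flip k u)" using Suc f by simp
      then show ?thesis
        using assms(1,2) f k flip_flip[of k u] unfolding flat_family_def by metis
    qed
  qed
  from this[of m] show ?thesis using assms by auto
qed

definition trunc :: "nat \<Rightarrow> nat \<Rightarrow> (nat \<Rightarrow> real) \<Rightarrow> nat \<Rightarrow> real" where
  "trunc m k u = (\<lambda>i\<in>{..<m}. if i < k then u i else 0)"

text \<open>Transport along the staircase from the origin to \<open>u\<close> that switches on the
  coordinates in increasing order; \<open>trunc m k u\<close> is the corner reached when the first
  \<open>k\<close> coordinates have been treated.\<close>

primrec spread :: "nat \<Rightarrow> ((nat \<Rightarrow> real) \<Rightarrow> 'x) \<Rightarrow> 's \<Rightarrow> nat \<Rightarrow> (nat \<Rightarrow> real) \<Rightarrow> 's" where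
  "spread m \<psi> s 0 u = s"
| "spread m \<psi> s (Suc k) u =
     (if u k = 1 then t (edge m \<psi> (trunc m k u) k) (spread m \<psi> s k u) else spread m \<psi> s k u)"

lemma trunc_corner: "u \<in> cube_corners m \<Longrightarrow> trunc m k u \<in> cube_corners m"
  by (auto simp: trunc_def cube_corners_def PiE_iff)

lemma trunc_flip: "i < k \<Longrightarrow> i < m \<Longrightarrow> trunc m k (flip i u) = flip i (trunc m k u)"
  by (auto simp: trunc_def flip_def)

lemma trunc_Suc:
  assumes "k < m" "u \<in> cube_corners m"
  shows "trunc m (Suc k) u = (if u k = 1 then flip k (trunc m k u) else trunc m k u)"
  using cube_cornersD[OF assms(2,1)] assms(1) by (auto simp: trunc_def flip_def fun_eq_iff less_Suc_eq)

lemma trunc_flip_ge: "k \<le> i \<Longrightarrow> trunc m k (flip i u) = trunc m k u"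
  by (auto simp: trunc_def flip_def)

lemma spread_flip_ge: "k \<le> i \<Longrightarrow> spread m \<psi> s k (flip i u) = spread m \<psi> s k u"
  by (induction k) (auto simp: trunc_flip_ge flip_other)

text \<open>A flip of the last coordinate treated is a step of the staircase or its reversal. A flip
  of an earlier one commutes with the last step by \<open>t_square\<close>.\<close>

lemma spread_flat:
  assumes "\<psi> \<in> \<Phi> m" "s \<in> M (\<psi> (cube_origin m))" "k \<le> m" "u \<in> cube_corners m"
  shows "spread m \<psi> s k u \<in> M (\<psi> (trunc m k u)) \<and>
    (\<forall>i<k. spread m \<psi> s k (flip i u) = t (edge m \<psi> (trunc m k u) i) (spread m \<psi> s k u))"
  using assms(3,4)
proof (induction k arbitrary: u)
  case 0
  have "trunc m 0 u = cube_origin m" by (simp add: trunc_def cube_origin_def)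
  then show ?case using assms by simp
next
  case (Suc k)
  have k: "k < m" and u: "u \<in> cube_corners m" using Suc by auto
  have IH1: "spread m \<psi> s k v \<in> M (\<psi> (trunc m k v))" if "v \<in> cube_corners m" for v
    using Suc that by simp
  have IH2: "spread m \<psi> s k (flip i u) = t (edge m \<psi> (trunc m k u) i) (spread m \<psi> s k u)" if "i < k" for i
    using Suc that by simp
  let ?v = "trunc m k u"
  have v: "?v \<in> cube_corners m" using u trunc_corner by blast
  have e: "edge m \<psi> ?v i \<in> \<Phi> 1" if "i < m" for i using edge_chart assms v that by blast
  have sv: "spread m \<psi> s k u \<in> M (dart_source (edge m \<psi> ?v i))" if "i < m" for i
    using IH1[OF u] by (simp only: source_edge[OF that v])
  have 1: "spread m \<psi> s (Suc k) u \<in> M (\<psi> (trunc m (Suc k) u))"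
    using IH1[OF u] t_in[OF e[OF k] sv[OF k]] by (auto simp: trunc_Suc[OF k u] target_edge k v)
  moreover have "spread m \<psi> s (Suc k) (flip i u) =
      t (edge m \<psi> (trunc m (Suc k) u) i) (spread m \<psi> s (Suc k) u)" if i: "i < Suc k" for i
  proof (cases "i < k")
    case True
    then have fk: "flip i u k = u k" by (simp add: flip_def)
    show ?thesis
    proof (cases "u k = 1")
      case False
      then show ?thesis using IH2[OF True] fk by (simp add: trunc_Suc[OF k u])
    next
      case u1: True
      have "spread m \<psi> s (Suc k) (flip i u) =
          t (edge m \<psi> (flip i ?v) k) (t (edge m \<psi> ?v i) (spread m \<psi> s k u))"
        using fk u1 IH2[OF True] True k by (simp add: trunc_flip)
      also have "\<dots> = t (edge m \<psi> (flip k ?v) i) (t (edge m \<psi> ?v k) (spread m \<psi> s k u))"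
        using t_square[OF assms(1) v _ k _ IH1[OF u], of i] True k by simp
      finally show ?thesis using u1 by (simp add: trunc_Suc[OF k u])
    qed
  next
    case False
    then have ik: "i = k" using i by simp
    have fkk: "flip k u k = 1 - u k" by (simp add: flip_def)
    show ?thesis
    proof (cases "u k = 1")
      case True
      then have "spread m \<psi> s (Suc k) (flip k u) = spread m \<psi> s k u"
        using spread_flip_ge[of k k m \<psi> s u] by (simp add: fkk)
      also have "\<dots> = t (dart_rev (edge m \<psi> ?v k)) (t (edge m \<psi> ?v k) (spread m \<psi> s k u))"
        using t_rev[OF e[OF k] sv[OF k]] by simp
      finally show ?thesis using ik True by (simp add: trunc_Suc[OF k u] edge_flip[OF k v])
    next
      case False
      then have "u k = 0" using cube_cornersD[OF u k] by simp
      then have "spread m \<psi> s (Suc k) (flip k u) = t (edge m \<psi> ?v k) (spread m \<psi> s k u)"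
        using trunc_flip_ge[of k k m u] spread_flip_ge[of k k m \<psi> s u] by (simp add: fkk)
      then show ?thesis using ik False by (simp add: trunc_Suc[OF k u])
    qed
  qed
  ultimately show ?case by blast
qed

lemma flat_exists:
  assumes "\<psi> \<in> \<Phi> m" "w \<in> cube_corners m" "s \<in> M (\<psi> w)"
  obtains F where "flat_family m \<psi> F" "F w = s"
proof -
  \<comment> \<open>The chart is recentred so that \<open>w\<close> becomes the origin;
    \<open>emb m m id w\<close> is a reflection and hence its own inverse, which leads back to the
    given chart.\<close>
  let ?\<chi> = "pull m m \<psi> id w"
  have data: "emb_data m m id w" using id_data assms by blast
  have o: "cube_origin m \<in> cube_corners m" by (rule origin_corner)
  have \<chi>: "?\<chi> \<in> \<Phi> m" using pull_chart assms data by blast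
  have s: "s \<in> M (?\<chi> (cube_origin m))" using assms corners_in_cube[OF o] emb_origin[OF data] by simp
  define F' where "F' = spread m ?\<chi> s m"
  have tm: "trunc m m u = u" if "u \<in> cube_corners m" for u
    using that by (intro unit_cube_eqI[of _ m]) (auto simp: trunc_def intro!: corners_in_cube trunc_corner[unfolded trunc_def])
  have F': "flat_family m ?\<chi> F'"
    unfolding flat_family_def F'_def
  proof (intro ballI)
    fix u assume u: "u \<in> cube_corners m"
    show "spread m ?\<chi> s m u \<in> M (?\<chi> u) \<and>
        (\<forall>i<m. spread m ?\<chi> s m (flip i u) = t (edge m ?\<chi> u i) (spread m ?\<chi> s m u))"
      using spread_flat[OF \<chi> s order.refl u] unfolding tm[OF u] .
  qed
  have "spread m ?\<chi> s k (cube_origin m) = s" if "k \<le> m" for k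
    using that by (induction k) auto
  then have F'0: "F' (cube_origin m) = s" by (simp add: F'_def)
  have inv: "emb m m id w (emb m m id w u) = u" if "u \<in> unit_cube m" for u
  proof (rule unit_cube_eqI[of _ m])
    fix i assume "i < m"
    then show "emb m m id w (emb m m id w u) i = u i"
      using cube_cornersD[OF assms(2), of i] unit_cubeD[OF that, of i] emb_in_cube[OF data that] that by auto
  qed (use emb_in_cube[OF data] that in blast)+
  have "pull m m ?\<chi> id w = \<psi>"
  proof
    fix u show "pull m m ?\<chi> id w u = \<psi> u"
      using inv[of u] emb_in_cube[OF data, of u] chart_fun[OF assms(1)]
      by (cases "u \<in> unit_cube m") (auto simp: pull_def compose_def PiE_iff extensional_def)
  qed
  then have "flat_family m \<psi> (\<lambda>u. F' (emb m m id w u))" using flat_pull[OF F' data] by simp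
  moreover have "emb m m id w w = cube_origin m"
    using inv[OF corners_in_cube[OF o]] emb_origin[OF data] by simp
  then have "F' (emb m m id w w) = s" using F'0 by simp
  ultimately show thesis using that by blast
qed

end

section \<open>Points of a cube complex\<close>

lemma cube_dist_sym: "cube_dist n p q = cube_dist n q p"
  by (simp add: cube_dist_def L2_set_def power2_commute)

lemma cube_dist_refl [simp]: "cube_dist n p p = 0"
  by (simp add: cube_dist_def L2_set_def)

lemma cube_dist_triangle: "cube_dist n p r \<le> cube_dist n p q + cube_dist n q r"
  using L2_set_triangle_ineq[of "\<lambda>i. p i - q i" "\<lambda>i. q i - r i" "{..<n}"]
  by (simp add: cube_dist_def)

lemma coordinate_le_cube_dist: "i < n \<Longrightarrow> \<bar>p i - q i\<bar> \<le> cube_dist n p q"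
proof -
  assume "i < n"
  then have "(p i - q i)\<^sup>2 \<le> (\<Sum>i<n. (p i - q i)\<^sup>2)"
    by (intro member_le_sum) auto
  then have "sqrt ((p i - q i)\<^sup>2) \<le> sqrt (\<Sum>i<n. (p i - q i)\<^sup>2)"
    by (rule real_sqrt_le_mono)
  then show ?thesis by (simp add: cube_dist_def L2_set_def)
qed

lemma openin_cube_ball: "openin (cube_topology n) {q \<in> unit_cube n. cube_dist n p q < d}"
proof -
  have c: "continuous_map (cube_topology n) euclideanreal (\<lambda>q. q i)" if "i < n" for i
  proof -
    have "continuous_map (cube_topology n) (top_of_set {0..1}) (\<lambda>q. q i)"
      unfolding cube_topology_def using that by (intro continuous_map_product_projection) auto
    then show ?thesis using continuous_map_in_subtopology by blast
  qed
  have "continuous_map (cube_topology n) euclideanreal (\<lambda>q. \<Sum>i<n. (p i - q i)\<^sup>2)"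
    by (intro continuous_map_sum continuous_map_real_pow continuous_map_diff c) auto
  then have "continuous_map (cube_topology n) euclideanreal (cube_dist n p)"
    unfolding cube_dist_def[abs_def] L2_set_def by (rule continuous_map_sqrt)
  then have "openin (cube_topology n) {q \<in> topspace (cube_topology n). cube_dist n p q \<in> {..<d}}"
    by (rule openin_continuous_map_preimage) simp
  then show ?thesis by (simp add: topspace_cube_topology)
qed

abbreviation vertex_point :: "nat \<Rightarrow> real" where "vertex_point \<equiv> cube_origin 0"

lemma unit_cube_0: "unit_cube 0 = {vertex_point}"
  by (auto simp: unit_cube_def cube_origin_def)

lemma pull_vertex:
  assumes "u \<in> cube_corners m"
  shows "emb_data 0 m (\<lambda>_. 0) u" "pull 0 m \<psi> (\<lambda>_. 0) u = (\<lambda>r\<in>unit_cube 0. \<psi> u)"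
    and "emb 0 m (\<lambda>_. 0) u vertex_point = u"
proof -
  show d: "emb_data 0 m (\<lambda>_. 0) u" using assms by (simp add: emb_data_def bij_betw_def)
  show e: "emb 0 m (\<lambda>_. 0) u vertex_point = u" using emb_origin[OF d] .
  show "pull 0 m \<psi> (\<lambda>_. 0) u = (\<lambda>r\<in>unit_cube 0. \<psi> u)"
    using e by (auto simp: pull_def compose_def unit_cube_0)
qed

context cube_complex
begin

lemma corner_vertex: "\<psi> \<in> \<Phi> m \<Longrightarrow> u \<in> cube_corners m \<Longrightarrow> \<psi> u \<in> vertices \<Phi>"
  unfolding vertices_def using pull_chart[OF _ pull_vertex(1)] pull_vertex(2,3) corners_in_cube[OF origin_corner]
  by (metis (mono_tags, lifting) mem_Collect_eq pull_apply)

text \<open>The smallest face that contains \<open>q\<close> has it in its interior, so its open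
  cube meets that of \<open>\<phi>\<close> and is the same cube. Hence every occurrence of a point
  in a chart factors through the open cube that contains the point.\<close>

lemma through:
  assumes "\<phi> \<in> \<Phi> n" "p \<in> open_cube n" "\<psi> \<in> \<Phi> m" "q \<in> unit_cube m" "\<psi> q = \<phi> p"
  obtains c u where "emb_data n m c u" "pull n m \<psi> c u = \<phi>" "emb n m c u p = q"
proof -
  obtain k c0 u0 r0 where 0: "emb_data k m c0 u0" "r0 \<in> open_cube k" "emb k m c0 u0 r0 = q"
    using minimal_face[OF assms(4)] by blast
  let ?\<chi> = "pull k m \<psi> c0 u0"
  have \<chi>: "?\<chi> \<in> \<Phi> k" using pull_chart assms 0 by blast
  have r0: "?\<chi> r0 = \<phi> p" using 0 assms open_in_cube by simp
  then have ne: "?\<chi> ` open_cube k \<inter> \<phi> ` open_cube n \<noteq> {}" using 0 assms by blast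
  obtain h where k: "k = n" and h: "face_isometry n n h" "\<phi> = compose (unit_cube n) ?\<chi> h"
    using open_cubes_disjoint[OF \<chi> assms(1) ne] by blast
  obtain c' u' where e: "emb_data n n c' u'" "h = emb n n c' u'" using face_isometry_emb[OF h(1)] .
  have e00: "emb_data n m c0 u0" using 0 k by simp
  have \<phi>: "\<phi> = pull n n (pull n m \<psi> c0 u0) c' u'" using h e k by (simp add: pull_def)
  have "emb n n c' u' p \<in> open_cube n" using emb_open e assms by blast
  moreover have "?\<chi> (emb n n c' u' p) = ?\<chi> r0" using r0 \<phi> open_in_cube[OF assms(2)] k by simp
  ultimately have "emb n n c' u' p = r0" using chart_inj[OF \<chi>] 0 k by (auto dest: inj_onD)
  then have "emb n m (emb_comp_dir n n c0 c') (emb n m c0 u0 u') p = q"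
    using emb_comp[OF e00 e(1) open_in_cube[OF assms(2)]] 0 k by simp
  moreover have "pull n m \<psi> (emb_comp_dir n n c0 c') (emb n m c0 u0 u') = \<phi>"
    using pull_pull[OF e00 e(1), of \<psi>] \<phi> by simp
  ultimately show thesis using that emb_comp_data[OF e00 e(1)] by blast
qed

lemma emb_open_coordinates:
  assumes "emb_data n m c u" "p \<in> open_cube n" "i < m"
  shows "c i < n \<Longrightarrow> 0 < emb n m c u p i \<and> emb n m c u p i < 1"
    and "\<not> c i < n \<Longrightarrow> emb n m c u p i = u i"
    and "u i = 0 \<or> u i = 1"
  using cube_cornersD[OF emb_data_corner[OF assms(1)] assms(3)] open_cubeD[OF assms(2), of "c i"]
    open_in_cube[OF assms(2)] assms(3) by auto

lemma open_face_inj: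
  assumes "\<phi> \<in> \<Phi> n" "emb_data n m c u" "pull n m \<psi> c u = \<phi>" "r \<in> open_cube n"
    and "q \<in> unit_cube m" "\<psi> q = \<phi> r"
    and "\<And>i. i < m \<Longrightarrow> c i < n \<Longrightarrow> 0 < q i \<and> q i < 1" "\<And>i. i < m \<Longrightarrow> \<not> c i < n \<Longrightarrow> q i = u i"
  shows "q = emb n m c u r"
proof -
  obtain r' where r': "r' \<in> unit_cube n" "emb n m c u r' = q" "r' \<in> open_cube n"
    using emb_surj_face[OF assms(2,5,8)] assms(7) by blast
  then have "\<phi> r' = \<phi> r" using assms(3,6) by (metis pull_apply)
  then have "r' = r" using chart_inj[OF assms(1)] r' assms(4) by (auto dest: inj_onD)
  then show ?thesis using r' by simp
qed

text \<open>A face inclusion is fixed by where it sends one interior point: that point shows which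
  coordinates are free, and injectivity of the chart on the open cube then makes the two inclusions
  agree on all interior points.\<close>

lemma through_unique:
  assumes \<phi>: "\<phi> \<in> \<Phi> n" and p: "p \<in> open_cube n"
    and 1: "emb_data n m c u" "pull n m \<psi> c u = \<phi>"
    and 2: "emb_data n m c' u'" "pull n m \<psi> c' u' = \<phi>"
    and q: "emb n m c u p = emb n m c' u' p"
  shows "emb n m c u = emb n m c' u'"
proof -
  have iff: "c i < n \<longleftrightarrow> c' i < n" if "i < m" for i
    using emb_open_coordinates[OF 1(1) p that] emb_open_coordinates[OF 2(1) p that] q by force
  have ueq: "u i = u' i" if "i < m" "\<not> c i < n" for i
    using emb_open_coordinates[OF 1(1) p that(1)] emb_open_coordinates[OF 2(1) p that(1)] q iff that by simp
  have eq: "emb n m c' u' r = emb n m c u r" if r: "r \<in> open_cube n" for r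
  proof (rule open_face_inj[OF \<phi> 1 r])
    show "emb n m c' u' r \<in> unit_cube m" using emb_in_cube 2 open_in_cube r by blast
    show "\<psi> (emb n m c' u' r) = \<phi> r" using 2(2) open_in_cube[OF r] by (metis pull_apply)
    show "0 < emb n m c' u' r i \<and> emb n m c' u' r i < 1" if "i < m" "c i < n" for i
      using emb_open_coordinates(1)[OF 2(1) r that(1)] iff that by blast
    show "emb n m c' u' r i = u i" if "i < m" "\<not> c i < n" for i
      using emb_open_coordinates(2)[OF 2(1) r that(1)] iff ueq that by simp
  qed
  \<comment> \<open>The value 1/3 changes under reflection, so this point detects \<open>u\<close>.
    Replacing one coordinate by 1/4, which is neither 1/3 nor 2/3, then detects
    \<open>c\<close>.\<close>
  define a :: "nat \<Rightarrow> real" where "a = (\<lambda>i\<in>{..<n}. 1/3)"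
  have a: "a \<in> open_cube n" by (auto simp: a_def open_cube_def)
  have ueq': "u i = u' i" if i: "i < m" for i
  proof (cases "c i < n")
    case True
    then show ?thesis
      using fun_cong[OF eq[OF a], of i] iff[OF i] i open_in_cube[OF a]
        emb_open_coordinates(3)[OF 1(1) p i] emb_open_coordinates(3)[OF 2(1) p i]
      by (auto simp: a_def)
  qed (use ueq i in blast)
  have ceq: "c i = c' i" if i: "i < m" "c i < n" for i
  proof (rule ccontr)
    assume ne: "c i \<noteq> c' i"
    define b where "b = a(c i := 1/4)"
    have b: "b \<in> open_cube n"
      using a i(2) by (auto simp: b_def open_cube_def PiE_iff extensional_def)
    show False
      using fun_cong[OF eq[OF b], of i] iff[OF i(1)] i open_in_cube[OF b] ne ueq'[OF i(1)]
        emb_open_coordinates(3)[OF 1(1) p i(1)]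
      by (auto simp: a_def b_def)
  qed
  have "emb n m c u = emb n m c' u" by (rule emb_cong) (use ceq iff in blast)
  moreover have "emb n m c' u = emb n m c' u'"
    unfolding emb_def using ueq' by (intro restrict_ext) auto
  ultimately show ?thesis by simp
qed

text \<open>
  The points over \<open>x\<close> in one cube are at mutual distance at least \<open>d\<close>, and their coordinates stay away
  from 0 and 1 unless they are equal to 0 or 1. So the balls of radius \<open>d/2\<close> about all points over
  \<open>x\<close> fit together to an open neighbourhood of \<open>x\<close>, although \<open>X\<close> need not be locally finite.
\<close>

definition isolating :: "'x \<Rightarrow> real \<Rightarrow> bool" where
  "isolating x d \<longleftrightarrow> 0 < d \<and> d < 1 \<and>
     (\<forall>m. \<forall>\<psi>\<in>\<Phi> m. \<forall>q\<in>unit_cube m. \<psi> q = x \<longrightarrow>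
        (\<forall>i<m. q i = 0 \<or> q i = 1 \<or> d \<le> q i \<and> q i \<le> 1 - d) \<and>
        (\<forall>q'\<in>unit_cube m. \<psi> q' = x \<longrightarrow> cube_dist m q q' < d \<longrightarrow> q = q'))"

text \<open>One representative \<open>p\<close> in an open cube suffices: every other occurrence of
  \<open>x\<close> comes from \<open>p\<close> by a face inclusion, so its coordinates are 0, 1 or
  those of \<open>p\<close> up to reflection, and only finitely many numbers have to be bounded away
  from 0 and 1.\<close>

lemma isolating_exists:
  assumes "x \<in> X"
  obtains d where "isolating x d"
proof -
  obtain n \<phi> p where \<phi>: "\<phi> \<in> \<Phi> n" "p \<in> open_cube n" "x = \<phi> p"
    using open_cubes_cover[OF assms] by blast
  define S where "S = insert (1/2) ((\<lambda>i. min (p i) (1 - p i)) ` {..<n})"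
  define d where "d = Min S"
  have S: "finite S" "S \<noteq> {}" by (auto simp: S_def)
  have "\<forall>s\<in>S. 0 < s" using open_cubeD[OF \<phi>(2)] by (auto simp: S_def)
  then have d0: "0 < d" using S by (simp add: d_def)
  have "1/2 \<in> S" by (simp add: S_def)
  then have "d \<le> 1/2" using S(1) unfolding d_def by (rule Min_le[rotated])
  have dp: "d \<le> p i \<and> d \<le> 1 - p i" if "i < n" for i
  proof -
    have "min (p i) (1 - p i) \<in> S" using that by (simp add: S_def)
    then have "d \<le> min (p i) (1 - p i)" unfolding d_def by (rule Min_le[OF S(1)])
    then show ?thesis by (simp only: min.bounded_iff)
  qed
  have coord: "q i = 0 \<or> q i = 1 \<or> d \<le> q i \<and> q i \<le> 1 - d"
    if \<psi>: "\<psi> \<in> \<Phi> m" and q: "q \<in> unit_cube m" "\<psi> q = x" and i: "i < m" for m \<psi> q i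
  proof -
    obtain c u where e: "emb_data n m c u" "emb n m c u p = q"
      using through[OF \<phi>(1,2) \<psi> q(1)] q(2) \<phi>(3) by metis
    then show ?thesis
      using emb_open_coordinates(3)[OF e(1) \<phi>(2) i] dp[of "c i"] open_in_cube[OF \<phi>(2)] i
        unit_cubeD[OF q(1) i]
      by (auto simp: abs_if split: if_splits)
  qed
  have "q = q'"
    if \<psi>: "\<psi> \<in> \<Phi> m" and q: "q \<in> unit_cube m" "\<psi> q = x"
      and q': "q' \<in> unit_cube m" "\<psi> q' = x" and lt: "cube_dist m q q' < d" for m \<psi> q q'
  proof -
    have close: "\<bar>q i - q' i\<bar> < d" if "i < m" for i
      using coordinate_le_cube_dist[OF that, of q q'] lt by simp
    obtain c u where e: "emb_data n m c u" "pull n m \<psi> c u = \<phi>" "emb n m c u p = q"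
      using through[OF \<phi>(1,2) \<psi> q(1)] q(2) \<phi>(3) by metis
    have "q' = emb n m c u p"
    proof (rule open_face_inj[OF \<phi>(1) e(1,2) \<phi>(2) q'(1)])
      show "\<psi> q' = \<phi> p" using q' \<phi> by simp
      fix i assume i: "i < m"
      note ci = coord[OF \<psi> q i] coord[OF \<psi> q' i] close[OF i] emb_open_coordinates[OF e(1) \<phi>(2) i]
      show "0 < q' i \<and> q' i < 1" if "c i < n"
        using ci that e(3) d0 by auto
      show "q' i = u i" if "\<not> c i < n"
        using ci that e(3) d0 \<open>d \<le> 1/2\<close> by auto
    qed
    then show ?thesis using e by simp
  qed
  then have "isolating x d"
    unfolding isolating_def using coord d0 \<open>d \<le> 1/2\<close> by auto
  then show thesis using that by blast
qed

definition star :: "'x \<Rightarrow> real \<Rightarrow> 'x set" where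
  "star x d = {\<psi> q' | m \<psi> q q'. \<psi> \<in> \<Phi> m \<and> q \<in> unit_cube m \<and> q' \<in> unit_cube m \<and> \<psi> q = x \<and>
                 cube_dist m q q' < d}"

lemma isolatingD:
  assumes "isolating x d"
  shows "0 < d" "d < 1"
    and "\<psi> \<in> \<Phi> m \<Longrightarrow> q \<in> unit_cube m \<Longrightarrow> \<psi> q = x \<Longrightarrow> i < m \<Longrightarrow>
           q i = 0 \<or> q i = 1 \<or> d \<le> q i \<and> q i \<le> 1 - d"
    and "\<psi> \<in> \<Phi> m \<Longrightarrow> q \<in> unit_cube m \<Longrightarrow> \<psi> q = x \<Longrightarrow> q' \<in> unit_cube m \<Longrightarrow> \<psi> q' = x \<Longrightarrow>
           cube_dist m q q' < d \<Longrightarrow> q = q'"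
  using assms unfolding isolating_def by blast+

text \<open>A point of the star is near \<open>x\<close> in some cube, but openness requires it to
  be near \<open>x\<close> in every cube containing it. The two cubes share the smallest face
  through the point, and \<open>x\<close> turns out to lie in that face.\<close>

lemma star_chart:
  assumes iso: "isolating x d" and \<psi>: "\<psi> \<in> \<Phi> m" "q' \<in> unit_cube m" "\<psi> q' \<in> star x (d/2)"
  obtains q where "q \<in> unit_cube m" "\<psi> q = x" "cube_dist m q q' < d/2"
proof -
  obtain m0 \<psi>0 q0 q0' where 0: "\<psi>0 \<in> \<Phi> m0" "q0 \<in> unit_cube m0" "q0' \<in> unit_cube m0" "\<psi>0 q0 = x"
    "cube_dist m0 q0 q0' < d/2" "\<psi>0 q0' = \<psi> q'"
    using \<psi>(3) unfolding star_def by force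
  obtain n \<phi> p where \<phi>: "\<phi> \<in> \<Phi> n" "p \<in> open_cube n" "\<psi> q' = \<phi> p"
    using open_cubes_cover[OF chart_in_space[OF \<psi>(1,2)]] by blast
  obtain c u where e: "emb_data n m c u" "pull n m \<psi> c u = \<phi>" "emb n m c u p = q'"
    using through[OF \<phi>(1,2) \<psi>(1,2) \<phi>(3)] by blast
  have "\<psi>0 q0' = \<phi> p" using 0 \<phi> by simp
  then obtain c0 u0 where e0: "emb_data n m0 c0 u0" "pull n m0 \<psi>0 c0 u0 = \<phi>" "emb n m0 c0 u0 p = q0'"
    using through[OF \<phi>(1,2) 0(1,3)] by blast
  \<comment> \<open>The coordinate of \<open>q0'\<close> is 0 or 1 and that of \<open>q0\<close> is
    less than \<open>d/2\<close> away. As the latter is 0, 1 or at least \<open>d\<close> away from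
    both, it equals the former.\<close>
  have "q0 i = u0 i" if i: "i < m0" "\<not> c0 i < n" for i
  proof -
    have "\<bar>q0 i - q0' i\<bar> < d/2" using coordinate_le_cube_dist[OF i(1), of q0 q0'] 0 by simp
    then show ?thesis
      using isolatingD(3)[OF iso 0(1,2,4) i(1)] emb_open_coordinates[OF e0(1) \<phi>(2) i(1)] e0(3) i
        isolatingD(1,2)[OF iso] by auto
  qed
  then obtain r where r: "r \<in> unit_cube n" "emb n m0 c0 u0 r = q0"
    using emb_surj_face[OF e0(1) 0(2)] by metis
  have "\<psi> (emb n m c u r) = \<phi> r" using e(2) r(1) pull_apply by metis
  also have "\<dots> = x" using e0(2) r 0(4) pull_apply by metis
  finally have "\<psi> (emb n m c u r) = x" .
  moreover have "cube_dist m (emb n m c u r) q' < d/2"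
    using emb_dist[OF e(1) r(1) open_in_cube[OF \<phi>(2)]]
      emb_dist[OF e0(1) r(1) open_in_cube[OF \<phi>(2)]] e e0 r 0(5) by simp
  ultimately show thesis using that emb_in_cube[OF e(1) r(1)] by blast
qed

lemma openin_star:
  assumes iso: "isolating x d"
  shows "openin (complex_topology X \<Phi>) (star x (d/2))"
  unfolding openin_complex_topology
proof (intro conjI allI ballI)
  show "star x (d/2) \<subseteq> X" using chart_in_space by (auto simp: star_def)
  fix m \<psi> assume \<psi>: "\<psi> \<in> \<Phi> m"
  have "{q' \<in> unit_cube m. \<psi> q' \<in> star x (d/2)} =
      (\<Union>q\<in>{q \<in> unit_cube m. \<psi> q = x}. {q' \<in> unit_cube m. cube_dist m q q' < d/2})"
  proof (intro subset_antisym subsetI)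
    fix q' assume "q' \<in> {q' \<in> unit_cube m. \<psi> q' \<in> star x (d/2)}"
    then have q': "q' \<in> unit_cube m" "\<psi> q' \<in> star x (d/2)" by auto
    obtain q where "q \<in> unit_cube m" "\<psi> q = x" "cube_dist m q q' < d/2"
      using star_chart[OF iso \<psi> q'] .
    then show "q' \<in> (\<Union>q\<in>{q \<in> unit_cube m. \<psi> q = x}. {q' \<in> unit_cube m. cube_dist m q q' < d/2})"
      using q' by blast
  next
    fix q' assume "q' \<in> (\<Union>q\<in>{q \<in> unit_cube m. \<psi> q = x}. {q' \<in> unit_cube m. cube_dist m q q' < d/2})"
    then show "q' \<in> {q' \<in> unit_cube m. \<psi> q' \<in> star x (d/2)}"
      unfolding star_def using \<psi> by blast
  qed
  moreover have "openin (cube_topology m)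
      (\<Union>q\<in>{q \<in> unit_cube m. \<psi> q = x}. {q' \<in> unit_cube m. cube_dist m q q' < d/2})"
    using openin_cube_ball by (intro openin_Union) blast
  ultimately show "openin (cube_topology m) {q' \<in> unit_cube m. \<psi> q' \<in> star x (d/2)}" by simp
qed

lemma star_center:
  assumes "isolating x d" "x \<in> X"
  shows "x \<in> star x (d/2)"
proof -
  obtain n \<phi> p where "\<phi> \<in> \<Phi> n" "p \<in> open_cube n" "x = \<phi> p"
    using open_cubes_cover[OF assms(2)] by blast
  moreover have "cube_dist n p p < d/2" using isolatingD(1)[OF assms(1)] by simp
  ultimately show ?thesis unfolding star_def using open_in_cube by blast
qed

end

section \<open>Flat sections\<close>

lemma (in cube_complex) open_chartE:
  assumes "\<psi> \<in> \<Phi> m" "q \<in> unit_cube m"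
  obtains n \<phi> p where "\<phi> \<in> \<Phi> n" "p \<in> open_cube n" "\<psi> q = \<phi> p"
  using open_cubes_cover[OF chart_in_space[OF assms]] by blast

context local_system_complex
begin

text \<open>
  A point over \<open>y\<close> of the covering space of the local system. It is recorded by its parallel
  transports to the corners of all cubes that contain \<open>y\<close>.
\<close>

definition fibre :: "'x \<Rightarrow> (nat \<Rightarrow> ((nat \<Rightarrow> real) \<Rightarrow> 'x) \<Rightarrow> (nat \<Rightarrow> real) \<Rightarrow> (nat \<Rightarrow> real) \<Rightarrow> 's) \<Rightarrow> bool" where
  "fibre y a \<longleftrightarrow> (\<forall>m. \<forall>\<psi>\<in>\<Phi> m. \<forall>q\<in>unit_cube m. \<psi> q = y \<longrightarrow>
     flat_family m \<psi> (a m \<psi> q) \<and>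
     (\<forall>k c u. \<forall>r\<in>unit_cube k. emb_data k m c u \<longrightarrow> emb k m c u r = q \<longrightarrow>
        (\<forall>w\<in>cube_corners k. a k (pull k m \<psi> c u) r w = a m \<psi> q (emb k m c u w))))"

lemma fibreD:
  assumes "fibre y a" "\<psi> \<in> \<Phi> m" "q \<in> unit_cube m" "\<psi> q = y"
  shows "flat_family m \<psi> (a m \<psi> q)"
    and "emb_data k m c u \<Longrightarrow> r \<in> unit_cube k \<Longrightarrow> emb k m c u r = q \<Longrightarrow> w \<in> cube_corners k \<Longrightarrow>
          a k (pull k m \<psi> c u) r w = a m \<psi> q (emb k m c u w)"
  using assms unfolding fibre_def by blast+

text \<open>Equality of points of the covering space; the values of \<open>a\<close> at charts and
  points not lying over \<open>y\<close> carry no information.\<close>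

definition fibre_eq :: "'x \<Rightarrow> (nat \<Rightarrow> ((nat \<Rightarrow> real) \<Rightarrow> 'x) \<Rightarrow> (nat \<Rightarrow> real) \<Rightarrow> (nat \<Rightarrow> real) \<Rightarrow> 's) \<Rightarrow>
    (nat \<Rightarrow> ((nat \<Rightarrow> real) \<Rightarrow> 'x) \<Rightarrow> (nat \<Rightarrow> real) \<Rightarrow> (nat \<Rightarrow> real) \<Rightarrow> 's) \<Rightarrow> bool" where
  "fibre_eq y a b \<longleftrightarrow> (\<forall>m. \<forall>\<psi>\<in>\<Phi> m. \<forall>q\<in>unit_cube m. \<psi> q = y \<longrightarrow>
     (\<forall>u\<in>cube_corners m. a m \<psi> q u = b m \<psi> q u))"

lemma fibre_eqD:
  "fibre_eq y a b \<Longrightarrow> \<psi> \<in> \<Phi> m \<Longrightarrow> q \<in> unit_cube m \<Longrightarrow> \<psi> q = y \<Longrightarrow> u \<in> cube_corners m \<Longrightarrow>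
    a m \<psi> q u = b m \<psi> q u"
  by (simp add: fibre_eq_def)

lemma fibre_eq_refl [simp]: "fibre_eq y a a"
  and fibre_eq_sym: "fibre_eq y a b \<Longrightarrow> fibre_eq y b a"
  and fibre_eq_trans: "fibre_eq y a b \<Longrightarrow> fibre_eq y b c \<Longrightarrow> fibre_eq y a c"
  by (simp_all add: fibre_eq_def)

lemma flat_family_cong:
  assumes "\<And>u. u \<in> cube_corners m \<Longrightarrow> F u = F' u" "flat_family m \<psi> F"
  shows "flat_family m \<psi> F'"
  unfolding flat_family_def
proof (intro ballI conjI allI impI)
  fix u assume u: "u \<in> cube_corners m"
  show "F' u \<in> M (\<psi> u)" using assms u by (simp add: flat_family_def)
  fix i assume "i < m"
  then show "F' (flip i u) = t (edge m \<psi> u i) (F' u)"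
    using assms(2) assms(1)[OF u] assms(1)[OF flip_corner[OF u \<open>i < m\<close>]] u
    by (simp add: flat_family_def)
qed

lemma fibre_cong:
  assumes "fibre y a" "fibre_eq y a b"
  shows "fibre y b"
  unfolding fibre_def
proof (intro allI ballI impI conjI)
  fix m \<psi> q assume h: "\<psi> \<in> \<Phi> m" "q \<in> unit_cube m" "\<psi> q = y"
  show "flat_family m \<psi> (b m \<psi> q)"
    using flat_family_cong[OF fibre_eqD[OF assms(2) h] fibreD(1)[OF assms(1) h]] .
  fix k c u r w
  assume e: "r \<in> unit_cube k" "emb_data k m c u" "emb k m c u r = q" "w \<in> cube_corners k"
  have "pull k m \<psi> c u \<in> \<Phi> k" "pull k m \<psi> c u r = y" using pull_chart h e by auto
  then have "a k (pull k m \<psi> c u) r w = b k (pull k m \<psi> c u) r w"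
    using fibre_eqD[OF assms(2)] e by blast
  then show "b k (pull k m \<psi> c u) r w = b m \<psi> q (emb k m c u w)"
    using fibreD(2)[OF assms(1) h e(2,1,3,4)] fibre_eqD[OF assms(2) h emb_corner[OF e(2,4)]] by simp
qed

text \<open>Any two charts through \<open>y\<close> share the open cube of \<open>y\<close> as a
  face. Agreement at one corner passes to this face and from there to the other chart.\<close>

lemma fibre_eqI:
  assumes a: "fibre y a" and b: "fibre y b" and \<psi>: "\<psi> \<in> \<Phi> m" "q \<in> unit_cube m" "\<psi> q = y"
    and w: "w \<in> cube_corners m" "a m \<psi> q w = b m \<psi> q w"
  shows "fibre_eq y a b"
  unfolding fibre_eq_def
proof (intro allI ballI impI)
  fix m' \<psi>' q' v
  assume \<psi>': "\<psi>' \<in> \<Phi> m'" "q' \<in> unit_cube m'" "\<psi>' q' = y" and v: "v \<in> cube_corners m'"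
  obtain n \<phi> p where \<phi>: "\<phi> \<in> \<Phi> n" "p \<in> open_cube n" "y = \<phi> p"
    using open_chartE[OF \<psi>(1,2)] \<psi>(3) by metis
  obtain c u where e: "emb_data n m c u" "pull n m \<psi> c u = \<phi>" "emb n m c u p = q"
    using through[OF \<phi>(1,2) \<psi>(1,2)] \<psi>(3) \<phi>(3) by metis
  obtain c' u' where e': "emb_data n m' c' u'" "pull n m' \<psi>' c' u' = \<phi>" "emb n m' c' u' p = q'"
    using through[OF \<phi>(1,2) \<psi>'(1,2)] \<psi>'(3) \<phi>(3) by metis
  let ?o = "cube_origin n"
  have p: "p \<in> unit_cube n" using open_in_cube \<phi> by blast
  have "a m \<psi> q (emb n m c u ?o) = b m \<psi> q (emb n m c u ?o)"
    using flat_unique[OF fibreD(1)[OF a \<psi>] fibreD(1)[OF b \<psi>] w emb_corner[OF e(1) origin_corner]] .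
  then have "a n \<phi> p ?o = b n \<phi> p ?o"
    using fibreD(2)[OF a \<psi> e(1) p e(3) origin_corner] fibreD(2)[OF b \<psi> e(1) p e(3) origin_corner]
    by (simp add: e(2))
  then have "a m' \<psi>' q' (emb n m' c' u' ?o) = b m' \<psi>' q' (emb n m' c' u' ?o)"
    using fibreD(2)[OF a \<psi>' e'(1) p e'(3) origin_corner] fibreD(2)[OF b \<psi>' e'(1) p e'(3) origin_corner]
    by (simp add: e'(2))
  then show "a m' \<psi>' q' v = b m' \<psi>' q' v"
    using flat_unique[OF fibreD(1)[OF a \<psi>'] fibreD(1)[OF b \<psi>'] emb_corner[OF e'(1) origin_corner] _ v]
    by blast
qed

text \<open>The family \<open>F1\<close> is restricted to the open cube of the point, and on each
  chart through the point a flat family extending this restriction is chosen. \<open>good\<close>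
  asks for all ways in which the open cube sits in the chart with \<open>p\<close> over the same
  point; by \<open>through_unique\<close> these are one.\<close>

lemma fibre_exists:
  assumes \<psi>1: "\<psi>1 \<in> \<Phi> m1" "q1 \<in> unit_cube m1" and F1: "flat_family m1 \<psi>1 F1"
  obtains a where "fibre (\<psi>1 q1) a" "\<And>w. w \<in> cube_corners m1 \<Longrightarrow> a m1 \<psi>1 q1 w = F1 w"
proof -
  obtain n \<phi> p where \<phi>: "\<phi> \<in> \<Phi> n" "p \<in> open_cube n" "\<psi>1 q1 = \<phi> p"
    using open_chartE[OF \<psi>1] .
  have p: "p \<in> unit_cube n" using open_in_cube \<phi> by blast
  obtain c1 u1 where e1: "emb_data n m1 c1 u1" "pull n m1 \<psi>1 c1 u1 = \<phi>" "emb n m1 c1 u1 p = q1"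
    using through[OF \<phi>(1,2) \<psi>1 \<phi>(3)] by blast
  define F0 where "F0 = (\<lambda>w. F1 (emb n m1 c1 u1 w))"
  have F0: "flat_family n \<phi> F0" using flat_pull[OF F1 e1(1)] e1(2) by (simp add: F0_def)
  define good where "good = (\<lambda>m \<psi> q F. flat_family m \<psi> F \<and>
    (\<forall>c u. emb_data n m c u \<longrightarrow> pull n m \<psi> c u = \<phi> \<longrightarrow> emb n m c u p = q \<longrightarrow>
      (\<forall>w\<in>cube_corners n. F (emb n m c u w) = F0 w)))"
  define a where "a = (\<lambda>m \<psi> q. SOME F. good m \<psi> q F)"
  have good: "good m \<psi> q (a m \<psi> q)" if \<psi>: "\<psi> \<in> \<Phi> m" "q \<in> unit_cube m" "\<psi> q = \<psi>1 q1" for m \<psi> q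
  proof -
    obtain c u where e: "emb_data n m c u" "pull n m \<psi> c u = \<phi>" "emb n m c u p = q"
      using through[OF \<phi>(1,2) \<psi>(1,2)] \<psi>(3) \<phi>(3) by metis
    let ?o = "cube_origin n"
    have "F0 ?o \<in> M (\<psi> (emb n m c u ?o))"
      using F0 origin_corner corners_in_cube[OF origin_corner] e(2)
      unfolding flat_family_def by (metis pull_apply)
    then obtain F where F: "flat_family m \<psi> F" "F (emb n m c u ?o) = F0 ?o"
      using flat_exists[OF \<psi>(1) emb_corner[OF e(1) origin_corner]] by metis
    have flF: "flat_family n \<phi> (\<lambda>w. F (emb n m c u w))" using flat_pull[OF F(1) e(1)] e(2) by simp
    have FF0: "F (emb n m c u w) = F0 w" if "w \<in> cube_corners n" for w
      using flat_unique[OF flF F0 origin_corner _ that] F(2) by blast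
    have "good m \<psi> q F" unfolding good_def
    proof (intro conjI allI impI ballI F(1))
      fix c' u' w assume "emb_data n m c' u'" "pull n m \<psi> c' u' = \<phi>" "emb n m c' u' p = q"
        "w \<in> cube_corners n"
      then show "F (emb n m c' u' w) = F0 w"
        using through_unique[OF \<phi>(1,2) e(1,2), of c' u'] e(3) FF0 by simp
    qed
    then show ?thesis unfolding a_def by (rule someI[of "good m \<psi> q"])
  qed
  have "fibre (\<psi>1 q1) a" unfolding fibre_def
  proof (intro allI ballI impI conjI)
    fix m \<psi> q assume \<psi>: "\<psi> \<in> \<Phi> m" "q \<in> unit_cube m" "\<psi> q = \<psi>1 q1"
    show fl: "flat_family m \<psi> (a m \<psi> q)" using good[OF \<psi>] good_def by blast
    fix k c u r w
    assume e: "r \<in> unit_cube k" "emb_data k m c u" "emb k m c u r = q" and w: "w \<in> cube_corners k"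
    let ?\<chi> = "pull k m \<psi> c u"
    have \<chi>: "?\<chi> \<in> \<Phi> k" "?\<chi> r = \<psi>1 q1" using pull_chart \<psi> e by auto
    obtain c' u' where e': "emb_data n k c' u'" "pull n k ?\<chi> c' u' = \<phi>" "emb n k c' u' p = r"
      using through[OF \<phi>(1,2) \<chi>(1) e(1)] \<chi>(2) \<phi>(3) by metis
    let ?o = "cube_origin n"
    let ?c = "emb_comp_dir n k c c'" and ?u = "emb k m c u u'"
    have "a k ?\<chi> r (emb n k c' u' ?o) = F0 ?o"
      using good[OF \<chi>(1) e(1) \<chi>(2)] e' origin_corner unfolding good_def by blast
    moreover have "a m \<psi> q (emb n m ?c ?u ?o) = F0 ?o"
    proof -
      have "emb_data n m ?c ?u" "pull n m \<psi> ?c ?u = \<phi>" "emb n m ?c ?u p = q"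
        using emb_comp_data[OF e(2) e'(1)] pull_pull[OF e(2) e'(1), of \<psi>] e'(2)
          emb_comp[OF e(2) e'(1) p] e'(3) e(3) by simp_all
      then show ?thesis using good[OF \<psi>] origin_corner unfolding good_def by blast
    qed
    then have "a m \<psi> q (emb k m c u (emb n k c' u' ?o)) = F0 ?o"
      using emb_comp[OF e(2) e'(1) corners_in_cube[OF origin_corner]] by simp
    moreover have "flat_family k ?\<chi> (a k ?\<chi> r)"
      using good[OF \<chi>(1) e(1) \<chi>(2)] unfolding good_def by blast
    ultimately show "a k ?\<chi> r w = a m \<psi> q (emb k m c u w)"
      using flat_unique[OF _ flat_pull[OF fl e(2)] emb_corner[OF e'(1) origin_corner] _ w] by simp
  qed
  moreover have "a m1 \<psi>1 q1 w = F1 w" if "w \<in> cube_corners m1" for w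
  proof -
    have g: "good m1 \<psi>1 q1 (a m1 \<psi>1 q1)" using good \<psi>1 by blast
    then have "a m1 \<psi>1 q1 (emb n m1 c1 u1 (cube_origin n)) = F1 (emb n m1 c1 u1 (cube_origin n))"
      using e1 origin_corner unfolding good_def F0_def by blast
    then show ?thesis
      using flat_unique[OF _ F1 emb_corner[OF e1(1) origin_corner] _ that] g unfolding good_def by blast
  qed
  ultimately show thesis using that by blast
qed

text \<open>A continuous section of the covering, expressed as local constancy in charts, which
  avoids putting a topology on the covering space.\<close>

definition section_on :: "'x set \<Rightarrow> (nat \<Rightarrow> ((nat \<Rightarrow> real) \<Rightarrow> 'x) \<Rightarrow> (nat \<Rightarrow> real) \<Rightarrow> (nat \<Rightarrow> real) \<Rightarrow> 's) \<Rightarrow> bool" where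
  "section_on U a \<longleftrightarrow> openin (complex_topology X \<Phi>) U \<and> (\<forall>y\<in>U. fibre y a) \<and>
     (\<forall>m. \<forall>\<psi>\<in>\<Phi> m. \<forall>q\<in>unit_cube m. \<psi> q \<in> U \<longrightarrow>
        (\<exists>W. openin (cube_topology m) W \<and> q \<in> W \<and>
           (\<forall>q'\<in>W. \<psi> q' \<in> U \<longrightarrow> (\<forall>u\<in>cube_corners m. a m \<psi> q' u = a m \<psi> q u))))"

lemma section_onD:
  assumes "section_on U a"
  shows "openin (complex_topology X \<Phi>) U" "y \<in> U \<Longrightarrow> fibre y a"
    and "\<psi> \<in> \<Phi> m \<Longrightarrow> q \<in> unit_cube m \<Longrightarrow> \<psi> q \<in> U \<Longrightarrow>
        \<exists>W. openin (cube_topology m) W \<and> q \<in> W \<and>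
           (\<forall>q'\<in>W. \<psi> q' \<in> U \<longrightarrow> (\<forall>u\<in>cube_corners m. a m \<psi> q' u = a m \<psi> q u))"
  using assms unfolding section_on_def by blast+

text \<open>Taking \<open>P\<close> to be \<open>True\<close> and \<open>False\<close> shows that
  both agreement and disagreement are open, which is the source of uniqueness of lifts on connected
  sets.\<close>

lemma section_agreement:
  assumes a: "section_on U a" and b: "section_on U' b"
  shows "openin (complex_topology X \<Phi>) {y \<in> U \<inter> U'. fibre_eq y a b = P}"
  unfolding openin_complex_topology
proof (intro conjI allI ballI)
  have op: "openin (complex_topology X \<Phi>) (U \<inter> U')" using section_onD(1) a b by blast
  then show "{y \<in> U \<inter> U'. fibre_eq y a b = P} \<subseteq> X" unfolding openin_complex_topology by blast
  fix m \<psi> assume \<psi>: "\<psi> \<in> \<Phi> m"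
  let ?S = "{q \<in> unit_cube m. \<psi> q \<in> {y \<in> U \<inter> U'. fibre_eq y a b = P}}"
  show "openin (cube_topology m) ?S"
  proof (subst openin_subopen, intro ballI)
    fix q assume "q \<in> ?S"
    then have q: "q \<in> unit_cube m" "\<psi> q \<in> U" "\<psi> q \<in> U'" "fibre_eq (\<psi> q) a b = P" by auto
    let ?o = "cube_origin m"
    obtain W where W: "openin (cube_topology m) W" "q \<in> W"
      "\<And>q'. q' \<in> W \<Longrightarrow> \<psi> q' \<in> U \<Longrightarrow> \<forall>u\<in>cube_corners m. a m \<psi> q' u = a m \<psi> q u"
      using section_onD(3)[OF a \<psi> q(1,2)] by blast
    obtain W' where W': "openin (cube_topology m) W'" "q \<in> W'"
      "\<And>q'. q' \<in> W' \<Longrightarrow> \<psi> q' \<in> U' \<Longrightarrow> \<forall>u\<in>cube_corners m. b m \<psi> q' u = b m \<psi> q u"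
      using section_onD(3)[OF b \<psi> q(1,3)] by blast
    let ?V = "W \<inter> W' \<inter> {q \<in> unit_cube m. \<psi> q \<in> U \<inter> U'}"
    have "openin (cube_topology m) ?V"
      using W(1) W'(1) op \<psi> unfolding openin_complex_topology by blast
    moreover have "?V \<subseteq> ?S"
    proof
      fix q' assume "q' \<in> ?V"
      then have q': "q' \<in> unit_cube m" "\<psi> q' \<in> U" "\<psi> q' \<in> U'" "q' \<in> W" "q' \<in> W'" by auto
      have iff: "fibre_eq (\<psi> r) a b \<longleftrightarrow> a m \<psi> r ?o = b m \<psi> r ?o"
        if "r \<in> unit_cube m" "\<psi> r \<in> U" "\<psi> r \<in> U'" for r
        using fibre_eqI[OF section_onD(2)[OF a that(2)] section_onD(2)[OF b that(3)] \<psi> that(1) _ origin_corner]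
          fibre_eqD[OF _ \<psi> that(1) _ origin_corner] by blast
      have "a m \<psi> q' ?o = a m \<psi> q ?o" "b m \<psi> q' ?o = b m \<psi> q ?o"
        using W(3)[OF q'(4,2)] W'(3)[OF q'(5,3)] origin_corner by blast+
      then have "fibre_eq (\<psi> q') a b \<longleftrightarrow> fibre_eq (\<psi> q) a b"
        using iff[OF q'(1-3)] iff[OF q(1-3)] by simp
      then show "q' \<in> ?S" using q q' by blast
    qed
    moreover have "q \<in> ?V" using W(2) W'(2) q by blast
    ultimately show "\<exists>T. openin (cube_topology m) T \<and> q \<in> T \<and> T \<subseteq> ?S" by blast
  qed
qed

text \<open>Near each occurrence \<open>q\<close> of \<open>x\<close> in a chart the section repeats
  the transports of \<open>a\<close> at \<open>q\<close>. There is only one such \<open>q\<close>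
  within \<open>d/2\<close>, as two would be closer than \<open>d\<close> to each other.\<close>

lemma star_section:
  assumes iso: "isolating x d" and a: "fibre x a"
  shows "\<exists>s. section_on (star x (d/2)) s \<and>
    (\<forall>m. \<forall>\<psi>\<in>\<Phi> m. \<forall>q\<in>unit_cube m. \<forall>q'\<in>unit_cube m. \<psi> q = x \<longrightarrow> cube_dist m q q' < d/2 \<longrightarrow>
       s m \<psi> q' = a m \<psi> q)"
proof -
  define near where "near = (\<lambda>m \<psi> q' q. q \<in> unit_cube m \<and> \<psi> q = x \<and> cube_dist m q q' < d/2)"
  have near_unique: "q = r" if "\<psi> \<in> \<Phi> m" "near m \<psi> q' q" "near m \<psi> q' r" for m \<psi> q' q r
  proof (rule isolatingD(4)[OF iso that(1)])
    show "cube_dist m q r < d"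
      using cube_dist_triangle[of m q r q'] cube_dist_sym[of m q' r] that by (simp add: near_def)
  qed (use that near_def in auto)
  define s where "s = (\<lambda>m \<psi> q'. a m \<psi> (THE q. near m \<psi> q' q))"
  have s: "s m \<psi> q' = a m \<psi> q" if "\<psi> \<in> \<Phi> m" "near m \<psi> q' q" for m \<psi> q' q
  proof -
    have "(THE q. near m \<psi> q' q) = q" using that near_unique by (intro the_equality) blast+
    then show ?thesis by (simp add: s_def)
  qed
  have ex: "\<exists>q. near m \<psi> q' q" if "\<psi> \<in> \<Phi> m" "q' \<in> unit_cube m" "\<psi> q' \<in> star x (d/2)" for m \<psi> q'
    using star_chart[OF iso that] unfolding near_def by metis
  have "section_on (star x (d/2)) s" unfolding section_on_def fibre_def
  proof (intro conjI ballI allI impI openin_star[OF iso])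
    fix y m \<psi> q' assume y: "y \<in> star x (d/2)" and \<psi>: "\<psi> \<in> \<Phi> m" "q' \<in> unit_cube m" "\<psi> q' = y"
    then obtain q where q: "near m \<psi> q' q" using ex by blast
    have aq: "q \<in> unit_cube m" "\<psi> q = x" using q near_def by auto
    show "flat_family m \<psi> (s m \<psi> q')" using s[OF \<psi>(1) q] fibreD(1)[OF a \<psi>(1) aq] by simp
    fix k c u r' w
    assume e: "r' \<in> unit_cube k" "emb_data k m c u" "emb k m c u r' = q'" and w: "w \<in> cube_corners k"
    let ?\<chi> = "pull k m \<psi> c u"
    have \<chi>: "?\<chi> \<in> \<Phi> k" "?\<chi> r' \<in> star x (d/2)" using pull_chart \<psi> e y by auto
    then obtain r where r: "near k ?\<chi> r' r" using ex e by blast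
    then have r': "r \<in> unit_cube k" "\<psi> (emb k m c u r) = x" "cube_dist k r r' < d/2"
      unfolding near_def by auto
    then have "near m \<psi> q' (emb k m c u r)"
      using emb_in_cube[OF e(2) r'(1)] emb_dist[OF e(2) r'(1) e(1)] e(3) by (simp add: near_def)
    then have "emb k m c u r = q" using near_unique[OF \<psi>(1)] q by blast
    moreover have "r \<in> unit_cube k" using r near_def by blast
    ultimately show "s k ?\<chi> r' w = s m \<psi> q' (emb k m c u w)"
      using fibreD(2)[OF a \<psi>(1) aq e(2) _ _ w] s[OF \<psi>(1) q] s[OF \<chi>(1) r] by simp
  next
    fix m \<psi> q' assume \<psi>: "\<psi> \<in> \<Phi> m" "q' \<in> unit_cube m" "\<psi> q' \<in> star x (d/2)"
    then obtain q where q: "near m \<psi> q' q" using ex by blast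
    let ?W = "{q'' \<in> unit_cube m. cube_dist m q q'' < d/2}"
    have const: "s m \<psi> q'' = s m \<psi> q'" if "q'' \<in> ?W" for q''
      using that q s[OF \<psi>(1), of q'' q] s[OF \<psi>(1) q] by (simp add: near_def)
    have center: "q' \<in> ?W" using q \<psi> by (simp add: near_def)
    show "\<exists>W. openin (cube_topology m) W \<and> q' \<in> W \<and>
        (\<forall>q''\<in>W. \<psi> q'' \<in> star x (d/2) \<longrightarrow> (\<forall>u\<in>cube_corners m. s m \<psi> q'' u = s m \<psi> q' u))"
    proof (rule exI[of _ ?W], intro conjI ballI impI)
      show "openin (cube_topology m) ?W" by (rule openin_cube_ball)
      show "q' \<in> ?W" by (rule center)
      show "s m \<psi> q'' u = s m \<psi> q' u" if "q'' \<in> ?W" for q'' u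
        by (rule fun_cong[OF const[OF that]])
    qed
  qed
  then show ?thesis using s unfolding near_def by blast
qed

text \<open>Stars are evenly covered neighbourhoods: a point of the covering over any
  \<open>y\<close> in the star is first moved to the centre inside one common cube and then spread
  over the star.\<close>

lemma local_section:
  assumes "x \<in> X"
  obtains N where "openin (complex_topology X \<Phi>) N" "x \<in> N"
    "\<And>y b. y \<in> N \<Longrightarrow> fibre y b \<Longrightarrow> \<exists>s. section_on N s \<and> fibre_eq y b s"
proof -
  obtain d where iso: "isolating x d" using isolating_exists assms by blast
  have "\<exists>s. section_on (star x (d/2)) s \<and> fibre_eq y b s" if y: "y \<in> star x (d/2)" and b: "fibre y b" for y b
  proof -
    obtain m \<psi> q q' where \<psi>: "\<psi> \<in> \<Phi> m" and q: "q \<in> unit_cube m" "\<psi> q = x"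
      and q': "q' \<in> unit_cube m" "y = \<psi> q'" and lt: "cube_dist m q q' < d/2"
      using y unfolding star_def by blast
    obtain a where a: "fibre x a" "\<And>w. w \<in> cube_corners m \<Longrightarrow> a m \<psi> q w = b m \<psi> q' w"
      using fibre_exists[OF \<psi> q(1) fibreD(1)[OF b \<psi> q'(1) q'(2)[symmetric]]] q(2) by metis
    obtain s where s: "section_on (star x (d/2)) s" "s m \<psi> q' = a m \<psi> q"
      using star_section[OF iso a(1)] \<psi> q q' lt by blast
    have "fibre_eq y b s"
      using fibre_eqI[OF b section_onD(2)[OF s(1) y] \<psi> q'(1) q'(2)[symmetric] origin_corner]
        s(2) a(2)[OF origin_corner] by simp
    then show ?thesis using s by blast
  qed
  then show thesis using that openin_star[OF iso] star_center[OF iso assms] by blast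
qed

end

section \<open>Lifting and monodromy\<close>

context local_system_complex
begin

abbreviation T where "T \<equiv> complex_topology X \<Phi>"

text \<open>A continuous lift of \<open>\<eta>\<close> to the covering: locally it is a section of
  the covering composed with \<open>\<eta>\<close>.\<close>

definition flat_lift where
  "flat_lift \<eta> R L \<longleftrightarrow> (\<forall>z\<in>R. \<exists>U s W. section_on U s \<and> open W \<and> z \<in> W \<and>
     (\<forall>z'\<in>W \<inter> R. \<eta> z' \<in> U \<and> fibre_eq (\<eta> z') (L z') s))"

lemma flat_liftE:
  assumes "flat_lift \<eta> R L" "z \<in> R"
  obtains U s W where "section_on U s" "open W" "z \<in> W"
    "\<And>z'. z' \<in> W \<Longrightarrow> z' \<in> R \<Longrightarrow> \<eta> z' \<in> U \<and> fibre_eq (\<eta> z') (L z') s"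
proof -
  from assms obtain U s W where W: "section_on U s" "open W" "z \<in> W"
    "\<forall>z'\<in>W \<inter> R. \<eta> z' \<in> U \<and> fibre_eq (\<eta> z') (L z') s"
    unfolding flat_lift_def by blast
  show thesis
  proof (rule that[OF W(1-3)])
    fix z' assume "z' \<in> W" "z' \<in> R"
    then show "\<eta> z' \<in> U \<and> fibre_eq (\<eta> z') (L z') s" using W(4) by blast
  qed
qed

lemma flat_lift_fibre: "flat_lift \<eta> R L \<Longrightarrow> z \<in> R \<Longrightarrow> fibre (\<eta> z) (L z)"
  by (erule flat_liftE, assumption) (use fibre_cong fibre_eq_sym section_onD(2) in blast)

lemma flat_lift_mono: "flat_lift \<eta> R L \<Longrightarrow> R' \<subseteq> R \<Longrightarrow> flat_lift \<eta> R' L"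
proof -
  assume L: "flat_lift \<eta> R L" and sub: "R' \<subseteq> R"
  show ?thesis unfolding flat_lift_def
  proof
    fix z assume "z \<in> R'"
    then have "z \<in> R" using sub by blast
    then obtain U s W where "section_on U s" "open W" "z \<in> W"
      "\<And>z'. z' \<in> W \<Longrightarrow> z' \<in> R \<Longrightarrow> \<eta> z' \<in> U \<and> fibre_eq (\<eta> z') (L z') s"
      using flat_liftE[OF L] by metis
    then show "\<exists>U s W. section_on U s \<and> open W \<and> z \<in> W \<and>
        (\<forall>z'\<in>W \<inter> R'. \<eta> z' \<in> U \<and> fibre_eq (\<eta> z') (L z') s)"
      using sub by blast
  qed
qed

lemma flat_lift_cong:
  assumes "\<And>z. z \<in> R \<Longrightarrow> \<eta> z = \<eta>' z"
  shows "flat_lift \<eta> R L \<longleftrightarrow> flat_lift \<eta>' R L"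
  unfolding flat_lift_def by (intro ball_cong ex_cong1 conj_cong HOL.refl) (auto simp: assms)

lemma flat_lift_comp:
  fixes g :: "'z::topological_space \<Rightarrow> 'y::topological_space"
  assumes L: "flat_lift \<eta> R L" and g: "continuous_on R' g" "g ` R' \<subseteq> R"
  shows "flat_lift (\<lambda>z. \<eta> (g z)) R' (\<lambda>z. L (g z))"
  unfolding flat_lift_def
proof
  fix z assume z: "z \<in> R'"
  then have "g z \<in> R" using g by blast
  then obtain U s W where W: "section_on U s" "open W" "g z \<in> W"
    "\<And>z'. z' \<in> W \<Longrightarrow> z' \<in> R \<Longrightarrow> \<eta> z' \<in> U \<and> fibre_eq (\<eta> z') (L z') s"
    using flat_liftE[OF L] by metis
  obtain A where A: "open A" "A \<inter> R' = g -` W \<inter> R'"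
    using g(1) W(2) unfolding continuous_on_open_invariant by blast
  have "z \<in> A" using A z W(3) by blast
  moreover have "\<eta> (g z') \<in> U \<and> fibre_eq (\<eta> (g z')) (L (g z')) s" if "z' \<in> A \<inter> R'" for z'
    using that A g(2) W(4)[of "g z'"] by blast
  ultimately show "\<exists>U s W. section_on U s \<and> open W \<and> z \<in> W \<and>
     (\<forall>z'\<in>W \<inter> R'. \<eta> (g z') \<in> U \<and> fibre_eq (\<eta> (g z')) (L (g z')) s)"
    using W(1) A(1) by blast
qed

lemma open_preimage:
  fixes \<eta> :: "'z::topological_space \<Rightarrow> 'x"
  assumes "continuous_map (top_of_set C) T \<eta>" "openin T U"
  obtains W where "open W" "W \<inter> C = {z \<in> C. \<eta> z \<in> U}"
proof -
  have "openin (top_of_set C) {z \<in> topspace (top_of_set C). \<eta> z \<in> U}"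
    using openin_continuous_map_preimage assms by blast
  then show thesis using that by (auto simp: openin_open)
qed

lemma flat_lift_agreement:
  fixes \<eta> :: "'z::topological_space \<Rightarrow> 'x"
  assumes L: "flat_lift \<eta> C L" and L': "flat_lift \<eta> C L'"
    and \<eta>: "continuous_map (top_of_set C) T \<eta>"
  shows "openin (top_of_set C) {z \<in> C. fibre_eq (\<eta> z) (L z) (L' z) = P}"
proof (subst openin_subopen, intro ballI)
  fix z assume "z \<in> {z \<in> C. fibre_eq (\<eta> z) (L z) (L' z) = P}"
  then have z: "z \<in> C" "fibre_eq (\<eta> z) (L z) (L' z) = P" by auto
  obtain U s W where W: "section_on U s" "open W" "z \<in> W"
    "\<And>z'. z' \<in> W \<Longrightarrow> z' \<in> C \<Longrightarrow> \<eta> z' \<in> U \<and> fibre_eq (\<eta> z') (L z') s"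
    using flat_liftE[OF L z(1)] by metis
  obtain U' s' W' where W': "section_on U' s'" "open W'" "z \<in> W'"
    "\<And>z'. z' \<in> W' \<Longrightarrow> z' \<in> C \<Longrightarrow> \<eta> z' \<in> U' \<and> fibre_eq (\<eta> z') (L' z') s'"
    using flat_liftE[OF L' z(1)] by metis
  obtain V where V: "open V" "V \<inter> C = {z \<in> C. \<eta> z \<in> {y \<in> U \<inter> U'. fibre_eq y s s' = P}}"
    using open_preimage[OF \<eta> section_agreement[OF W(1) W'(1), of P]] .
  have iff: "fibre_eq (\<eta> z') (L z') (L' z') = fibre_eq (\<eta> z') s s'"
    if "z' \<in> C" "z' \<in> W" "z' \<in> W'" for z'
    using W(4)[OF that(2,1)] W'(4)[OF that(3,1)] fibre_eq_sym fibre_eq_trans by meson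
  have "z \<in> V" using V z W W' iff by blast
  moreover have "C \<inter> (W \<inter> W' \<inter> V) \<subseteq> {z \<in> C. fibre_eq (\<eta> z) (L z) (L' z) = P}"
    using V iff by blast
  moreover have "openin (top_of_set C) (C \<inter> (W \<inter> W' \<inter> V))"
    using W(2) W'(2) V(1) by (intro openin_open_Int open_Int)
  ultimately show "\<exists>S. openin (top_of_set C) S \<and> z \<in> S \<and> S \<subseteq> {z \<in> C. fibre_eq (\<eta> z) (L z) (L' z) = P}"
    using z W(3) W'(3) by blast
qed

lemma flat_lift_unique:
  fixes \<eta> :: "'z::topological_space \<Rightarrow> 'x"
  assumes "flat_lift \<eta> C L" "flat_lift \<eta> C L'" "continuous_map (top_of_set C) T \<eta>"
    and "connected C" "z0 \<in> C" "fibre_eq (\<eta> z0) (L z0) (L' z0)" "z \<in> C"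
  shows "fibre_eq (\<eta> z) (L z) (L' z)"
proof (rule ccontr)
  assume n: "\<not> ?thesis"
  let ?A = "\<lambda>P. {z \<in> C. fibre_eq (\<eta> z) (L z) (L' z) = P}"
  have "openin (top_of_set C) (?A True)" "openin (top_of_set C) (?A False)"
    using flat_lift_agreement assms by blast+
  moreover have "C \<subseteq> ?A True \<union> ?A False" "?A True \<inter> ?A False = {}" "?A True \<noteq> {}" "?A False \<noteq> {}"
    using assms n by blast+
  ultimately show False using assms(4) unfolding connected_openin by blast
qed

definition liftable where
  "liftable \<eta> R \<longleftrightarrow> (\<forall>z0\<in>R. \<forall>a. fibre (\<eta> z0) a \<longrightarrow>
     (\<exists>L. flat_lift \<eta> R L \<and> fibre_eq (\<eta> z0) (L z0) a))"

text \<open>At a common point the two local sections agree there and hence nearby, so one of them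
  serves both lifts. At other points closedness keeps the other region away.\<close>

lemma flat_lift_glue:
  fixes \<eta> :: "'z::topological_space \<Rightarrow> 'x"
  assumes L1: "flat_lift \<eta> R1 L1" and L2: "flat_lift \<eta> R2 L2"
    and cl: "closed R1" "closed R2"
    and \<eta>: "continuous_map (top_of_set (R1 \<union> R2)) T \<eta>"
    and eq: "\<And>z. z \<in> R1 \<inter> R2 \<Longrightarrow> fibre_eq (\<eta> z) (L1 z) (L2 z)"
  shows "flat_lift \<eta> (R1 \<union> R2) (\<lambda>z. if z \<in> R1 then L1 z else L2 z)"
  unfolding flat_lift_def
proof
  let ?L = "\<lambda>z. if z \<in> R1 then L1 z else L2 z"
  fix z assume z: "z \<in> R1 \<union> R2"
  show "\<exists>U s W. section_on U s \<and> open W \<and> z \<in> W \<and>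
     (\<forall>z'\<in>W \<inter> (R1 \<union> R2). \<eta> z' \<in> U \<and> fibre_eq (\<eta> z') (?L z') s)"
  proof (cases "z \<in> R1"; cases "z \<in> R2")
    assume n: "z \<in> R1" "z \<notin> R2"
    then obtain U s W where W: "section_on U s" "open W" "z \<in> W"
      "\<And>z'. z' \<in> W \<Longrightarrow> z' \<in> R1 \<Longrightarrow> \<eta> z' \<in> U \<and> fibre_eq (\<eta> z') (L1 z') s"
      using flat_liftE[OF L1] by metis
    have "open (W - R2)" using W(2) cl by blast
    then show ?thesis using W n by (intro exI[of _ U] exI[of _ s] exI[of _ "W - R2"]) auto
  next
    assume n: "z \<notin> R1" "z \<in> R2"
    then obtain U s W where W: "section_on U s" "open W" "z \<in> W"
      "\<And>z'. z' \<in> W \<Longrightarrow> z' \<in> R2 \<Longrightarrow> \<eta> z' \<in> U \<and> fibre_eq (\<eta> z') (L2 z') s"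
      using flat_liftE[OF L2] by metis
    have "open (W - R1)" using W(2) cl by blast
    then show ?thesis using W n by (intro exI[of _ U] exI[of _ s] exI[of _ "W - R1"]) auto
  next
    assume b: "z \<in> R1" "z \<in> R2"
    obtain U s W where W: "section_on U s" "open W" "z \<in> W"
      "\<And>z'. z' \<in> W \<Longrightarrow> z' \<in> R1 \<Longrightarrow> \<eta> z' \<in> U \<and> fibre_eq (\<eta> z') (L1 z') s"
      using flat_liftE[OF L1 b(1)] by metis
    obtain U' s' W' where W': "section_on U' s'" "open W'" "z \<in> W'"
      "\<And>z'. z' \<in> W' \<Longrightarrow> z' \<in> R2 \<Longrightarrow> \<eta> z' \<in> U' \<and> fibre_eq (\<eta> z') (L2 z') s'"
      using flat_liftE[OF L2 b(2)] by metis
    obtain V where V: "open V"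
      "V \<inter> (R1 \<union> R2) = {z \<in> R1 \<union> R2. \<eta> z \<in> {y \<in> U \<inter> U'. fibre_eq y s s' = True}}"
      using open_preimage[OF \<eta> section_agreement[OF W(1) W'(1), of True]] .
    have "fibre_eq (\<eta> z) s s'"
      using W(4)[OF W(3) b(1)] W'(4)[OF W'(3) b(2)] eq b fibre_eq_sym fibre_eq_trans by (meson IntI)
    then have "z \<in> V" using V b W(4)[OF W(3) b(1)] W'(4)[OF W'(3) b(2)] by blast
    moreover have "\<eta> z' \<in> U \<and> fibre_eq (\<eta> z') (?L z') s" if z': "z' \<in> W \<inter> W' \<inter> V \<inter> (R1 \<union> R2)" for z'
    proof (cases "z' \<in> R1")
      case True
      then show ?thesis using W(4)[of z'] z' by simp
    next
      case False
      then have "\<eta> z' \<in> U" and ss: "fibre_eq (\<eta> z') s s'" and "fibre_eq (\<eta> z') (L2 z') s'"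
        using W'(4)[of z'] z' V(2) by blast+
      then show ?thesis using False fibre_eq_trans[OF _ fibre_eq_sym[OF ss]] by simp
    qed
    moreover have "open (W \<inter> W' \<inter> V)" using W(2) W'(2) V(1) by blast
    ultimately show ?thesis
      using W(1,3) W'(3) by (intro exI[of _ U] exI[of _ s] exI[of _ "W \<inter> W' \<inter> V"]) blast
  qed (use z in blast)
qed

text \<open>A lift over one region fixes a starting value at a common point for a lift over the
  other; the two then agree on the connected intersection and can be glued.\<close>

lemma liftable_Un:
  fixes \<eta> :: "'z::topological_space \<Rightarrow> 'x"
  assumes l1: "liftable \<eta> R1" and l2: "liftable \<eta> R2" and cl: "closed R1" "closed R2"
    and con: "connected (R1 \<inter> R2)" and ne: "R1 \<inter> R2 = {} \<Longrightarrow> R1 = {} \<or> R2 = {}"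
    and \<eta>: "continuous_map (top_of_set (R1 \<union> R2)) T \<eta>"
  shows "liftable \<eta> (R1 \<union> R2)"
proof (cases "R1 \<inter> R2 = {}")
  case True
  then show ?thesis using ne l1 l2 by auto
next
  case False
  then obtain z1 where z1: "z1 \<in> R1" "z1 \<in> R2" by blast
  have \<eta>': "continuous_map (top_of_set (R1 \<inter> R2)) T \<eta>"
    using continuous_map_from_subtopology_mono[OF \<eta>] by blast
  have *: "\<exists>L. flat_lift \<eta> (R1 \<union> R2) L \<and> fibre_eq (\<eta> z0) (L z0) a"
    if l: "liftable \<eta> R1" "liftable \<eta> R2" and cl: "closed R1" "closed R2"
      and z1: "z1 \<in> R1" "z1 \<in> R2" and con: "connected (R1 \<inter> R2)"
      and \<eta>: "continuous_map (top_of_set (R1 \<union> R2)) T \<eta>" "continuous_map (top_of_set (R1 \<inter> R2)) T \<eta>"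
      and z0: "z0 \<in> R1" "fibre (\<eta> z0) a" for R1 R2 z0 a
  proof -
    obtain L1 where L1: "flat_lift \<eta> R1 L1" "fibre_eq (\<eta> z0) (L1 z0) a"
      using l(1) z0 unfolding liftable_def by blast
    have "fibre (\<eta> z1) (L1 z1)" using flat_lift_fibre L1 z1 by blast
    then obtain L2 where L2: "flat_lift \<eta> R2 L2" "fibre_eq (\<eta> z1) (L2 z1) (L1 z1)"
      using l(2) z1 unfolding liftable_def by blast
    have "fibre_eq (\<eta> z) (L1 z) (L2 z)" if "z \<in> R1 \<inter> R2" for z
      using flat_lift_unique[OF flat_lift_mono[OF L1(1)] flat_lift_mono[OF L2(1)] \<eta>(2) con, of z1 z]
        z1 that fibre_eq_sym[OF L2(2)] by blast
    then have "flat_lift \<eta> (R1 \<union> R2) (\<lambda>z. if z \<in> R1 then L1 z else L2 z)"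
      using flat_lift_glue[OF L1(1) L2(1) cl \<eta>(1)] by blast
    then show ?thesis
      using L1(2) z0(1) by (intro exI[of _ "\<lambda>z. if z \<in> R1 then L1 z else L2 z"] conjI) simp_all
  qed
  show ?thesis unfolding liftable_def
  proof (intro ballI allI impI)
    fix z0 a assume z0: "z0 \<in> R1 \<union> R2" and a: "fibre (\<eta> z0) a"
    show "\<exists>L. flat_lift \<eta> (R1 \<union> R2) L \<and> fibre_eq (\<eta> z0) (L z0) a"
    proof (cases "z0 \<in> R1")
      case True
      show ?thesis by (rule *[OF l1 l2 cl z1 con \<eta> \<eta>' True a])
    next
      case False
      then have "z0 \<in> R2" using z0 by blast
      then show ?thesis
        using *[OF l2 l1 cl(2,1) z1(2,1) _ _ _ _ a] con \<eta> \<eta>' by (simp add: Un_commute Int_commute)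
    qed
  qed
qed

lemma liftable_local:
  fixes \<eta> :: "'z::topological_space \<Rightarrow> 'x"
  assumes \<eta>: "continuous_map (top_of_set S) T \<eta>" and z: "z \<in> S"
  obtains W where "open W" "z \<in> W" "\<And>R. R \<subseteq> S \<inter> W \<Longrightarrow> liftable \<eta> R"
proof -
  have "\<eta> z \<in> X" using \<eta> z topspace_complex_topology by (auto simp: continuous_map_def)
  then obtain N where N: "openin T N" "\<eta> z \<in> N"
    "\<And>y b. y \<in> N \<Longrightarrow> fibre y b \<Longrightarrow> \<exists>s. section_on N s \<and> fibre_eq y b s"
    using local_section by metis
  obtain W where W: "open W" "W \<inter> S = {z \<in> S. \<eta> z \<in> N}" using open_preimage[OF \<eta> N(1)] .
  have "liftable \<eta> R" if R: "R \<subseteq> S \<inter> W" for R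
    unfolding liftable_def
  proof (intro ballI allI impI)
    fix z0 a assume z0: "z0 \<in> R" and a: "fibre (\<eta> z0) a"
    have RN: "\<eta> z' \<in> N" if "z' \<in> R" for z' using that R W(2) by blast
    obtain s where s: "section_on N s" "fibre_eq (\<eta> z0) a s" using N(3)[OF RN[OF z0] a] by blast
    have "flat_lift \<eta> R (\<lambda>_. s)" unfolding flat_lift_def
    proof
      fix z assume "z \<in> R"
      show "\<exists>U s' W. section_on U s' \<and> open W \<and> z \<in> W \<and>
          (\<forall>z'\<in>W \<inter> R. \<eta> z' \<in> U \<and> fibre_eq (\<eta> z') s s')"
        by (rule exI[of _ N], rule exI[of _ s], rule exI[of _ UNIV]) (use s RN in auto)
    qed
    then show "\<exists>L. flat_lift \<eta> R L \<and> fibre_eq (\<eta> z0) (L z0) a"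
      using fibre_eq_sym[OF s(2)] by blast
  qed
  moreover have "z \<in> W" using W N(2) z by blast
  ultimately show thesis using that W(1) by blast
qed

text \<open>Intersecting with the unit interval is needed because bisection also considers small
  intervals that stick out of it.\<close>

abbreviation rect :: "real \<Rightarrow> real \<Rightarrow> real \<Rightarrow> real \<Rightarrow> (real \<times> real) set" where
  "rect a b c d \<equiv> ({a..b} \<inter> {0..1}) \<times> ({c..d} \<inter> {0..1})"

text \<open>Two nested bisection arguments replace a Lebesgue number: the inner one produces a lift
  over a whole vertical strip around \<open>x\<close>, the outer one joins such strips.\<close>

lemma liftable_square:
  assumes \<eta>: "continuous_map (top_of_set ({0..1} \<times> {0..1::real})) T (\<eta> :: real \<times> real \<Rightarrow> 'x)"
  shows "liftable \<eta> ({0..1} \<times> {0..1})"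
proof -
  have \<eta>R: "continuous_map (top_of_set R) T \<eta>" if "R \<subseteq> {0..1} \<times> {0..1}" for R
    using continuous_map_from_subtopology_mono[OF \<eta> that] .
  have con: "connected ({a..b::real} \<inter> {c..d})" for a b c d :: real
    by simp
  have inner: "\<exists>\<delta>>0. \<forall>a b. a \<le> x \<and> x \<le> b \<and> b - a < \<delta> \<longrightarrow> liftable \<eta> (rect a b 0 1)"
    if x: "0 \<le> x" "x \<le> 1" for x
  proof -
    \<comment> \<open>The width of the strip is quantified inside, so that stacking two pieces only
      costs the minimum of their widths.\<close>
    define Q where "Q = (\<lambda>c d. \<exists>\<delta>>0. \<forall>a b. a \<le> x \<and> x \<le> b \<and> b - a < \<delta> \<longrightarrow> liftable \<eta> (rect a b c d))"
    have "(0::real) \<le> 1" by simp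
    then have "Q 0 1"
    proof (induction rule: Bolzano)
      case (trans c d e)
      obtain \<delta>1 where 1: "\<delta>1 > 0" "\<And>a b. a \<le> x \<Longrightarrow> x \<le> b \<Longrightarrow> b - a < \<delta>1 \<Longrightarrow> liftable \<eta> (rect a b c d)"
        using trans(1) unfolding Q_def by blast
      obtain \<delta>2 where 2: "\<delta>2 > 0" "\<And>a b. a \<le> x \<Longrightarrow> x \<le> b \<Longrightarrow> b - a < \<delta>2 \<Longrightarrow> liftable \<eta> (rect a b d e)"
        using trans(2) unfolding Q_def by blast
      have "liftable \<eta> (rect a b c e)" if "a \<le> x" "x \<le> b" "b - a < min \<delta>1 \<delta>2" for a b
      proof -
        have eq: "rect a b c d \<union> rect a b d e = rect a b c e" using trans(3,4) by auto
        have int: "rect a b c d \<inter> rect a b d e = ({a..b} \<inter> {0..1}) \<times> ({d..d} \<inter> {0..1})"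
          using trans(3,4) by auto
        have "liftable \<eta> (rect a b c d \<union> rect a b d e)"
        proof (rule liftable_Un)
          show "liftable \<eta> (rect a b c d)" "liftable \<eta> (rect a b d e)" using 1 2 that by auto
          show "closed (rect a b c d)" "closed (rect a b d e)" by (intro closed_Times closed_Int closed_atLeastAtMost)+
          show "connected (rect a b c d \<inter> rect a b d e)" unfolding int by (intro connected_Times con)
          show "continuous_map (top_of_set (rect a b c d \<union> rect a b d e)) T \<eta>" by (rule \<eta>R) auto
          show "rect a b c d = {} \<or> rect a b d e = {}" if "rect a b c d \<inter> rect a b d e = {}"
            using that unfolding int by fastforce
        qed
        then show ?thesis unfolding eq .
      qed
      then show ?case unfolding Q_def using 1(1) 2(1) by (intro exI[of _ "min \<delta>1 \<delta>2"]) auto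
    next
      case (local y)
      obtain W where W: "open W" "(x, y) \<in> W" "\<And>R. R \<subseteq> ({0..1} \<times> {0..1}) \<inter> W \<Longrightarrow> liftable \<eta> R"
        using liftable_local[OF \<eta>, of "(x, y)"] x local by auto
      obtain A B where AB: "open A" "open B" "x \<in> A" "y \<in> B" "A \<times> B \<subseteq> W"
        using open_prod_elim[OF W(1,2)] by (metis mem_Sigma_iff)
      obtain \<delta>1 where 1: "\<delta>1 > 0" "\<And>z. \<bar>z - x\<bar> < \<delta>1 \<Longrightarrow> z \<in> A"
        using AB(1,3) by (auto simp: open_dist dist_real_def)
      obtain \<delta>2 where 2: "\<delta>2 > 0" "\<And>z. \<bar>z - y\<bar> < \<delta>2 \<Longrightarrow> z \<in> B"
        using AB(2,4) by (auto simp: open_dist dist_real_def)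
      have "Q c d" if "c \<le> y \<and> y \<le> d \<and> d - c < \<delta>2" for c d
        unfolding Q_def
      proof (intro exI[of _ \<delta>1] conjI allI impI 1(1))
        fix a b assume ab: "a \<le> x \<and> x \<le> b \<and> b - a < \<delta>1"
        have "{a..b} \<subseteq> A" using ab by (auto intro!: 1(2))
        moreover have "{c..d} \<subseteq> B" using that by (auto intro!: 2(2))
        ultimately have "rect a b c d \<subseteq> ({0..1} \<times> {0..1}) \<inter> W" using AB(5) by blast
        then show "liftable \<eta> (rect a b c d)" by (rule W(3))
      qed
      then show ?case using 2(1) by blast
    qed
    then show ?thesis unfolding Q_def .
  qed
  define P where "P = (\<lambda>a b. liftable \<eta> (rect a b 0 1))"
  have "(0::real) \<le> 1" by simp
  then have "P 0 1"
  proof (induction rule: Bolzano)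
    case (trans a b c)
    have eq: "rect a b 0 1 \<union> rect b c 0 1 = rect a c 0 1" using trans(3,4) by auto
    have int: "rect a b 0 1 \<inter> rect b c 0 1 = ({b..b} \<inter> {0..1}) \<times> ({0..1} \<inter> {0..1})"
      using trans(3,4) by auto
    have "liftable \<eta> (rect a b 0 1 \<union> rect b c 0 1)"
    proof (rule liftable_Un)
      show "liftable \<eta> (rect a b 0 1)" "liftable \<eta> (rect b c 0 1)" using trans(1,2) unfolding P_def .
      show "closed (rect a b 0 1)" "closed (rect b c 0 1)" by (intro closed_Times closed_Int closed_atLeastAtMost)+
      show "connected (rect a b 0 1 \<inter> rect b c 0 1)" unfolding int by (intro connected_Times con)
      show "continuous_map (top_of_set (rect a b 0 1 \<union> rect b c 0 1)) T \<eta>" by (rule \<eta>R) auto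
      show "rect a b 0 1 = {} \<or> rect b c 0 1 = {}" if "rect a b 0 1 \<inter> rect b c 0 1 = {}"
        using that unfolding int by fastforce
    qed
    then show ?case unfolding eq P_def .
  next
    case (local x)
    then show ?case unfolding P_def by (rule inner)
  qed
  then show ?thesis by (simp add: P_def)
qed

section \<open>Holonomy of edge paths, read off from lifts at vertices\<close>

definition value_at :: "'x \<Rightarrow> (nat \<Rightarrow> ((nat \<Rightarrow> real) \<Rightarrow> 'x) \<Rightarrow> (nat \<Rightarrow> real) \<Rightarrow> (nat \<Rightarrow> real) \<Rightarrow> 's) \<Rightarrow> 's" where
  "value_at v a = a 0 (\<lambda>r\<in>unit_cube 0. v) vertex_point vertex_point"

text \<open>The 0-cube at \<open>v\<close> is a face of every cube that has \<open>v\<close> as a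
  corner, so the value read on it is the one at that corner.\<close>

lemma value_at_corner:
  assumes "fibre v a" "\<psi> \<in> \<Phi> m" "u \<in> cube_corners m" "\<psi> u = v"
  shows "value_at v a = a m \<psi> u u"
  using fibreD(2)[OF assms(1,2) corners_in_cube[OF assms(3)] assms(4) pull_vertex(1)[OF assms(3)] _
      pull_vertex(3)[OF assms(3)] origin_corner]
    pull_vertex(2)[OF assms(3), of \<psi>] assms(4) corners_in_cube[OF origin_corner]
    pull_vertex(3)[OF assms(3)] by (simp add: value_at_def)

lemma value_at_cong:
  assumes "fibre_eq v a b" "v \<in> vertices \<Phi>"
  shows "value_at v a = value_at v b"
proof -
  obtain \<phi> where \<phi>: "\<phi> \<in> \<Phi> 0" "v = \<phi> vertex_point" using assms(2) by (auto simp: vertices_def)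
  then have "\<phi> = (\<lambda>r\<in>unit_cube 0. v)"
    using chart_fun[OF \<phi>(1)] by (auto simp: unit_cube_0 PiE_iff extensional_def)
  then show ?thesis
    using fibre_eqD[OF assms(1) \<phi>(1) _ _ origin_corner] \<phi> corners_in_cube[OF origin_corner]
    unfolding value_at_def by metis
qed

lemma fibre_with_value:
  assumes "v \<in> vertices \<Phi>" "s \<in> M v"
  obtains a where "fibre v a" "value_at v a = s"
proof -
  obtain \<phi> where \<phi>: "\<phi> \<in> \<Phi> 0" "v = \<phi> vertex_point" using assms by (auto simp: vertices_def)
  have o: "vertex_point \<in> cube_corners 0" by (rule origin_corner)
  obtain F where F: "flat_family 0 \<phi> F" "F vertex_point = s"
    using flat_exists[OF \<phi>(1) o] assms(2) \<phi>(2) by metis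
  obtain a where "fibre v a" "a 0 \<phi> vertex_point vertex_point = s"
    using fibre_exists[OF \<phi>(1) corners_in_cube[OF o] F(1)] F(2) o \<phi>(2) by metis
  then show thesis using that value_at_corner[OF _ \<phi>(1) o] \<phi>(2) by metis
qed

text \<open>While a path stays in one chart, the transport of its lift to a fixed corner is locally
  constant by the definition of \<open>section_on\<close>, hence constant on the connected
  interval.\<close>

lemma flat_lift_locally_constant:
  fixes \<eta> :: "real \<Rightarrow> 'x"
  assumes L: "flat_lift \<eta> {0..1} L" and \<psi>: "\<psi> \<in> \<Phi> m"
    and g: "\<And>x. x \<in> {0..1} \<Longrightarrow> g x \<in> unit_cube m" "\<And>x. x \<in> {0..1} \<Longrightarrow> \<psi> (g x) = \<eta> x"
    and cont: "continuous_map (top_of_set {0..1}) (cube_topology m) g"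
    and u: "u \<in> cube_corners m" and x: "x \<in> {0..1}" "y \<in> {0..1}"
  shows "L x m \<psi> (g x) u = L y m \<psi> (g y) u"
proof (rule ccontr)
  assume n: "L x m \<psi> (g x) u \<noteq> L y m \<psi> (g y) u"
  let ?S = "\<lambda>P. {z \<in> {0..1}. (L z m \<psi> (g z) u = L x m \<psi> (g x) u) = P}"
  have op: "openin (top_of_set {0..1}) (?S P)" for P
  proof (subst openin_subopen, intro ballI)
    fix z assume zS: "z \<in> ?S P"
    then have z: "z \<in> {0..1}" by blast
    obtain U s W where W: "section_on U s" "open W" "z \<in> W"
      "\<And>z'. z' \<in> W \<Longrightarrow> z' \<in> {0..1} \<Longrightarrow> \<eta> z' \<in> U \<and> fibre_eq (\<eta> z') (L z') s"
      using flat_liftE[OF L z] by metis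
    have "\<psi> (g z) \<in> U" using W(4)[OF W(3) z] g(2)[OF z] by simp
    then obtain V where V: "openin (cube_topology m) V" "g z \<in> V"
      "\<And>q. q \<in> V \<Longrightarrow> \<psi> q \<in> U \<Longrightarrow> \<forall>u\<in>cube_corners m. s m \<psi> q u = s m \<psi> (g z) u"
      using section_onD(3)[OF W(1) \<psi> g(1)[OF z]] by blast
    have "openin (top_of_set {0..1}) {z \<in> {0..1}. g z \<in> V}"
      using openin_continuous_map_preimage[OF cont V(1)] by (simp only: topspace_euclidean_subtopology)
    then have "openin (top_of_set {0..1}) (({0..1} \<inter> W) \<inter> {z \<in> {0..1}. g z \<in> V})"
      by (rule openin_Int[OF openin_open_Int[OF W(2)]])
    moreover have "z' \<in> ?S P" if "z' \<in> ({0..1} \<inter> W) \<inter> {z \<in> {0..1}. g z \<in> V}" for z'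
    proof -
      have z': "z' \<in> {0..1}" "z' \<in> W" "g z' \<in> V" using that by auto
      have eq: "L r m \<psi> (g r) u = s m \<psi> (g r) u" if "r \<in> {0..1}" "r \<in> W" for r
        using fibre_eqD[OF _ \<psi> g(1)[OF that(1)] g(2)[OF that(1)] u] W(4)[OF that(2,1)] by blast
      have "\<psi> (g z') \<in> U" using W(4)[OF z'(2,1)] g(2)[OF z'(1)] by simp
      then have "s m \<psi> (g z') u = s m \<psi> (g z) u" using V(3)[OF z'(3)] u by blast
      then have "L z' m \<psi> (g z') u = L z m \<psi> (g z) u" using eq[OF z'(1,2)] eq[OF z W(3)] by simp
      then show ?thesis using zS z'(1) by simp
    qed
    ultimately show "\<exists>T. openin (top_of_set {0..1}) T \<and> z \<in> T \<and> T \<subseteq> ?S P"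
      using z W(3) V(2) by blast
  qed
  have "{0..1} \<subseteq> ?S True \<union> ?S False" "?S True \<inter> ?S False = {}" "?S True \<noteq> {}" "?S False \<noteq> {}"
    using x n by auto
  moreover have "connected {0..1::real}" by simp
  ultimately show False using op[of True] op[of False] unfolding connected_openin by blast
qed

text \<open>Speaks about all lifts and claims the existence of none; in
  \<open>monodromy_trivial\<close> a lift is provided by restricting one of the
  null-homotopy.\<close>

definition carries :: "(real \<Rightarrow> 'x) \<Rightarrow> ('s \<Rightarrow> 's) \<Rightarrow> bool" where
  "carries \<gamma> f \<longleftrightarrow> pathin T \<gamma> \<and>
     (\<forall>L. flat_lift \<gamma> {0..1} L \<longrightarrow> value_at (\<gamma> 1) (L 1) = f (value_at (\<gamma> 0) (L 0)))"

lemma carries_const: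
  assumes "v \<in> vertices \<Phi>"
  shows "carries (\<lambda>_. v) (\<lambda>s. s)"
  unfolding carries_def
proof (intro conjI allI impI)
  obtain \<phi> where \<phi>: "\<phi> \<in> \<Phi> 0" "v = \<phi> vertex_point" using assms by (auto simp: vertices_def)
  have o: "vertex_point \<in> cube_corners 0" "vertex_point \<in> unit_cube 0"
    using origin_corner corners_in_cube by blast+
  show "pathin T (\<lambda>_. v)" using chart_in_space[OF \<phi>(1) o(2)] \<phi>(2) topspace_complex_topology by simp
  fix L :: "real \<Rightarrow> _" assume L: "flat_lift (\<lambda>_. v) {0..1} L"
  have "L 1 0 \<phi> vertex_point vertex_point = L 0 0 \<phi> vertex_point vertex_point"
    using o \<phi> by (intro flat_lift_locally_constant[OF L \<phi>(1), of "\<lambda>_. vertex_point"])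
      (auto simp: topspace_cube_topology)
  then show "value_at v (L 1) = value_at v (L 0)"
    using value_at_corner[OF flat_lift_fibre[OF L] \<phi>(1) o(1)] \<phi>(2) by simp
qed

definition dart_path :: "((nat \<Rightarrow> real) \<Rightarrow> 'x) \<Rightarrow> real \<Rightarrow> 'x" where
  "dart_path e x = e (\<lambda>i\<in>{..<1}. x)"

lemma continuous_dart_point:
  "continuous_map (top_of_set {0..1}) (cube_topology 1) (\<lambda>x::real. \<lambda>i\<in>{..<1}. x)"
  unfolding cube_topology_def
  by (subst continuous_map_componentwise) (auto simp: continuous_map_in_subtopology)

lemma continuous_chart: "\<psi> \<in> \<Phi> m \<Longrightarrow> continuous_map (cube_topology m) T \<psi>"
  unfolding continuous_map_def topspace_cube_topology topspace_complex_topology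
  using chart_in_space by (auto simp: openin_complex_topology)

text \<open>Along the edge the transports to both of its corners stay constant. Only the corner at
  which the value is read changes, from the origin to \<open>one1\<close>, and flatness relates the
  two by \<open>t e\<close>.\<close>

lemma carries_dart:
  assumes e: "e \<in> \<Phi> 1"
  shows "carries (dart_path e) (t e)" "dart_path e 0 = dart_source e"
    "dart_path e 1 = dart_source (dart_rev e)"
proof -
  define g where "g = (\<lambda>x::real. \<lambda>i\<in>{..<1::nat}. x)"
  have g: "g x \<in> unit_cube 1" if "x \<in> {0..1}" for x using that by (auto simp: g_def unit_cube_def)
  have g01: "g 0 = cube_origin 1" "g 1 = one1"
    by (auto simp: g_def cube_origin_def flip_def fun_eq_iff)
  show s: "dart_path e 0 = dart_source e" "dart_path e 1 = dart_source (dart_rev e)"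
    using g01 dart_target[of e] unfolding dart_path_def dart_source_def g_def by simp_all
  have cg: "continuous_map (top_of_set {0..1}) (cube_topology 1) g"
    using continuous_dart_point by (simp add: g_def)
  have dp: "dart_path e = e \<circ> g" by (auto simp: dart_path_def g_def)
  have "pathin T (dart_path e)"
    unfolding pathin_def dp by (rule continuous_map_compose[OF cg continuous_chart[OF e]])
  moreover have "value_at (dart_path e 1) (L 1) = t e (value_at (dart_path e 0) (L 0))"
    if L: "flat_lift (dart_path e) {0..1} L" for L
  proof -
    have f: "fibre (dart_path e x) (L x)" if "x \<in> {0..1}" for x using flat_lift_fibre[OF L that] .
    have o: "cube_origin 1 \<in> cube_corners 1" "one1 \<in> cube_corners 1" by (rule origin_corner one1_corner)+
    have c: "L 1 1 e (g 1) u = L 0 1 e (g 0) u" if "u \<in> cube_corners 1" for u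
      by (rule flat_lift_locally_constant[OF L e g _ cg that]) (simp_all add: dp)
    have fl: "flat_family 1 e (L 0 1 e (g 0))"
      by (rule fibreD(1)[OF f e g]) (auto simp: dp)
    have "value_at (dart_path e 1) (L 1) = L 1 1 e (g 1) one1"
      using value_at_corner[OF f[of 1] e o(2)] by (simp add: dp g01)
    also have "\<dots> = L 0 1 e (g 0) one1" using c[OF o(2)] .
    also have "\<dots> = t (edge 1 e (cube_origin 1) 0) (L 0 1 e (g 0) (cube_origin 1))"
      using fl o(1) unfolding flat_family_def by blast
    also have "\<dots> = t e (L 0 1 e (g 0) (cube_origin 1))" by (simp only: edge_self[OF e])
    also have "L 0 1 e (g 0) (cube_origin 1) = value_at (dart_path e 0) (L 0)"
      using value_at_corner[OF f[of 0] e o(1)] by (simp add: dp g01)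
    finally show ?thesis .
  qed
  ultimately show "carries (dart_path e) (t e)" unfolding carries_def by blast
qed

lemma carries_join:
  assumes c1: "carries \<gamma>1 f1" and c2: "carries \<gamma>2 f2" and eq: "\<gamma>1 1 = \<gamma>2 0"
  shows "carries (\<lambda>x. if x \<le> 1/2 then \<gamma>1 (2 * x) else \<gamma>2 (2 * x - 1)) (f2 \<circ> f1)"
proof -
  let ?\<gamma> = "\<lambda>x. if x \<le> 1/2 then \<gamma>1 (2 * x) else \<gamma>2 (2 * x - 1)"
  have p: "continuous_map (top_of_set {0..1}) T \<gamma>1" "continuous_map (top_of_set {0..1}) T \<gamma>2"
    using c1 c2 by (auto simp: carries_def pathin_def)
  have "continuous_map (top_of_set {0..1}) T ?\<gamma>"
  proof (rule continuous_map_cases_le)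
    show "continuous_map (top_of_set {0..1::real}) euclideanreal (\<lambda>x. x)" by simp
    show "continuous_map (top_of_set {0..1::real}) euclideanreal (\<lambda>x. 1/2)" by simp
    have "continuous_map (top_of_set {0..1/2}) (top_of_set {0..1}) (\<lambda>x::real. 2 * x)"
      by (auto intro!: continuous_intros)
    moreover have "{0..1} \<inter> {x \<in> topspace (top_of_set {0..1}). x \<le> 1/2} = {0..1/2::real}" by auto
    ultimately show "continuous_map (subtopology (top_of_set {0..1}) {x \<in> topspace (top_of_set {0..1}). x \<le> 1/2}) T
        (\<lambda>x. \<gamma>1 (2 * x))"
      using continuous_map_compose[OF _ p(1)] by (simp only: subtopology_subtopology) (simp only: o_def)
    have "continuous_map (top_of_set {1/2..1}) (top_of_set {0..1}) (\<lambda>x::real. 2 * x - 1)"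
      by (auto intro!: continuous_intros)
    moreover have "{0..1} \<inter> {x \<in> topspace (top_of_set {0..1}). 1/2 \<le> x} = {1/2..1::real}" by auto
    ultimately show "continuous_map (subtopology (top_of_set {0..1}) {x \<in> topspace (top_of_set {0..1}). 1/2 \<le> x}) T
        (\<lambda>x. \<gamma>2 (2 * x - 1))"
      using continuous_map_compose[OF _ p(2)] by (simp only: subtopology_subtopology) (simp only: o_def)
    show "\<gamma>1 (2 * x) = \<gamma>2 (2 * x - 1)" if "x = 1/2" for x unfolding that using eq by simp
  qed
  then have "pathin T ?\<gamma>" by (simp add: pathin_def)
  moreover have "value_at (?\<gamma> 1) (L 1) = (f2 \<circ> f1) (value_at (?\<gamma> 0) (L 0))"
    if L: "flat_lift ?\<gamma> {0..1} L" for L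
  proof -
    have "flat_lift (\<lambda>x. ?\<gamma> (x / 2)) {0..1} (\<lambda>x. L (x / 2))"
      by (rule flat_lift_comp[OF L]) (auto intro!: continuous_intros)
    moreover have "flat_lift (\<lambda>x. ?\<gamma> (x / 2)) {0..1} K = flat_lift \<gamma>1 {0..1} K" for K
      by (rule flat_lift_cong) simp
    ultimately have L1: "flat_lift \<gamma>1 {0..1} (\<lambda>x. L (x / 2))" by simp
    have "flat_lift (\<lambda>x. ?\<gamma> ((x + 1) / 2)) {0..1} (\<lambda>x. L ((x + 1) / 2))"
      by (rule flat_lift_comp[OF L]) (auto intro!: continuous_intros)
    moreover have g2: "?\<gamma> ((x + 1) / 2) = \<gamma>2 x" if "x \<in> {0..1}" for x
    proof -
      have "2 * ((x + 1) / 2) - 1 = x" by (simp add: field_simps)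
      moreover have "(x + 1) / 2 \<le> 1/2 \<longleftrightarrow> x = 0" using that by auto
      ultimately show ?thesis using eq by (cases "x = 0") (simp_all only: if_True if_False, simp)
    qed
    have "flat_lift (\<lambda>x. ?\<gamma> ((x + 1) / 2)) {0..1} K = flat_lift \<gamma>2 {0..1} K" for K
      by (rule flat_lift_cong[OF g2])
    ultimately have L2: "flat_lift \<gamma>2 {0..1} (\<lambda>x. L ((x + 1) / 2))" by simp
    show ?thesis
      using c1 c2 L1 L2 eq unfolding carries_def by force
  qed
  ultimately show ?thesis unfolding carries_def by blast
qed

inductive edge_path :: "'x \<Rightarrow> ((nat \<Rightarrow> real) \<Rightarrow> 'x) list \<Rightarrow> 'x \<Rightarrow> bool" where
  edge_path_Nil: "x \<in> vertices \<Phi> \<Longrightarrow> edge_path x [] x"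
| edge_path_Cons: "e \<in> \<Phi> 1 \<Longrightarrow> edge_path (dart_source (dart_rev e)) p y \<Longrightarrow> edge_path (dart_source e) (e # p) y"

lemma edge_path_vertex: "edge_path x p y \<Longrightarrow> x \<in> vertices \<Phi>"
  by (induction rule: edge_path.induct)
    (auto simp: dart_source_def corner_vertex[OF _ origin_corner])

lemma edge_path_carries:
  assumes "edge_path x p y"
  shows "\<exists>\<gamma>. \<gamma> 0 = x \<and> \<gamma> 1 = y \<and> carries \<gamma> (fold t p)"
  using assms
proof (induction rule: edge_path.induct)
  case (edge_path_Nil x)
  then show ?case using carries_const[OF edge_path_Nil] by (intro exI[of _ "\<lambda>_. x"]) (simp add: id_def)
next
  case (edge_path_Cons e p y)
  then obtain \<gamma> where \<gamma>: "\<gamma> 0 = dart_source (dart_rev e)" "\<gamma> 1 = y" "carries \<gamma> (fold t p)" by blast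
  let ?\<gamma> = "\<lambda>x. if x \<le> 1/2 then dart_path e (2 * x) else \<gamma> (2 * x - 1)"
  have "carries ?\<gamma> (fold t p \<circ> t e)"
    using carries_join[OF carries_dart(1)[OF edge_path_Cons(1)] \<gamma>(3)] \<gamma>(1) carries_dart(3)[OF edge_path_Cons(1)]
    by simp
  then show ?case using \<gamma> carries_dart(2)[OF edge_path_Cons(1)] by (intro exI[of _ ?\<gamma>]) (simp add: o_def)
qed

text \<open>The null-homotopy is lifted to the square. Three sides are mapped to \<open>v\<close>,
  so the value of the lift is the same along them; along the fourth side, which is
  \<open>\<gamma>\<close>, it changes by \<open>fold t p\<close>.\<close>

theorem monodromy_trivial:
  assumes sc: "simply_connected_space T" and p: "edge_path v p v" and s: "s \<in> M v"
  shows "fold t p s = s"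
proof -
  have v: "v \<in> vertices \<Phi>" using edge_path_vertex[OF p] .
  obtain \<gamma> where \<gamma>: "\<gamma> 0 = v" "\<gamma> 1 = v" "carries \<gamma> (fold t p)" using edge_path_carries[OF p] by blast
  have "\<gamma> 0 = \<gamma> 1" using \<gamma> by simp
  have "homotopic_with (\<lambda>\<delta>. \<delta> 0 = \<gamma> 0 \<and> \<delta> 1 = \<gamma> 0) (top_of_set {0..1}) T \<gamma> (\<lambda>_. \<gamma> 0)"
    using sc \<gamma>(3) \<open>\<gamma> 0 = \<gamma> 1\<close> unfolding simply_connected_space_def carries_def by blast
  then have "\<exists>h. continuous_map (prod_topology (top_of_set {0..1::real}) (top_of_set {0..1})) T h \<and>
      (\<forall>x. h (0, x) = \<gamma> x) \<and> (\<forall>x. h (1, x) = \<gamma> 0) \<and>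
      (\<forall>x\<in>{0..1}. h (x, 0) = \<gamma> 0 \<and> h (x, 1) = \<gamma> 0)"
    by (simp only: homotopic_with_def)
  then obtain h where hc: "continuous_map (prod_topology (top_of_set {0..1::real}) (top_of_set {0..1})) T h"
    and h0: "\<forall>x. h (0, x) = \<gamma> x" and h1: "\<forall>x. h (1, x) = \<gamma> 0"
    and hs: "\<forall>x\<in>{0..1}. h (x, 0) = \<gamma> 0 \<and> h (x, 1) = \<gamma> 0"
    by (elim exE conjE)
  have h: "h (0, x) = \<gamma> x" "h (1, x) = v" "x \<in> {0..1} \<Longrightarrow> h (x, 0) = v" "x \<in> {0..1} \<Longrightarrow> h (x, 1) = v" for x
    using h0 h1 hs unfolding \<gamma>(1) by simp_all
  have "continuous_map (top_of_set ({0..1} \<times> {0..1::real})) T h"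
    using hc by (simp flip: subtopology_Times)
  then have l: "liftable h ({0..1} \<times> {0..1})" by (rule liftable_square)
  obtain a where a: "fibre v a" "value_at v a = s" using fibre_with_value[OF v s] .
  have "fibre (h (0, 0)) a" using a h \<gamma> by simp
  moreover have "(0, 0) \<in> {0..1::real} \<times> {0..1::real}" by simp
  ultimately obtain L where L: "flat_lift h ({0..1} \<times> {0..1}) L" "fibre_eq v (L (0, 0)) a"
    using l h(1)[of 0] \<gamma>(1) unfolding liftable_def by metis
  have const: "value_at v (L (g 1)) = value_at v (L (g 0))"
    if "continuous_on {0..1} g" "g ` {0..1} \<subseteq> {0..1} \<times> {0..1}" "\<And>x. x \<in> {0..1} \<Longrightarrow> h (g x) = v"
    for g :: "real \<Rightarrow> real \<times> real"
  proof -
    have "flat_lift (\<lambda>x. h (g x)) {0..1} (\<lambda>x. L (g x))" using flat_lift_comp[OF L(1) that(1,2)] .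
    moreover have "flat_lift (\<lambda>x. h (g x)) {0..1} K = flat_lift (\<lambda>_. v) {0..1} K" for K
      by (rule flat_lift_cong[OF that(3)])
    ultimately have "flat_lift (\<lambda>_. v) {0..1} (\<lambda>x. L (g x))" by blast
    then show ?thesis using carries_const[OF v] unfolding carries_def by blast
  qed
  have 1: "value_at v (L (1, 0)) = value_at v (L (0, 0))"
    by (rule const[of "\<lambda>x. (x, 0)"])
      (auto simp: h intro!: continuous_on_Pair continuous_on_id continuous_on_const)
  have 2: "value_at v (L (1, 1)) = value_at v (L (0, 1))"
    by (rule const[of "\<lambda>x. (x, 1)"])
      (auto simp: h intro!: continuous_on_Pair continuous_on_id continuous_on_const)
  have 3: "value_at v (L (1, 1)) = value_at v (L (1, 0))"
    by (rule const[of "\<lambda>x. (1, x)"])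
      (auto simp: h intro!: continuous_on_Pair continuous_on_id continuous_on_const)
  have "flat_lift (\<lambda>x. h (0, x)) {0..1} (\<lambda>x. L (0, x))"
    by (rule flat_lift_comp[OF L(1)]) (auto intro!: continuous_on_Pair continuous_on_id continuous_on_const)
  then have "flat_lift \<gamma> {0..1} (\<lambda>x. L (0, x))" by (simp add: h)
  then have "value_at v (L (0, 1)) = fold t p (value_at v (L (0, 0)))"
    using \<gamma> unfolding carries_def by auto
  moreover have "value_at v (L (0, 0)) = s" using value_at_cong[OF L(2) v] a by simp
  ultimately show ?thesis using 1 2 3 by simp
qed

end

section \<open>The graph of a CAT(0) cube complex\<close>

context cube_complex
begin

definition square :: "((nat \<Rightarrow> real) \<Rightarrow> 'x) \<Rightarrow> ((nat \<Rightarrow> real) \<Rightarrow> 'x) \<Rightarrow> ((nat \<Rightarrow> real) \<Rightarrow> 'x) \<Rightarrow> bool" where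
  "square a b \<psi> \<longleftrightarrow> \<psi> \<in> \<Phi> 2 \<and> edge 2 \<psi> (cube_origin 2) 0 = a \<and> edge 2 \<psi> (cube_origin 2) 1 = b"

definition perp :: "((nat \<Rightarrow> real) \<Rightarrow> 'x) \<Rightarrow> ((nat \<Rightarrow> real) \<Rightarrow> 'x) \<Rightarrow> bool" where
  "perp a b \<longleftrightarrow> (\<exists>\<psi>. square a b \<psi>)"

text \<open>The square is unique by \<open>square_unique\<close>, a consequence of simplicial
  links.\<close>

definition transport :: "((nat \<Rightarrow> real) \<Rightarrow> 'x) \<Rightarrow> ((nat \<Rightarrow> real) \<Rightarrow> 'x) \<Rightarrow> (nat \<Rightarrow> real) \<Rightarrow> 'x" where
  "transport a b = edge 2 (THE \<psi>. square a b \<psi>) (flip 0 (cube_origin 2)) 1"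

lemma corner_edge_eq: "i < n \<Longrightarrow> corner_edge n \<phi> i = edge n \<phi> (cube_origin n) i"
proof
  assume i: "i < n"
  fix r :: "nat \<Rightarrow> real"
  show "corner_edge n \<phi> i r = edge n \<phi> (cube_origin n) i r"
  proof (cases "r \<in> unit_cube 1")
    case True
    have "emb 1 n (single_axis i) (cube_origin n) r = (\<lambda>j\<in>{..<n}. if j = i then r 0 else 0)"
      using True unit_cubeD[OF True, of 0] i
      by (auto simp: emb_def single_axis_def cube_origin_def fun_eq_iff)
    then show ?thesis using True by (simp add: corner_edge_def edge_def)
  next
    case False
    then show ?thesis by (simp add: corner_edge_def edge_def pull_def compose_def)
  qed
qed

lemma corner_edges: "corner_edge n \<phi> ` {..<n} = edge n \<phi> (cube_origin n) ` {..<n}"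
  by (rule image_cong) (auto simp: corner_edge_eq)

lemma corner_edges_2:
  "corner_edge 2 \<phi> ` {..<2} = {edge 2 \<phi> (cube_origin 2) 0, edge 2 \<phi> (cube_origin 2) 1}"
proof -
  have "{..<2} = {0, 1::nat}" by auto
  then show ?thesis using corner_edges[of 2 \<phi>] by (simp only: image_insert image_empty)
qed

lemma pull_identity:
  assumes "\<psi> \<in> \<Phi> m" "\<And>i. i < m \<Longrightarrow> c i = i"
  shows "pull m m \<psi> c (cube_origin m) = \<psi>"
proof
  fix r show "pull m m \<psi> c (cube_origin m) r = \<psi> r"
  proof (cases "r \<in> unit_cube m")
    case True
    have "emb_data m m c (cube_origin m)"
    proof -
      have "{i. i < m \<and> c i < m} = {..<m}" using assms(2) by auto
      moreover have "bij_betw c {..<m} {..<m}" using assms(2) by (auto simp: bij_betw_def inj_on_def image_def)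
      ultimately show ?thesis by (simp add: emb_data_def origin_corner)
    qed
    then have "emb m m c (cube_origin m) r = r"
      using True unit_cubeD[OF True] assms(2)
      by (intro unit_cube_eqI[OF emb_in_cube]) auto
    then show ?thesis using True by simp
  next
    case False
    then show ?thesis using chart_fun[OF assms(1)] by (auto simp: pull_def compose_def PiE_iff extensional_def)
  qed
qed

definition pair_axes :: "nat \<Rightarrow> nat \<Rightarrow> nat \<Rightarrow> nat" where
  "pair_axes i j = (\<lambda>l. if l = i then 0 else if l = j then 1 else 2)"

lemma pair_axes_data:
  assumes "u \<in> cube_corners m" "i < m" "j < m" "i \<noteq> j"
  shows "emb_data 2 m (pair_axes i j) u"
proof -
  have "{l. l < m \<and> pair_axes i j l < 2} = {i, j}" using assms by (auto simp: pair_axes_def)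
  moreover have "bij_betw (pair_axes i j) {i, j} {..<2}"
    using assms(4) by (auto simp: pair_axes_def bij_betw_def)
  ultimately show ?thesis using assms by (simp add: emb_data_def)
qed

lemma pair_edges:
  fixes \<psi> :: "(nat \<Rightarrow> real) \<Rightarrow> 'x"
  assumes "u \<in> cube_corners m" "i < m" "j < m" "i \<noteq> j" "w \<in> cube_corners 2"
  defines "\<xi> \<equiv> pull 2 m \<psi> (pair_axes i j) u" and "e \<equiv> emb 2 m (pair_axes i j) u"
  shows "edge 2 \<xi> w 0 = edge m \<psi> (e w) i" "edge 2 \<xi> w 1 = edge m \<psi> (e w) j"
    and "e (flip 0 w) = flip i (e w)" "e (flip 1 w) = flip j (e w)"
  using edge_pull[OF pair_axes_data[OF assms(1-4)] assms(5), of i \<psi>]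
    edge_pull[OF pair_axes_data[OF assms(1-4)] assms(5), of j \<psi>]
    emb_flip[OF pair_axes_data[OF assms(1-4)] assms(5), of i]
    emb_flip[OF pair_axes_data[OF assms(1-4)] assms(5), of j] assms(2-4)
  by (auto simp: \<xi>_def e_def pair_axes_def)

lemma corner_chart: "\<psi> \<in> \<Phi> n \<Longrightarrow> \<psi> \<in> corners \<Phi> (\<psi> (cube_origin n)) n"
  by (simp add: corners_def)

end

context cat0_cube_complex
begin

lemma edges_inj:
  assumes "\<psi> \<in> \<Phi> n"
  shows "inj_on (edge n \<psi> (cube_origin n)) {..<n}"
proof -
  have "inj_on (corner_edge n \<psi>) {..<n}"
    using links_simplicial[OF corner_vertex[OF assms origin_corner]] corner_chart[OF assms]
    unfolding link_simplicial_def by blast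
  then show ?thesis by (simp add: inj_on_def corner_edge_eq)
qed

lemma square_source:
  assumes "square a b \<psi>"
  shows "a \<in> \<Phi> 1" "dart_source a = \<psi> (cube_origin 2)" "dart_source b = \<psi> (cube_origin 2)" "a \<noteq> b"
  using assms edge_chart[of \<psi> 2 0 "cube_origin 2"] origin_corner[of 2] edges_inj[of \<psi> 2]
    source_edge[of 0 2 "cube_origin 2" \<psi>] source_edge[of 1 2 "cube_origin 2" \<psi>]
  unfolding square_def by (auto dest: inj_onD)

text \<open>Since links are simplicial, two squares with the same pair of edges at a corner differ
  by an isometry fixing the corner. It also fixes both edges, which are different, so it is the
  identity.\<close>

lemma square_unique:
  assumes a: "square a b \<psi>" and b: "square a b \<psi>'"
  shows "\<psi> = \<psi>'"
proof -
  let ?o = "cube_origin 2"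
  have \<psi>: "\<psi> \<in> \<Phi> 2" "\<psi>' \<in> \<Phi> 2" using a b square_def by auto
  have v: "\<psi> ?o = \<psi>' ?o" using square_source(2) a b by metis
  have "corner_edge 2 \<psi> ` {..<2} = corner_edge 2 \<psi>' ` {..<2}"
    unfolding corner_edges_2 using a b by (simp add: square_def)
  then obtain h where h: "face_isometry 2 2 h" "h ?o = ?o" "\<psi>' = compose (unit_cube 2) \<psi> h"
    using links_simplicial[OF corner_vertex[OF \<psi>(1) origin_corner]] corner_chart[OF \<psi>(1)]
      corner_chart[OF \<psi>(2)] v unfolding link_simplicial_def by metis
  obtain c u where e: "emb_data 2 2 c u" "h = emb 2 2 c u" using face_isometry_emb[OF h(1)] .
  have u: "u = ?o" using emb_origin[OF e(1)] e(2) h(2) by simp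
  have \<psi>': "\<psi>' = pull 2 2 \<psi> c ?o" using h(3) e(2) u by (simp add: pull_def)
  have c: "c i < 2" if "i < 2" for i using emb_full[OF e(1) that] .
  have edges: "edge 2 \<psi>' ?o (c i) = edge 2 \<psi> ?o i" if "i < 2" for i
    using edge_pull[OF e(1) origin_corner that c[OF that], of \<psi>] emb_origin[OF e(1)] \<psi>' u by simp
  have eq: "edge 2 \<psi>' ?o i = edge 2 \<psi> ?o i" if "i < 2" for i
    using a b that by (auto simp: square_def less_2_cases_iff)
  have "c i = i" if "i < 2" for i
    using inj_onD[OF edges_inj[OF \<psi>(1)], of "c i" i] edges[OF that] eq[OF c[OF that]] c[OF that] that by simp
  then show ?thesis using pull_identity[OF \<psi>(1)] \<psi>' by metis
qed

lemma transport_square: "square a b \<psi> \<Longrightarrow> transport a b = edge 2 \<psi> (flip 0 (cube_origin 2)) 1"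
proof -
  assume s: "square a b \<psi>"
  then have "(THE \<psi>. square a b \<psi>) = \<psi>" using square_unique by blast
  then show ?thesis by (simp add: transport_def)
qed

lemma face_square:
  assumes "\<xi> \<in> \<Phi> m" "u \<in> cube_corners m" "i < m" "j < m" "i \<noteq> j"
  shows "square (edge m \<xi> u i) (edge m \<xi> u j) (pull 2 m \<xi> (pair_axes i j) u)"
    and "perp (edge m \<xi> u i) (edge m \<xi> u j)"
    and "transport (edge m \<xi> u i) (edge m \<xi> u j) = edge m \<xi> (flip i u) j"
proof -
  have o: "cube_origin 2 \<in> cube_corners 2" "flip 0 (cube_origin 2) \<in> cube_corners 2"
    by (simp_all add: flip_corner origin_corner)
  have data: "emb_data 2 m (pair_axes i j) u" using pair_axes_data assms by blast
  note 1 = pair_edges(1,2)[OF assms(2-5) o(1), of \<xi>] pair_edges(3,4)[OF assms(2-5) o(1)]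
    and 2 = pair_edges(1,2)[OF assms(2-5) o(2), of \<xi>]
  show s: "square (edge m \<xi> u i) (edge m \<xi> u j) (pull 2 m \<xi> (pair_axes i j) u)"
    unfolding square_def using pull_chart[OF assms(1) data] 1 emb_origin[OF data] by simp
  then show "perp (edge m \<xi> u i) (edge m \<xi> u j)" using perp_def by blast
  show "transport (edge m \<xi> u i) (edge m \<xi> u j) = edge m \<xi> (flip i u) j"
    using transport_square[OF s] 1 2 emb_origin[OF data] by simp
qed

lemma perpE:
  assumes "perp a b"
  obtains \<psi> where "\<psi> \<in> \<Phi> 2" "a = edge 2 \<psi> (cube_origin 2) 0" "b = edge 2 \<psi> (cube_origin 2) 1"
  using assms unfolding perp_def square_def by blast

lemma link_edge:
  assumes "perp a b"
  shows "{a, b} \<in> link_simplices \<Phi> (dart_source a)"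
proof -
  obtain \<psi> where \<psi>: "\<psi> \<in> \<Phi> 2" "a = edge 2 \<psi> (cube_origin 2) 0" "b = edge 2 \<psi> (cube_origin 2) 1"
    using perpE[OF assms] .
  have "\<psi> \<in> corners \<Phi> (dart_source a) 2"
    using corner_chart[OF \<psi>(1)] source_edge[of 0 2 "cube_origin 2" \<psi>] \<psi>(2) origin_corner by simp
  moreover have "corner_edge 2 \<psi> ` {..<2} = {a, b}"
    unfolding corner_edges_2 using \<psi> by simp
  ultimately show ?thesis unfolding link_simplices_def by blast
qed

text \<open>The place where flagness is used: three darts that pairwise span squares are three
  pairwise adjacent vertices of a link, hence they span a simplex, and this simplex comes from a
  cube.\<close>

lemma cube_at_corner:
  assumes "perp a b" "perp b c" "perp a c"
  obtains m \<xi> i j k where "\<xi> \<in> \<Phi> m" "i < m" "j < m" "k < m" "i \<noteq> j" "j \<noteq> k" "i \<noteq> k"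
    "a = edge m \<xi> (cube_origin m) i" "b = edge m \<xi> (cube_origin m) j" "c = edge m \<xi> (cube_origin m) k"
proof -
  have src: "x \<in> \<Phi> 1 \<and> y \<in> \<Phi> 1 \<and> dart_source x = dart_source y \<and> x \<noteq> y"
    if xy: "perp x y" for x y
  proof -
    obtain \<psi> where \<psi>: "\<psi> \<in> \<Phi> 2" "x = edge 2 \<psi> (cube_origin 2) 0" "y = edge 2 \<psi> (cube_origin 2) 1"
      using perpE[OF xy] .
    then show ?thesis
      using edge_chart[OF \<psi>(1)] source_edge[of _ 2 "cube_origin 2" \<psi>] origin_corner[of 2] edges_inj[OF \<psi>(1)]
      by (auto dest: inj_onD)
  qed
  let ?v = "dart_source a"
  have v: "?v \<in> vertices \<Phi>" using src[OF assms(1)] corner_vertex[OF _ origin_corner] by (simp add: dart_source_def)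
  have ab: "{a, b} \<in> link_simplices \<Phi> ?v" "{a, c} \<in> link_simplices \<Phi> ?v" "{b, c} \<in> link_simplices \<Phi> ?v"
    using link_edge assms src[OF assms(1)] by metis+
  have "{a, b, c} \<in> link_simplices \<Phi> ?v"
  proof -
    have sub: "{a, b, c} \<subseteq> corners \<Phi> ?v 1"
      using src[OF assms(1)] src[OF assms(2)] by (auto simp: corners_def dart_source_def)
    have pairs: "\<forall>x\<in>{a, b, c}. \<forall>y\<in>{a, b, c}. x \<noteq> y \<longrightarrow> {x, y} \<in> link_simplices \<Phi> ?v"
      using ab by (simp add: insert_commute)
    have "finite {a, b, c} \<and> {a, b, c} \<noteq> {} \<and> {a, b, c} \<subseteq> corners \<Phi> ?v 1 \<and>
        (\<forall>x\<in>{a, b, c}. \<forall>y\<in>{a, b, c}. x \<noteq> y \<longrightarrow> {x, y} \<in> link_simplices \<Phi> ?v) \<longrightarrow>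
        {a, b, c} \<in> link_simplices \<Phi> ?v"
      using links_flag[OF v] unfolding link_flag_def by (rule spec)
    then show ?thesis using sub pairs by (simp only: finite.intros finite_insert insert_not_empty simp_thms)
  qed
  then obtain n \<xi> where \<xi>: "\<xi> \<in> \<Phi> n" "{a, b, c} = edge n \<xi> (cube_origin n) ` {..<n}"
    unfolding link_simplices_def corner_edges by (auto simp: corners_def)
  have "a \<in> edge n \<xi> (cube_origin n) ` {..<n}" "b \<in> edge n \<xi> (cube_origin n) ` {..<n}"
    "c \<in> edge n \<xi> (cube_origin n) ` {..<n}" unfolding \<xi>(2)[symmetric] by simp_all
  then obtain i j k where "i < n" "j < n" "k < n" "a = edge n \<xi> (cube_origin n) i"
    "b = edge n \<xi> (cube_origin n) j" "c = edge n \<xi> (cube_origin n) k" by blast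
  moreover have "i \<noteq> j" "j \<noteq> k" "i \<noteq> k" using calculation src assms by metis+
  ultimately show thesis using that[OF \<xi>(1)] by blast
qed

sublocale darts: dart_complex "\<Phi> 1" dart_source dart_rev perp transport
proof
  fix e assume e: "e \<in> \<Phi> 1"
  have o: "cube_origin 1 \<in> cube_corners 1" by (rule origin_corner)
  show "dart_rev e \<in> \<Phi> 1" unfolding dart_rev_def using pull_chart[OF e id_data[OF one1_corner]] .
  have "dart_rev (dart_rev (edge 1 e (cube_origin 1) 0)) = edge 1 e (cube_origin 1) 0"
    using edge_flip[of 0 1 "cube_origin 1" e] edge_flip[of 0 1 one1 e] o one1_corner by (simp add: flip_flip)
  then show "dart_rev (dart_rev e) = e" unfolding edge_self[OF e] .
next
  fix a b assume ab: "perp a b"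
  obtain \<psi> where \<psi>: "\<psi> \<in> \<Phi> 2" "a = edge 2 \<psi> (cube_origin 2) 0" "b = edge 2 \<psi> (cube_origin 2) 1"
    using perpE[OF ab] .
  let ?o = "cube_origin 2"
  have o: "?o \<in> cube_corners 2" "flip 0 ?o \<in> cube_corners 2" "flip 1 ?o \<in> cube_corners 2"
    by (simp_all add: flip_corner origin_corner)
  show "a \<in> \<Phi> 1" using \<psi> edge_chart o by simp
  show "dart_source a = dart_source b"
    using \<psi> source_edge[of 0 2 ?o \<psi>] source_edge[of 1 2 ?o \<psi>] o by simp
  show "a \<noteq> b" using edges_inj[OF \<psi>(1)] \<psi> by (auto dest: inj_onD)
  show "perp b a" using face_square(2)[OF \<psi>(1) o(1), of 1 0] \<psi> by simp
  have tab: "transport a b = edge 2 \<psi> (flip 0 ?o) 1"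
    using face_square(3)[OF \<psi>(1) o(1), of 0 1] \<psi> by simp
  have tba: "transport b a = edge 2 \<psi> (flip 1 ?o) 0"
    using face_square(3)[OF \<psi>(1) o(1), of 1 0] \<psi> by simp
  have ra: "dart_rev a = edge 2 \<psi> (flip 0 ?o) 0" using edge_flip[of 0 2 ?o \<psi>] \<psi> o by simp
  show "perp (dart_rev a) (transport a b)"
    unfolding tab ra using face_square(2)[OF \<psi>(1) o(2), of 0 1] by simp
  show "transport (dart_rev a) (transport a b) = b"
    unfolding tab ra using face_square(3)[OF \<psi>(1) o(2), of 0 1] \<psi> by (simp add: flip_flip)
  show "transport (transport a b) (dart_rev a) = dart_rev (transport b a)"
    unfolding tab tba ra using face_square(3)[OF \<psi>(1) o(2), of 1 0] edge_flip[of 0 2 "flip 1 ?o" \<psi>] o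
    by (simp add: flip_commute)
next
  fix a b c assume p: "perp a b" "perp b c" "perp a c"
  obtain m \<xi> i j k where \<xi>: "\<xi> \<in> \<Phi> m" and ij: "i < m" "j < m" "k < m" "i \<noteq> j" "j \<noteq> k" "i \<noteq> k"
    and abc: "a = edge m \<xi> (cube_origin m) i" "b = edge m \<xi> (cube_origin m) j" "c = edge m \<xi> (cube_origin m) k"
    using cube_at_corner[OF p] .
  let ?o = "cube_origin m"
  have o: "?o \<in> cube_corners m" "flip i ?o \<in> cube_corners m" "flip j ?o \<in> cube_corners m"
    using ij by (simp_all add: flip_corner origin_corner)
  have t: "transport a b = edge m \<xi> (flip i ?o) j" "transport a c = edge m \<xi> (flip i ?o) k"
    "transport b a = edge m \<xi> (flip j ?o) i" "transport b c = edge m \<xi> (flip j ?o) k"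
    unfolding abc using face_square(3)[OF \<xi> o(1)] ij by auto
  show "perp (transport a b) (transport a c)" unfolding t using face_square(2)[OF \<xi> o(2)] ij by auto
  show "transport (transport a b) (transport a c) = transport (transport b a) (transport b c)"
    unfolding t using face_square(3)[OF \<xi> o(2), of j k] face_square(3)[OF \<xi> o(3), of i k] ij
    by (simp add: flip_commute)
qed

end

text \<open>The rewrite rules about paths mention \<open>\<Phi> 1\<close> and do not match \<open>\<Phi> (Suc 0)\<close>.\<close>

declare One_nat_def [simp del]

context cat0_cube_complex
begin

lemma dart_source_vertex: "e \<in> \<Phi> 1 \<Longrightarrow> dart_source e \<in> vertices \<Phi>"
  unfolding dart_source_def by (rule corner_vertex[OF _ origin_corner])

lemma dpath_snoc:
  "darts.dpath x p (dart_source e) \<Longrightarrow> e \<in> \<Phi> 1 \<Longrightarrow> darts.dpath x (p @ [e]) (dart_source (dart_rev e))"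
  by (induction p arbitrary: x) auto

lemma component_flip:
  assumes "\<psi> \<in> \<Phi> m" "u \<in> cube_corners m" "i < m" "\<exists>p. darts.dpath x p (\<psi> u)"
  shows "\<exists>p. darts.dpath x p (\<psi> (flip i u))"
proof -
  obtain p where "darts.dpath x p (\<psi> u)" using assms(4) by blast
  then have "darts.dpath x (p @ [edge m \<psi> u i]) (dart_source (dart_rev (edge m \<psi> u i)))"
    using dpath_snoc edge_chart[OF assms(1,3,2)] source_edge[OF assms(3,2), of \<psi>] by simp
  then show ?thesis unfolding target_edge[OF assms(3,2)] by blast
qed

text \<open>Reachability is a flat family of truth values, so it does not depend on the corner of a cube.\<close>

lemma component_cube:
  assumes "\<psi> \<in> \<Phi> m" "u \<in> cube_corners m" "w \<in> cube_corners m"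
  shows "(\<exists>p. darts.dpath x p (\<psi> u)) \<longleftrightarrow> (\<exists>p. darts.dpath x p (\<psi> w))"
proof -
  interpret B: local_system_complex X \<Phi> "\<lambda>_. UNIV :: bool set" "\<lambda>_ s. s"
    by unfold_locales (simp add: cube_system_def)
  have flip: "(\<exists>p. darts.dpath x p (\<psi> (flip i v))) \<longleftrightarrow> (\<exists>p. darts.dpath x p (\<psi> v))"
    if "v \<in> cube_corners m" "i < m" for v i
    using component_flip[OF assms(1) that, of x]
      component_flip[OF assms(1) flip_corner[OF that] that(2), of x] by (auto simp: flip_flip)
  have "B.flat_family m \<psi> (\<lambda>v. \<exists>p. darts.dpath x p (\<psi> v))"
    unfolding B.flat_family_def using flip by simp
  moreover have "B.flat_family m \<psi> (\<lambda>_. \<exists>p. darts.dpath x p (\<psi> w))"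
    unfolding B.flat_family_def by simp
  ultimately show ?thesis using B.flat_unique[OF _ _ assms(3) _ assms(2)] by blast
qed

text \<open>The union of the cubes with corners reachable from \<open>x\<close> is open, and so is
  its complement, because in each chart membership is all or nothing; the space is
  connected.\<close>

lemma graph_connected:
  assumes x: "x \<in> vertices \<Phi>" and y: "y \<in> vertices \<Phi>"
  shows "\<exists>p. darts.dpath x p y"
proof -
  let ?T = "complex_topology X \<Phi>"
  define U where "U = {\<psi> q | m \<psi> q. \<psi> \<in> \<Phi> m \<and> q \<in> unit_cube m \<and> (\<exists>p. darts.dpath x p (\<psi> (cube_origin m)))}"
  \<comment> \<open>Two cubes containing the same point share the open cube of the point as a face,
    and reachability passes from one to the other through a corner of this face.\<close>
  have mem: "\<psi> q \<in> U \<longleftrightarrow> (\<exists>p. darts.dpath x p (\<psi> (cube_origin m)))"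
    if \<psi>: "\<psi> \<in> \<Phi> m" "q \<in> unit_cube m" for m \<psi> q
  proof
    assume "\<psi> q \<in> U"
    then obtain m' \<psi>' q' where 1: "\<psi>' \<in> \<Phi> m'" "q' \<in> unit_cube m'" "\<psi>' q' = \<psi> q"
      "\<exists>p. darts.dpath x p (\<psi>' (cube_origin m'))" unfolding U_def by force
    obtain n \<phi> r where \<phi>: "\<phi> \<in> \<Phi> n" "r \<in> open_cube n" "\<psi> q = \<phi> r" using open_chartE[OF \<psi>] .
    obtain c u where e: "emb_data n m c u" "pull n m \<psi> c u = \<phi>"
      using through[OF \<phi>(1,2) \<psi> \<phi>(3)] .
    have "\<psi>' q' = \<phi> r" using 1(3) \<phi>(3) by simp
    then obtain c' u' where e': "emb_data n m' c' u'" "pull n m' \<psi>' c' u' = \<phi>"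
      using through[OF \<phi>(1,2) 1(1,2)] by blast
    let ?o = "cube_origin n"
    have o: "?o \<in> cube_corners n" "?o \<in> unit_cube n" using origin_corner corners_in_cube by blast+
    have "\<exists>p. darts.dpath x p (\<psi>' (emb n m' c' u' ?o))"
      using component_cube[OF 1(1) origin_corner emb_corner[OF e'(1) o(1)]] 1(4) by blast
    moreover have "\<psi>' (emb n m' c' u' ?o) = \<psi> (emb n m c u ?o)"
      using e(2) e'(2) pull_apply[OF o(2)] by metis
    ultimately show "\<exists>p. darts.dpath x p (\<psi> (cube_origin m))"
      using component_cube[OF \<psi>(1) origin_corner emb_corner[OF e(1) o(1)]] by simp
  next
    assume "\<exists>p. darts.dpath x p (\<psi> (cube_origin m))"
    then show "\<psi> q \<in> U" unfolding U_def using \<psi> by blast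
  qed
  have sub: "U \<subseteq> X" unfolding U_def using chart_in_space by blast
  have pre: "openin (cube_topology m) {q \<in> unit_cube m. P}" for m P
    by (cases P) (auto simp: topspace_cube_topology[symmetric])
  have "openin ?T U" unfolding openin_complex_topology
  proof (intro conjI sub allI ballI)
    fix m \<psi> assume \<psi>: "\<psi> \<in> \<Phi> m"
    have "{q \<in> unit_cube m. \<psi> q \<in> U} = {q \<in> unit_cube m. \<exists>p. darts.dpath x p (\<psi> (cube_origin m))}"
      using mem[OF \<psi>] by blast
    then show "openin (cube_topology m) {q \<in> unit_cube m. \<psi> q \<in> U}" using pre by simp
  qed
  moreover have "openin ?T (X - U)" unfolding openin_complex_topology
  proof (intro conjI Diff_subset allI ballI)
    fix m \<psi> assume \<psi>: "\<psi> \<in> \<Phi> m"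
    have "{q \<in> unit_cube m. \<psi> q \<in> X - U} = {q \<in> unit_cube m. \<not> (\<exists>p. darts.dpath x p (\<psi> (cube_origin m)))}"
      using mem[OF \<psi>] chart_in_space[OF \<psi>] by blast
    then show "openin (cube_topology m) {q \<in> unit_cube m. \<psi> q \<in> X - U}" using pre by simp
  qed
  moreover have "connected_space ?T"
    using simply_connected path_connected_imp_connected_space unfolding simply_connected_space_def by blast
  moreover have "X \<subseteq> U \<union> (X - U)" "U \<inter> (X - U) = {}" by blast+
  ultimately have "U = {} \<or> X - U = {}"
    unfolding connected_space_def topspace_complex_topology by blast
  moreover obtain \<phi>x where \<phi>x: "\<phi>x \<in> \<Phi> 0" "x = \<phi>x vertex_point" using x by (auto simp: vertices_def)
  moreover obtain \<phi>y where \<phi>y: "\<phi>y \<in> \<Phi> 0" "y = \<phi>y vertex_point" using y by (auto simp: vertices_def)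
  moreover have o: "vertex_point \<in> unit_cube 0" using origin_corner corners_in_cube by blast
  moreover have "x \<in> U"
    using mem[OF \<phi>x(1) o] \<phi>x(2) darts.dpath.simps(1)[of x x] by blast
  moreover have "y \<in> X" using chart_in_space[OF \<phi>y(1) o] \<phi>y(2) by simp
  ultimately have "y \<in> U" by blast
  then show ?thesis using mem[OF \<phi>y(1) o] \<phi>y(2) by simp
qed

lemma cube_system_of_dart_system:
  assumes "darts.local_system M t"
  shows "cube_system M t"
  unfolding cube_system_def
proof (intro conjI ballI)
  fix \<psi> s assume \<psi>: "\<psi> \<in> \<Phi> 2" and s: "s \<in> M (\<psi> (cube_origin 2))"
  let ?o = "cube_origin 2" and ?a = "edge 2 \<psi> (cube_origin 2) 0" and ?b = "edge 2 \<psi> (cube_origin 2) 1"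
  have o: "?o \<in> cube_corners 2" by (rule origin_corner)
  have "perp ?a ?b" using face_square(2)[OF \<psi> o, of 0 1] by simp
  moreover have "s \<in> M (dart_source ?a)" using s source_edge[of 0 2 ?o \<psi>] o by simp
  ultimately have "t (transport ?a ?b) (t ?a s) = t (transport ?b ?a) (t ?b s)"
    using assms unfolding darts.local_system_def by blast
  then show "t (edge 2 \<psi> (flip 0 ?o) 1) (t ?a s) = t (edge 2 \<psi> (flip 1 ?o) 0) (t ?b s)"
    using face_square(3)[OF \<psi> o, of 0 1] face_square(3)[OF \<psi> o, of 1 0] by simp
next
  fix e s assume "e \<in> \<Phi> 1" "s \<in> M (dart_source e)"
  then show "t e s \<in> M (dart_source (dart_rev e))" "t (dart_rev e) (t e s) = s"
    using assms unfolding darts.local_system_def by simp_all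
qed

sublocale graph: simply_connected_dart_complex "\<Phi> 1" dart_source dart_rev perp transport "vertices \<Phi>"
proof
  show "dart_source e \<in> vertices \<Phi>" if "e \<in> \<Phi> 1" for e using dart_source_vertex[OF that] .
  show "\<exists>p. darts.dpath x p y" if "x \<in> vertices \<Phi>" "y \<in> vertices \<Phi>" for x y
    using graph_connected[OF that] .
  fix M t p x and s :: "((nat \<Rightarrow> real) \<Rightarrow> 'x) list set"
  assume sys: "darts.local_system M t" and p: "darts.dpath x p x" and s: "s \<in> M x"
  interpret S: local_system_complex X \<Phi> M t
    by unfold_locales (rule cube_system_of_dart_system[OF sys])
  show "fold t p s = s"
  proof (cases p)
    case (Cons e q)
    then have x: "x \<in> vertices \<Phi>" using p dart_source_vertex by auto
    have "S.edge_path a p b" if "darts.dpath a p b" "b \<in> vertices \<Phi>" for a b p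
      using that by (induction p arbitrary: a) (auto intro: S.edge_path.intros)
    then show ?thesis using S.monodromy_trivial[OF simply_connected _ s] p x by blast
  qed simp
qed

section \<open>Cubical automorphisms on the graph, and comparison of the intrinsic metric with the
  graph distance\<close>

definition dart_map :: "('x \<Rightarrow> 'x) \<Rightarrow> ((nat \<Rightarrow> real) \<Rightarrow> 'x) \<Rightarrow> (nat \<Rightarrow> real) \<Rightarrow> 'x" where
  "dart_map f e = compose (unit_cube 1) f e"

lemma automorphism_chart:
  "cubical_automorphism X \<Phi> f \<Longrightarrow> \<psi> \<in> \<Phi> n \<Longrightarrow> compose (unit_cube n) f \<psi> \<in> \<Phi> n"
  unfolding cubical_automorphism_def by blast

lemma dart_map_in: "cubical_automorphism X \<Phi> f \<Longrightarrow> e \<in> \<Phi> 1 \<Longrightarrow> dart_map f e \<in> \<Phi> 1"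
  unfolding dart_map_def by (rule automorphism_chart)

lemma dart_map_source: "dart_source (dart_map f e) = f (dart_source e)"
  using corners_in_cube[OF origin_corner] by (simp add: dart_source_def dart_map_def compose_def)

lemma dart_map_target: "dart_source (dart_rev (dart_map f e)) = f (dart_source (dart_rev e))"
  unfolding dart_target using corners_in_cube[OF one1_corner] by (simp add: dart_map_def compose_def)

lemma automorphism_vertex: "cubical_automorphism X \<Phi> f \<Longrightarrow> v \<in> vertices \<Phi> \<Longrightarrow> f v \<in> vertices \<Phi>"
proof -
  assume f: "cubical_automorphism X \<Phi> f" and "v \<in> vertices \<Phi>"
  then obtain \<phi> where \<phi>: "\<phi> \<in> \<Phi> 0" "v = \<phi> vertex_point" by (auto simp: vertices_def)
  have "compose (unit_cube 0) f \<phi> vertex_point = f v"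
    using corners_in_cube[OF origin_corner] \<phi>(2) by (simp add: compose_def)
  then show ?thesis unfolding vertices_def using automorphism_chart[OF f \<phi>(1)]
    by (intro CollectI exI[of _ "compose (unit_cube 0) f \<phi>"]) simp
qed

lemma dpath_map:
  "cubical_automorphism X \<Phi> f \<Longrightarrow> darts.dpath x p y \<Longrightarrow> darts.dpath (f x) (map (dart_map f) p) (f y)"
  by (induction p arbitrary: x) (auto simp: dart_map_in dart_map_source dart_map_target)

lemma gdist_map_le:
  assumes "cubical_automorphism X \<Phi> f" "x \<in> vertices \<Phi>" "y \<in> vertices \<Phi>"
  shows "graph.gdist (f x) (f y) \<le> graph.gdist x y"
proof -
  obtain p where "darts.dpath x p y" "length p = graph.gdist x y" using graph.gdist_path assms by blast
  then show ?thesis using graph.gdist_le[OF dpath_map[OF assms(1)]] by fastforce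
qed

lemma joined_trans:
  assumes "joined_by_string X \<Phi> y z l'" "joined_by_string X \<Phi> x y l"
  shows "joined_by_string X \<Phi> x z (l + l')"
  using assms
proof (induction rule: joined_by_string.induct)
  case (step \<phi> p l' n q)
  then have "joined_by_string X \<Phi> x (\<phi> q) ((l + l') + cube_dist n p q)"
    by (intro joined_by_string.step[of _ _ _ \<phi> p]) auto
  then show ?case by (simp add: add.assoc)
qed simp

lemma joined_chart:
  assumes "\<phi> \<in> \<Phi> n" "p \<in> unit_cube n" "q \<in> unit_cube n"
  shows "joined_by_string X \<Phi> (\<phi> p) (\<phi> q) (cube_dist n p q)"
proof -
  have "joined_by_string X \<Phi> (\<phi> p) (\<phi> p) 0"
    by (rule joined_by_string.refl[OF chart_in_space[OF assms(1,2)]])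
  from joined_by_string.step[OF this assms] show ?thesis by simp
qed

lemma joined_dpath: "darts.dpath x p y \<Longrightarrow> y \<in> vertices \<Phi> \<Longrightarrow> joined_by_string X \<Phi> x y (length p)"
proof (induction p arbitrary: x)
  case Nil
  then obtain \<phi> where "\<phi> \<in> \<Phi> 0" "y = \<phi> vertex_point" by (auto simp: vertices_def)
  then have "y \<in> X" using chart_in_space[OF _ corners_in_cube[OF origin_corner]] by blast
  then show ?case using Nil joined_by_string.refl[of y X \<Phi>] by simp
next
  case (Cons e p)
  have e: "e \<in> \<Phi> 1" "x = e (cube_origin 1)"
    using Cons.prems(1) unfolding darts.dpath.simps by (simp_all add: dart_source_def)
  have "cube_dist 1 (cube_origin 1) one1 = 1"
    by (simp add: cube_dist_def L2_set_def flip_def)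
  then have "joined_by_string X \<Phi> x (dart_source (dart_rev e)) 1"
    using joined_chart[OF e(1) corners_in_cube[OF origin_corner] corners_in_cube[OF one1_corner]] e(2)
    by (simp add: dart_target)
  moreover have "joined_by_string X \<Phi> (dart_source (dart_rev e)) y (length p)" using Cons by simp
  ultimately show ?case using joined_trans[of "dart_source (dart_rev e)" y "length p" x 1] by simp
qed

lemma complex_dist_le: "joined_by_string X \<Phi> x y l \<Longrightarrow> complex_dist X \<Phi> x y \<le> l"
proof -
  assume j: "joined_by_string X \<Phi> x y l"
  have nonneg: "0 \<le> l" if "joined_by_string X \<Phi> x y l" for l
    using that by (induction rule: joined_by_string.induct) (auto simp: cube_dist_def intro!: add_nonneg_nonneg)
  show ?thesis unfolding complex_dist_def
  proof (rule cInf_lower)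
    show "l \<in> {l. joined_by_string X \<Phi> x y l}" using j by simp
    show "bdd_below {l. joined_by_string X \<Phi> x y l}" using nonneg by (intro bdd_belowI[of _ 0]) blast
  qed
qed

text \<open>The string runs inside a cube to the image of its corner \<open>v\<close> under
  \<open>f\<close>, along edges to the image under \<open>g\<close>, and back into the cube
  there.\<close>

lemma complex_dist_orbit_le:
  assumes f: "cubical_automorphism X \<Phi> f" and g: "cubical_automorphism X \<Phi> g"
    and \<phi>: "\<phi> \<in> \<Phi> n" "p \<in> unit_cube n" and v: "v = \<phi> (cube_origin n)"
  shows "complex_dist X \<Phi> (f (\<phi> p)) (g (\<phi> p)) \<le> 2 * cube_dist n p (cube_origin n) + graph.gdist (f v) (g v)"
proof -
  let ?o = "cube_origin n"
  have o: "?o \<in> unit_cube n" using origin_corner corners_in_cube by blast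
  have vV: "v \<in> vertices \<Phi>" unfolding v by (rule corner_vertex[OF \<phi>(1) origin_corner])
  have 1: "joined_by_string X \<Phi> (f (\<phi> p)) (f v) (cube_dist n p ?o)"
    using joined_chart[OF automorphism_chart[OF f \<phi>(1)] \<phi>(2) o] \<phi>(2) o v by (simp add: compose_def)
  have 3: "joined_by_string X \<Phi> (g v) (g (\<phi> p)) (cube_dist n p ?o)"
    using joined_chart[OF automorphism_chart[OF g \<phi>(1)] o \<phi>(2)] \<phi>(2) o v
    by (simp add: compose_def cube_dist_def L2_set_def power2_commute)
  have V: "f v \<in> vertices \<Phi>" "g v \<in> vertices \<Phi>" using automorphism_vertex f g vV by blast+
  obtain q where q: "darts.dpath (f v) q (g v)" "length q = graph.gdist (f v) (g v)"
    using graph.gdist_path[OF V] .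
  have 2: "joined_by_string X \<Phi> (f v) (g v) (graph.gdist (f v) (g v))"
    using joined_dpath[OF q(1) V(2)] q(2) by simp
  show ?thesis
    using complex_dist_le[OF joined_trans[OF 3 joined_trans[OF 2 1]]] by simp
qed

end

section \<open>Virtual complements of central subgroups\<close>

context group
begin

lemma commute_int_pow:
  assumes "x \<in> carrier G" "y \<in> carrier G" "x \<otimes> y = y \<otimes> x"
  shows "x [^] (i::int) \<otimes> y = y \<otimes> x [^] i"
proof (cases i rule: int_cases2)
  case (nonneg n)
  then show ?thesis using group_commutes_pow[OF assms(3,1,2), of n] by (simp only: int_pow_int)
next
  case (nonpos n)
  let ?p = "x [^] n"
  have p: "?p \<in> carrier G" "?p \<otimes> y = y \<otimes> ?p"
    using group_commutes_pow[OF assms(3,1,2), of n] nat_pow_closed[OF assms(1)] by blast+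
  have "inv ?p \<otimes> y = inv ?p \<otimes> (y \<otimes> ?p) \<otimes> inv ?p" using p(1) assms(2) by (simp add: m_assoc)
  also have "\<dots> = inv ?p \<otimes> (?p \<otimes> y) \<otimes> inv ?p" by (simp only: p(2))
  also have "\<dots> = y \<otimes> inv ?p" using p(1) assms(2) by (simp add: m_assoc[symmetric])
  finally show ?thesis unfolding nonpos int_pow_neg_int[OF assms(1)] .
qed

lemma int_hom_one:
  assumes "subgroup C G" "\<And>x y. x \<in> C \<Longrightarrow> y \<in> C \<Longrightarrow> \<tau> (x \<otimes> y) = \<tau> x + (\<tau> y :: int)"
  shows "\<tau> \<one> = 0"
  using assms(2)[of \<one> \<one>] subgroup.one_closed[OF assms(1)] by simp

lemma int_hom_inv:
  assumes "subgroup C G" "\<And>x y. x \<in> C \<Longrightarrow> y \<in> C \<Longrightarrow> \<tau> (x \<otimes> y) = \<tau> x + (\<tau> y :: int)" "x \<in> C"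
  shows "\<tau> (inv x) = - \<tau> x"
proof -
  have "x \<in> carrier G" using subgroup.mem_carrier[OF assms(1,3)] .
  moreover have "\<tau> \<one> = 0" by (rule int_hom_one[OF assms(1,2)])
  ultimately have "\<tau> (x \<otimes> inv x) = 0" by simp
  then show ?thesis using assms(2)[OF assms(3) subgroup.m_inv_closed[OF assms(1,3)]] by simp
qed

lemma int_hom_pow:
  assumes C: "subgroup C G" and hom: "\<And>x y. x \<in> C \<Longrightarrow> y \<in> C \<Longrightarrow> \<tau> (x \<otimes> y) = \<tau> x + (\<tau> y :: int)" and x: "x \<in> C"
  shows "\<tau> (x [^] (i::int)) = i * \<tau> x"
proof -
  have xG: "x \<in> carrier G" using subgroup.mem_carrier[OF C x] .
  have nat: "\<tau> (x [^] n) = int n * \<tau> x \<and> x [^] n \<in> C" for n :: nat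
  proof (induction n)
    case 0
    have "\<tau> \<one> = 0" by (rule int_hom_one[OF C hom])
    then show ?case using subgroup.one_closed[OF C] by simp
  next
    case (Suc n)
    then have "\<tau> (x [^] n \<otimes> x) = \<tau> (x [^] n) + \<tau> x" using hom x by blast
    then show ?case using Suc x subgroup.m_closed[OF C] by (simp add: algebra_simps)
  qed
  show ?thesis
  proof (cases i rule: int_cases2)
    case (nonneg n)
    then show ?thesis using nat[of n] by (simp only: int_pow_int)
  next
    case (nonpos n)
    have "\<tau> (inv (x [^] n)) = - \<tau> (x [^] n)" using int_hom_inv[OF C hom] nat[of n] by blast
    then show ?thesis using nat[of n] unfolding nonpos int_pow_neg_int[OF xG] by simp
  qed
qed

text \<open>
  A homomorphism to the integers that is nonzero on the generator \<open>s\<close> splits off a cyclic factor up to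
  finite index: the remaining generators \<open>t\<close> are pushed into its kernel by replacing them with
  \<open>t\<^sup>N s\<^sup>-\<^sup>\<tau>\<^sup>(\<^sup>t\<^sup>)\<close> where \<open>N = \<tau>(s)\<close>.
\<close>

lemma central_virtual_complement:
  assumes "finite S" "subgroup C G" "S \<subseteq> C" "\<And>s c. s \<in> S \<Longrightarrow> c \<in> C \<Longrightarrow> s \<otimes> c = c \<otimes> s"
    and "\<And>\<tau> x y. \<tau> \<in> T \<Longrightarrow> x \<in> C \<Longrightarrow> y \<in> C \<Longrightarrow> \<tau> (x \<otimes> y) = \<tau> x + (\<tau> y :: int)"
    and "\<And>a. a \<in> generate G S \<Longrightarrow> (\<And>\<tau>. \<tau> \<in> T \<Longrightarrow> \<tau> a = 0) \<Longrightarrow> a = \<one>"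
  shows "\<exists>K F. subgroup K G \<and> K \<subseteq> C \<and> generate G S \<inter> K = {\<one>} \<and> finite F \<and> F \<subseteq> C \<and>
    (\<forall>c\<in>C. \<exists>f\<in>F. \<exists>a\<in>generate G S. \<exists>k\<in>K. c = f \<otimes> a \<otimes> k)"
  using assms
proof (induction "card S" arbitrary: S C rule: less_induct)
  case less
  note S = less.prems(1) and C = less.prems(2) and SC = less.prems(3) and central = less.prems(4)
    and hom = less.prems(5) and detect = less.prems(6)
  interpret C: subgroup C G by (rule C)
  have SG: "S \<subseteq> carrier G" using SC C.subset by blast
  have gen: "subgroup (generate G S) G" using generate_is_subgroup[OF SG] .
  have genC: "generate G S \<subseteq> C" using generate_subgroup_incl[OF SC C] .
  show ?case
  proof (cases "S = {}")
    case True
    then show ?thesis using C C.one_closed C.mem_carrier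
      by (intro exI[of _ C] exI[of _ "{\<one>}"]) (auto simp: generate_empty)
  next
    case False
    then obtain s where s: "s \<in> S" by blast
    let ?S' = "S - {s}"
    have sC: "s \<in> C" and sG: "s \<in> carrier G" using s SC SG by auto
    have card: "card ?S' < card S" by (rule card_Diff1_less[OF S s])
    show ?thesis
    proof (cases "\<forall>\<tau>\<in>T. \<tau> s = 0")
      case True
      then have s1: "s = \<one>" using detect[OF generate.incl[OF s]] by blast
      have S'G: "?S' \<subseteq> carrier G" using SG by blast
      have "S \<subseteq> generate G ?S'" using s1 by (auto intro: generate.incl generate.one)
      then have eq: "generate G ?S' = generate G S"
        using generate_subgroup_incl[OF _ generate_is_subgroup[OF S'G], of S] mono_generate[of ?S' S]
        by (simp add: subset_antisym)
      show ?thesis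
      proof (rule less.hyps[OF card _ C, unfolded eq])
        show "finite ?S'" using S by simp
        show "?S' \<subseteq> C" using SC by blast
        show "x \<otimes> c = c \<otimes> x" if "x \<in> ?S'" "c \<in> C" for x c
          by (rule central) (use that in simp_all)
      qed (fact hom detect)+
    next
      case False
      then obtain \<tau> where \<tau>: "\<tau> \<in> T" "\<tau> s \<noteq> 0" by blast
      define N where "N = \<tau> s"
      have N: "N \<noteq> 0" using \<tau> N_def by simp
      note hom\<tau> = hom[OF \<tau>(1)]
      have h: "\<tau> \<one> = 0" "\<And>x. x \<in> C \<Longrightarrow> \<tau> (inv x) = - \<tau> x"
        "\<And>x i. x \<in> C \<Longrightarrow> \<tau> (x [^] (i::int)) = i * \<tau> x"
        using int_hom_one[OF C hom\<tau>] int_hom_inv[OF C hom\<tau>] int_hom_pow[OF C hom\<tau>] by blast+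
      have powC: "x [^] (i::int) \<in> C" if "x \<in> C" for x i
        using subgroup_int_pow_closed[OF C that] .
      define C' where "C' = {c \<in> C. \<tau> c = 0}"
      have C': "subgroup C' G"
      proof (rule subgroupI)
        show "C' \<subseteq> carrier G" using C.subset by (auto simp: C'_def)
        show "C' \<noteq> {}" using h(1) C.one_closed unfolding C'_def by blast
        show "inv x \<in> C'" if "x \<in> C'" for x
          using that h(2)[of x] C.m_inv_closed by (simp add: C'_def)
        show "x \<otimes> y \<in> C'" if "x \<in> C'" "y \<in> C'" for x y
          using that hom\<tau>[of x y] C.m_closed by (simp add: C'_def)
      qed
      define f where "f t = t [^] N \<otimes> s [^] (- \<tau> t)" for t
      let ?S2 = "f ` ?S'"
      have fC: "f t \<in> C" if "t \<in> S" for t unfolding f_def by (intro C.m_closed powC sC subsetD[OF SC that])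
      have fC': "f t \<in> C'" if "t \<in> S" for t
        using that SC sC powC fC[OF that] hom\<tau> h(3) by (auto simp: C'_def f_def N_def)
      have S2: "finite ?S2" "?S2 \<subseteq> C'" using S fC' by auto
      have card2: "card ?S2 < card S" using card card_image_le[of ?S' f] S by simp
      have sgen: "s \<in> generate G S" using generate.incl[OF s] .
      have fgen: "f t \<in> generate G S" if "t \<in> S" for t
        unfolding f_def by (intro generate.eng subgroup_int_pow_closed[OF gen] sgen generate.incl[OF that])
      have gen2: "generate G ?S2 \<subseteq> generate G S"
        by (rule generate_subgroup_incl[OF _ gen]) (use fgen in auto)
      have S2G: "?S2 \<subseteq> carrier G" using S2 C' subgroup.subset by blast
      have sub2: "subgroup (generate G ?S2) G" using generate_is_subgroup[OF S2G] .
      have Zcent: "a \<otimes> c = c \<otimes> a" if "a \<in> generate G S" "c \<in> C" for a c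
        using that(1)
      proof (induction rule: generate.induct)
        case (inv h)
        have "h \<in> carrier G" "c \<in> carrier G" using inv SG that(2) C.mem_carrier by auto
        then show ?case
          using commute_int_pow[of h c "-1"] central[OF inv that(2)] by (simp add: int_pow_neg)
      next
        case (eng h1 h2)
        have "h1 \<in> carrier G" "h2 \<in> carrier G" "c \<in> carrier G"
          using eng genC that(2) C.mem_carrier by auto
        then show ?case using eng by (metis m_assoc)
      qed (use that C.mem_carrier central in auto)
      \<comment> \<open>Modulo powers of \<open>s\<close>, the \<open>N\<close>-th power of every
        element lies in the subgroup generated by the modified generators; for a generator this is
        the definition of \<open>f\<close>, and centrality carries it to products.\<close>
      have root: "\<exists>j::int. a [^] N \<otimes> s [^] j \<in> generate G ?S2" if "a \<in> generate G S" for a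
        using that
      proof (induction rule: generate.induct)
        case one
        show ?case by (rule exI[of _ 0]) (simp add: generate.one)
      next
        case (incl h)
        show ?case
        proof (cases "h = s")
          case True
          then show ?thesis using sG by (intro exI[of _ "-N"]) (simp add: int_pow_neg generate.one)
        next
          case False
          then have "f h \<in> generate G ?S2" using incl by (intro generate.incl) blast
          then show ?thesis unfolding f_def by blast
        qed
      next
        case (inv h)
        then have hG: "h \<in> carrier G" using SG by blast
        have "\<exists>j::int. h [^] N \<otimes> s [^] j \<in> generate G ?S2"
        proof (cases "h = s")
          case True
          then show ?thesis using sG by (intro exI[of _ "-N"]) (simp add: int_pow_neg generate.one)
        next
          case False
          then have "f h \<in> generate G ?S2" using inv by (intro generate.incl) blast
          then show ?thesis unfolding f_def by blast
        qed
        then obtain j :: int where "h [^] N \<otimes> s [^] j \<in> generate G ?S2" by blast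
        then have "inv (h [^] N \<otimes> s [^] j) \<in> generate G ?S2" using subgroup.m_inv_closed[OF sub2] by blast
        moreover have "h [^] N \<otimes> s [^] j = s [^] j \<otimes> h [^] N"
          using Zcent[OF subgroup_int_pow_closed[OF gen generate.incl[OF inv]] powC[OF sC]] .
        ultimately have "(inv h) [^] N \<otimes> s [^] (- j) \<in> generate G ?S2"
          using hG sG by (simp add: inv_mult_group int_pow_inv int_pow_neg)
        then show ?case by blast
      next
        case (eng h1 h2)
        then obtain j1 j2 :: int where j: "h1 [^] N \<otimes> s [^] j1 \<in> generate G ?S2" "h2 [^] N \<otimes> s [^] j2 \<in> generate G ?S2"
          by blast
        have G: "h1 \<in> carrier G" "h2 \<in> carrier G" "h2 \<in> C" using eng genC C.mem_carrier by auto
        have 1: "(h1 \<otimes> h2) [^] N = h1 [^] N \<otimes> h2 [^] N"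
          using int_pow_mult_distrib Zcent[OF eng(1) G(3)] G by blast
        have 2: "s [^] j1 \<otimes> h2 [^] N = h2 [^] N \<otimes> s [^] j1"
          using Zcent[OF subgroup_int_pow_closed[OF gen sgen] powC[OF G(3)]] .
        have "(h1 [^] N \<otimes> s [^] j1) \<otimes> (h2 [^] N \<otimes> s [^] j2) = h1 [^] N \<otimes> (s [^] j1 \<otimes> h2 [^] N) \<otimes> s [^] j2"
          using G sG by (simp add: m_assoc)
        also have "\<dots> = (h1 \<otimes> h2) [^] N \<otimes> s [^] (j1 + j2)"
          unfolding 1 2 using G sG by (simp add: m_assoc int_pow_mult)
        finally have "(h1 \<otimes> h2) [^] N \<otimes> s [^] (j1 + j2) \<in> generate G ?S2" using j generate.eng by metis
        then show ?case by blast
      qed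
      have "\<exists>K F. subgroup K G \<and> K \<subseteq> C' \<and> generate G ?S2 \<inter> K = {\<one>} \<and> finite F \<and> F \<subseteq> C' \<and>
        (\<forall>c\<in>C'. \<exists>f\<in>F. \<exists>a\<in>generate G ?S2. \<exists>k\<in>K. c = f \<otimes> a \<otimes> k)"
      proof (rule less.hyps[OF card2 S2(1) C' S2(2)])
        show "x \<otimes> c = c \<otimes> x" if "x \<in> ?S2" "c \<in> C'" for x c
          using that fgen Zcent by (auto simp: C'_def)
        show "\<sigma> (x \<otimes> y) = \<sigma> x + \<sigma> y" if "\<sigma> \<in> T" "x \<in> C'" "y \<in> C'" for \<sigma> x y
          using hom that by (auto simp: C'_def)
        show "a = \<one>" if "a \<in> generate G ?S2" "\<And>\<sigma>. \<sigma> \<in> T \<Longrightarrow> \<sigma> a = 0" for a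
          by (rule detect[OF subsetD[OF gen2 that(1)]]) (rule that(2))
      qed
      then obtain K F where K: "subgroup K G" "K \<subseteq> C'" "generate G ?S2 \<inter> K = {\<one>}"
        and F: "finite F" "F \<subseteq> C'"
        and dec: "\<forall>c\<in>C'. \<exists>f\<in>F. \<exists>a\<in>generate G ?S2. \<exists>k\<in>K. c = f \<otimes> a \<otimes> k"
        by (elim exE conjE)
      \<comment> \<open>As \<open>a\<close> lies in the kernel of \<open>\<tau>\<close>, comparing
        values of \<open>\<tau>\<close> gives \<open>j = 0\<close>, so \<open>a [^] N\<close> lies
        in both factors of the smaller decomposition and is trivial. Homomorphisms to the integers
        do not see torsion, hence \<open>a\<close> is trivial as well.\<close>
      have "a = \<one>" if a: "a \<in> generate G S" "a \<in> K" for a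
      proof -
        have aC: "a \<in> C" "\<tau> a = 0" using a K(2) by (auto simp: C'_def)
        obtain j :: int where j: "a [^] N \<otimes> s [^] j \<in> generate G ?S2" using root a by blast
        then have "a [^] N \<otimes> s [^] j \<in> C'" using generate_subgroup_incl[OF S2(2) C'] by blast
        then have "\<tau> (a [^] N \<otimes> s [^] j) = 0" by (simp add: C'_def)
        then have "j * N = 0" using hom\<tau>[OF powC[OF aC(1)] powC[OF sC]] h(3)[OF aC(1)] h(3)[OF sC] aC(2)
          by (simp add: N_def)
        then have "j = 0" using N by simp
        then have "a [^] N \<in> generate G ?S2" using j aC C.mem_carrier by simp
        moreover have "a [^] N \<in> K" using subgroup_int_pow_closed[OF K(1) a(2)] .
        ultimately have a1: "a [^] N = \<one>" using K(3) by blast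
        show ?thesis
        proof (rule detect[OF a(1)])
          fix \<sigma> assume \<sigma>: "\<sigma> \<in> T"
          have "N * \<sigma> a = 0"
            using int_hom_pow[OF C hom[OF \<sigma>] aC(1), of N] int_hom_one[OF C hom[OF \<sigma>]] a1 by simp
          then show "\<sigma> a = 0" using N by simp
        qed
      qed
      moreover have "\<one> \<in> K" "\<one> \<in> generate G S" using K(1) subgroup.one_closed generate.one by blast+
      ultimately have int: "generate G S \<inter> K = {\<one>}" by blast
      \<comment> \<open>Representatives of the residues of \<open>\<tau>\<close> modulo
        \<open>N\<close>: the kernel of \<open>\<tau>\<close> and the powers of \<open>s\<close>
        together meet each residue class in finite index.\<close>
      define rep where "rep r = (SOME c. c \<in> C \<and> \<tau> c mod \<bar>N\<bar> = r)" for r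
      define F' where "F' = (\<lambda>(r, f). rep r \<otimes> f) ` ((\<lambda>c. \<tau> c mod \<bar>N\<bar>) ` C \<times> F)"
      have "(\<lambda>c. \<tau> c mod \<bar>N\<bar>) ` C \<subseteq> {0..<\<bar>N\<bar>}" using N by auto
      then have "finite ((\<lambda>c. \<tau> c mod \<bar>N\<bar>) ` C)" using finite_subset by blast
      then have F'fin: "finite F'" using F(1) by (simp add: F'_def)
      have rep: "rep (\<tau> c mod \<bar>N\<bar>) \<in> C" "\<tau> (rep (\<tau> c mod \<bar>N\<bar>)) mod \<bar>N\<bar> = \<tau> c mod \<bar>N\<bar>" if "c \<in> C" for c
        using someI[of "\<lambda>d. d \<in> C \<and> \<tau> d mod \<bar>N\<bar> = \<tau> c mod \<bar>N\<bar>" c] that by (auto simp: rep_def)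
      have FC: "F \<subseteq> C" using F(2) by (auto simp: C'_def)
      have F'C: "F' \<subseteq> C" using rep(1) FC C.m_closed by (auto simp: F'_def)
      have dec': "\<exists>f\<in>F'. \<exists>a\<in>generate G S. \<exists>k\<in>K. c = f \<otimes> a \<otimes> k" if c: "c \<in> C" for c
      proof -
        let ?r = "\<tau> c mod \<bar>N\<bar>"
        have "\<bar>N\<bar> dvd \<tau> c - \<tau> (rep ?r)" using rep(2)[OF c, symmetric] by (simp only: mod_eq_dvd_iff)
        then have "N dvd \<tau> c - \<tau> (rep ?r)" by (simp only: abs_dvd_iff)
        then obtain q where q: "\<tau> c - \<tau> (rep ?r) = N * q" by (rule dvdE)
        \<comment> \<open>The representative corrects the residue of \<open>\<tau> c\<close> and the
          power of \<open>s\<close> the remaining multiple of \<open>N\<close>, so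
          \<open>\<tau>\<close> vanishes on \<open>c0\<close>.\<close>
        define c0 where "c0 = inv (rep ?r) \<otimes> c \<otimes> s [^] (- q)"
        have rC: "rep ?r \<in> C" "inv (rep ?r) \<in> C" using rep(1)[OF c] C.m_inv_closed by auto
        have "\<tau> c0 = - \<tau> (rep ?r) + \<tau> c + (- q) * N"
          unfolding c0_def using rC c sC powC C.m_closed h(2)[OF rC(1)] h(3)[OF sC] hom\<tau> by (simp add: N_def)
        then have "c0 \<in> C'" using q rC c sC powC C.m_closed by (simp add: C'_def c0_def)
        then obtain f a k where fak: "f \<in> F" "a \<in> generate G ?S2" "k \<in> K" "c0 = f \<otimes> a \<otimes> k"
          using bspec[OF dec] by blast
        have kC: "k \<in> C" using fak(3) K(2) by (auto simp: C'_def)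
        have cG: "rep ?r \<in> carrier G" "f \<in> carrier G" "a \<in> carrier G" "k \<in> carrier G" "c \<in> carrier G"
          using rC(1) fak FC kC c gen2 genC C.mem_carrier by blast+
        have sq: "s [^] q \<otimes> k = k \<otimes> s [^] q"
          using Zcent[OF subgroup_int_pow_closed[OF gen sgen] kC] .
        have "rep ?r \<otimes> c0 \<otimes> s [^] q = c"
          using cG sG by (simp add: c0_def m_assoc[symmetric]) (simp add: m_assoc int_pow_neg)
        then have "c = rep ?r \<otimes> (f \<otimes> a \<otimes> k) \<otimes> s [^] q" using fak(4) by simp
        also have "\<dots> = (rep ?r \<otimes> f) \<otimes> a \<otimes> (k \<otimes> s [^] q)" using cG sG by (simp add: m_assoc)
        also have "\<dots> = (rep ?r \<otimes> f) \<otimes> (a \<otimes> s [^] q) \<otimes> k"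
          unfolding sq[symmetric] using cG sG by (simp add: m_assoc)
        finally have "c = (rep ?r \<otimes> f) \<otimes> (a \<otimes> s [^] q) \<otimes> k" .
        moreover have "a \<otimes> s [^] q \<in> generate G S"
          by (intro generate.eng subsetD[OF gen2 fak(2)] subgroup_int_pow_closed[OF gen sgen])
        moreover have "rep ?r \<otimes> f \<in> F'" unfolding F'_def using c fak(1) by force
        ultimately show ?thesis using fak(3) by blast
      qed
      have "K \<subseteq> C" using K(2) by (auto simp: C'_def)
      then show ?thesis
        by (intro exI[of _ K] exI[of _ F'] conjI ballI K(1) int F'fin F'C dec')
    qed
  qed
qed

lemma internal_direct_product_of_central:
  assumes A: "A \<lhd> G" and K: "subgroup K G" and comm: "\<And>a k. a \<in> A \<Longrightarrow> k \<in> K \<Longrightarrow> a \<otimes> k = k \<otimes> a"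
    and int: "A \<inter> K = {\<one>}"
    and F: "finite F" "F \<subseteq> carrier G" "\<And>g. g \<in> carrier G \<Longrightarrow> \<exists>f\<in>F. \<exists>a\<in>A. \<exists>k\<in>K. g = f \<otimes> a \<otimes> k"
  shows "\<exists>H K. subgroup H G \<and> finite (rcosets H) \<and> A \<subseteq> H \<and>
           subgroup K G \<and> K \<subseteq> H \<and> internal_direct_product (G\<lparr>carrier := H\<rparr>) A K"
proof -
  have sA: "subgroup A G" using A normal_imp_subgroup by blast
  interpret A: subgroup A G by (rule sA)
  interpret K: subgroup K G by (rule K)
  define H where "H = A <#> K"
  have memH: "h \<in> H \<longleftrightarrow> (\<exists>a\<in>A. \<exists>k\<in>K. h = a \<otimes> k)" for h by (auto simp: H_def set_mult_def)
  have swap: "(a \<otimes> k) \<otimes> (b \<otimes> l) = (a \<otimes> b) \<otimes> (k \<otimes> l)" if "a \<in> A" "b \<in> A" "k \<in> K" "l \<in> K" for a b k l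
  proof -
    have "(a \<otimes> k) \<otimes> (b \<otimes> l) = a \<otimes> (k \<otimes> b) \<otimes> l" using that by (simp add: m_assoc)
    also have "k \<otimes> b = b \<otimes> k" by (rule comm[OF that(2,3), symmetric])
    finally show ?thesis using that by (simp add: m_assoc)
  qed
  have H: "subgroup H G"
  proof (rule subgroupI)
    show "H \<subseteq> carrier G" using memH by auto
    show "H \<noteq> {}" using memH A.one_closed K.one_closed by blast
    fix h assume "h \<in> H"
    then obtain a k where h: "a \<in> A" "k \<in> K" "h = a \<otimes> k" using memH by blast
    then have "inv h = inv a \<otimes> inv k" using comm[of a k] by (simp add: inv_mult_group[symmetric])
    then show "inv h \<in> H" using memH h by blast
    fix h' assume "h' \<in> H"
    then obtain a' k' where h': "a' \<in> A" "k' \<in> K" "h' = a' \<otimes> k'" using memH by blast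
    show "h \<otimes> h' \<in> H" using swap[OF h(1) h'(1) h(2) h'(2)] h h' memH by blast
  qed
  interpret H: subgroup H G by (rule H)
  interpret GH: group "G\<lparr>carrier := H\<rparr>" by (rule subgroup_imp_group[OF H])
  have AH: "A \<subseteq> H" using memH K.one_closed by (metis A.mem_carrier r_one subsetI)
  have KH: "K \<subseteq> H" using memH A.one_closed by (metis K.mem_carrier l_one subsetI)
  \<comment> \<open>The elements of \<open>F\<close> represent left cosets of \<open>H\<close>;
    decomposing \<open>inv g\<close> instead of \<open>g\<close> turns them into right
    cosets.\<close>
  have "rcosets H \<subseteq> (\<lambda>f. H #> inv f) ` F"
  proof
    fix R assume "R \<in> rcosets H"
    then obtain g where g: "g \<in> carrier G" "R = H #> g" by (auto simp: RCOSETS_def)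
    obtain f a k where fak: "f \<in> F" "a \<in> A" "k \<in> K" "inv g = f \<otimes> a \<otimes> k" using F(3)[of "inv g"] g by auto
    have fG: "f \<in> carrier G" using fak F(2) by blast
    have hH: "inv (a \<otimes> k) \<in> H" using memH fak H.m_inv_closed by blast
    have "inv g = f \<otimes> (a \<otimes> k)" using fak fG by (simp add: m_assoc)
    then have "g = inv (f \<otimes> (a \<otimes> k))" using g(1) by (metis inv_inv)
    then have "g = inv (a \<otimes> k) \<otimes> inv f" using fak fG by (simp add: inv_mult_group)
    then have "H #> g = H #> inv (a \<otimes> k) #> inv f"
      using coset_mult_assoc[OF H.subset, of "inv (a \<otimes> k)" "inv f"] fG fak by simp
    also have "H #> inv (a \<otimes> k) = H" using coset_join2[OF _ H hH] fak by simp
    finally show "R \<in> (\<lambda>f. H #> inv f) ` F" using g(2) fak(1) by blast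
  qed
  then have fin: "finite (rcosets H)" using F(1) finite_surj by blast
  have "A \<lhd> G\<lparr>carrier := H\<rparr>"
    using normal_restrict_supergroup[OF H A AH] .
  moreover have "K \<lhd> G\<lparr>carrier := H\<rparr>"
  proof (rule GH.normal_invI)
    show "subgroup K (G\<lparr>carrier := H\<rparr>)" using subgroup_incl[OF K H KH] .
    fix x l assume x: "x \<in> carrier (G\<lparr>carrier := H\<rparr>)" and l: "l \<in> K"
    then obtain a k where ak: "a \<in> A" "k \<in> K" "x = a \<otimes> k" using memH by auto
    have "x \<otimes> l \<otimes> inv x = a \<otimes> (k \<otimes> l \<otimes> inv k) \<otimes> inv a"
      using ak l by (simp add: inv_mult_group m_assoc)
    also have "a \<otimes> (k \<otimes> l \<otimes> inv k) = (k \<otimes> l \<otimes> inv k) \<otimes> a"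
      by (rule comm) (use ak l in simp_all)
    also have "(k \<otimes> l \<otimes> inv k) \<otimes> a \<otimes> inv a = k \<otimes> l \<otimes> inv k" using ak l by (simp add: m_assoc)
    finally have "x \<otimes> l \<otimes> inv x \<in> K" using ak l by simp
    moreover have "inv\<^bsub>G\<lparr>carrier := H\<rparr>\<^esub> x = inv x" using m_inv_consistent[OF H] x by simp
    ultimately show "x \<otimes>\<^bsub>G\<lparr>carrier := H\<rparr>\<^esub> l \<otimes>\<^bsub>G\<lparr>carrier := H\<rparr>\<^esub> inv\<^bsub>G\<lparr>carrier := H\<rparr>\<^esub> x \<in> K" by simp
  qed
  moreover have "A <#>\<^bsub>G\<lparr>carrier := H\<rparr>\<^esub> K = H" by (simp add: H_def set_mult_def)
  ultimately have "internal_direct_product (G\<lparr>carrier := H\<rparr>) A K"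
    using int by (simp add: internal_direct_product_def)
  then show ?thesis using H fin AH K KH by blast
qed

end

section \<open>Groups acting on spaces with walls\<close>

locale wall_action = group G for G :: "('g, 'b) monoid_scheme" (structure) +
  fixes V :: "'v set" and act :: "'g \<Rightarrow> 'v \<Rightarrow> 'v" and W :: "'v set set" and x0 :: 'v
  assumes act_in: "g \<in> carrier G \<Longrightarrow> x \<in> V \<Longrightarrow> act g x \<in> V"
    and act_mult: "g \<in> carrier G \<Longrightarrow> h \<in> carrier G \<Longrightarrow> x \<in> V \<Longrightarrow> act (g \<otimes> h) x = act g (act h x)"
    and act_one: "x \<in> V \<Longrightarrow> act \<one> x = x"
    and wall_sub: "D \<in> W \<Longrightarrow> D \<subseteq> V"
    and act_wall: "g \<in> carrier G \<Longrightarrow> D \<in> W \<Longrightarrow> act g ` D \<in> W"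
    and finite_sep: "x \<in> V \<Longrightarrow> y \<in> V \<Longrightarrow> finite {D \<in> W. y \<in> D \<and> x \<notin> D}"
    and base: "x0 \<in> V"
begin

lemma act_inv: "g \<in> carrier G \<Longrightarrow> x \<in> V \<Longrightarrow> act (inv g) (act g x) = x"
  and act_inv': "g \<in> carrier G \<Longrightarrow> x \<in> V \<Longrightarrow> act g (act (inv g) x) = x"
  using act_mult[of "inv g" g x] act_mult[of g "inv g" x] by (simp_all add: act_one)

lemma mem_act:
  assumes "g \<in> carrier G" "D \<subseteq> V" "x \<in> V"
  shows "x \<in> act g ` D \<longleftrightarrow> act (inv g) x \<in> D"
proof
  assume "x \<in> act g ` D"
  then show "act (inv g) x \<in> D" using act_inv[OF assms(1)] assms(2) by auto
next
  assume "act (inv g) x \<in> D"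
  then show "x \<in> act g ` D" using act_inv'[OF assms(1,3)] by (metis imageI)
qed

lemma image_act_mult:
  assumes "g \<in> carrier G" "h \<in> carrier G" "D \<subseteq> V"
  shows "act (g \<otimes> h) ` D = act g ` (act h ` D)"
  unfolding image_image using act_mult[OF assms(1,2)] assms(3) by (intro image_cong) auto

lemma image_act_one: "D \<subseteq> V \<Longrightarrow> act \<one> ` D = D"
  using act_one by (force simp: image_def)

lemma image_act_inv:
  assumes "g \<in> carrier G" "D \<subseteq> V"
  shows "act (inv g) ` (act g ` D) = D"
  using image_act_mult[of "inv g" g D] assms by (simp add: image_act_one)

definition sep :: "'v \<Rightarrow> 'v \<Rightarrow> 'v set set \<Rightarrow> 'v set set" where
  "sep x y Q = {D \<in> Q. y \<in> D \<and> x \<notin> D}"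

lemma finite_sep': "Q \<subseteq> W \<Longrightarrow> x \<in> V \<Longrightarrow> y \<in> V \<Longrightarrow> finite (sep x y Q)"
  unfolding sep_def by (rule finite_subset[OF _ finite_sep[of x y]]) auto

text \<open>Half-spaces rather than walls are counted, since a half-space and its complement
  contribute with opposite signs. The count is therefore informative only for families like the
  orbits of \<open>A\<close>, not for all half-spaces of a cube complex at once.\<close>

definition flow :: "'v set set \<Rightarrow> 'v \<Rightarrow> 'v \<Rightarrow> int" where
  "flow Q x y = int (card (sep x y Q)) - int (card (sep y x Q))"

text \<open>Over a common finite index set the count becomes a sum of differences of indicators, so
  that additivity along three points telescopes.\<close>

lemma flow_sum:
  assumes "finite U" "sep x y Q \<subseteq> U" "sep y x Q \<subseteq> U" "U \<subseteq> Q"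
  shows "flow Q x y = (\<Sum>D\<in>U. of_bool (y \<in> D) - of_bool (x \<in> D))"
proof -
  have 1: "(\<Sum>D\<in>U. of_bool (y \<in> D \<and> x \<notin> D) :: int) = int (card (sep x y Q))"
  proof -
    have "sep x y Q = {D \<in> U. y \<in> D \<and> x \<notin> D}" using assms by (auto simp: sep_def)
    then show ?thesis using assms(1) by (simp add: of_bool_def sum.If_cases Int_def)
  qed
  have 2: "(\<Sum>D\<in>U. of_bool (x \<in> D \<and> y \<notin> D) :: int) = int (card (sep y x Q))"
  proof -
    have "sep y x Q = {D \<in> U. x \<in> D \<and> y \<notin> D}" using assms by (auto simp: sep_def)
    then show ?thesis using assms(1) by (simp add: of_bool_def sum.If_cases Int_def)
  qed
  have "flow Q x y = (\<Sum>D\<in>U. of_bool (y \<in> D \<and> x \<notin> D) - of_bool (x \<in> D \<and> y \<notin> D))"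
    unfolding flow_def sum_subtractf 1 2 by simp
  also have "\<dots> = (\<Sum>D\<in>U. of_bool (y \<in> D) - of_bool (x \<in> D))"
    by (rule sum.cong) auto
  finally show ?thesis .
qed

lemma flow_add:
  assumes "Q \<subseteq> W" "x \<in> V" "y \<in> V" "z \<in> V"
  shows "flow Q x z = flow Q x y + flow Q y z"
proof -
  let ?U = "sep x y Q \<union> sep y x Q \<union> sep y z Q \<union> sep z y Q \<union> sep x z Q \<union> sep z x Q"
  have U: "finite ?U" "?U \<subseteq> Q" using assms finite_sep' by (auto simp: sep_def)
  have "flow Q x z = (\<Sum>D\<in>?U. of_bool (z \<in> D) - of_bool (x \<in> D))"
    "flow Q x y = (\<Sum>D\<in>?U. of_bool (y \<in> D) - of_bool (x \<in> D))"
    "flow Q y z = (\<Sum>D\<in>?U. of_bool (z \<in> D) - of_bool (y \<in> D))"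
    by (rule flow_sum[OF U(1) _ _ U(2)]; blast)+
  then show ?thesis by (simp add: sum.distrib[symmetric])
qed

lemma flow_refl [simp]: "flow Q x x = 0"
  by (simp add: flow_def)

lemma flow_sym: "flow Q y x = - flow Q x y"
  by (simp add: flow_def)

lemma sep_act:
  assumes g: "g \<in> carrier G" and Q: "Q \<subseteq> W" and x: "x \<in> V" "y \<in> V"
  shows "sep (act g x) (act g y) ((`) (act g) ` Q) = (`) (act g) ` sep x y Q"
proof -
  have "act g z \<in> act g ` D \<longleftrightarrow> z \<in> D" if "D \<in> Q" "z \<in> V" for D z
  proof -
    have "D \<subseteq> V" using that(1) Q wall_sub by blast
    then show ?thesis using mem_act[OF g _ act_in[OF g that(2)], of D] act_inv[OF g that(2)] by simp
  qed
  then show ?thesis using x unfolding sep_def by blast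
qed

lemma inj_act: "g \<in> carrier G \<Longrightarrow> Q \<subseteq> W \<Longrightarrow> inj_on ((`) (act g)) Q"
  by (rule inj_onI) (metis image_act_inv subsetD wall_sub)

lemma flow_act:
  assumes g: "g \<in> carrier G" and Q: "Q \<subseteq> W" and x: "x \<in> V" "y \<in> V"
  shows "flow ((`) (act g) ` Q) (act g x) (act g y) = flow Q x y"
proof -
  have "card ((`) (act g) ` sep u v Q) = card (sep u v Q)" for u v
    by (rule card_image[OF inj_on_subset[OF inj_act[OF g Q]]]) (simp add: sep_def)
  then show ?thesis unfolding flow_def sep_act[OF g Q x] sep_act[OF g Q x(2,1)] by simp
qed

definition eps :: "'v set set \<Rightarrow> 'g \<Rightarrow> int" where
  "eps Q g = flow Q x0 (act g x0)"

text \<open>Moving the base point adds the flow from the old to the new one and subtracts that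
  between their translates, which is equal as \<open>g\<close> preserves \<open>Q\<close>.\<close>

lemma eps_base:
  assumes "g \<in> carrier G" "Q \<subseteq> W" "(`) (act g) ` Q = Q" "x \<in> V"
  shows "eps Q g = flow Q x (act g x)"
proof -
  have V: "act g x0 \<in> V" "act g x \<in> V" using act_in assms base by auto
  have "flow Q x0 (act g x0) = flow Q x0 x + flow Q x (act g x) + flow Q (act g x) (act g x0)"
    using flow_add[OF assms(2) base assms(4) V(1)] flow_add[OF assms(2,4) V(2,1)] by simp
  also have "flow Q (act g x) (act g x0) = flow Q x x0"
    using flow_act[OF assms(1,2,4) base] assms(3) by simp
  finally show ?thesis using flow_sym[of Q x x0] by (simp add: eps_def)
qed

lemma eps_mult:
  assumes "g \<in> carrier G" "h \<in> carrier G" "Q \<subseteq> W" "(`) (act g) ` Q = Q"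
  shows "eps Q (g \<otimes> h) = eps Q g + eps Q h"
proof -
  have V: "act g x0 \<in> V" "act h x0 \<in> V" "act g (act h x0) \<in> V" using act_in assms base by auto
  have "flow Q x0 (act g (act h x0)) = flow Q x0 (act g x0) + flow Q (act g x0) (act g (act h x0))"
    using flow_add[OF assms(3) base V(1,3)] .
  also have "flow Q (act g x0) (act g (act h x0)) = flow Q x0 (act h x0)"
    using flow_act[OF assms(1,3) base V(2)] assms(4) by simp
  finally show ?thesis using act_mult[OF assms(1,2) base] by (simp add: eps_def)
qed

definition stab :: "'v set set \<Rightarrow> 'g set" where
  "stab Q = {g \<in> carrier G. (`) (act g) ` Q = Q}"

lemma image2_act_mult:
  assumes "g \<in> carrier G" "h \<in> carrier G" "Q \<subseteq> W"
  shows "(`) (act (g \<otimes> h)) ` Q = (`) (act g) ` ((`) (act h) ` Q)"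
  unfolding image_image[of "(`) (act g)"]
proof (rule image_cong)
  fix D assume "D \<in> Q"
  then have "D \<subseteq> V" using wall_sub assms(3) by blast
  then show "act (g \<otimes> h) ` D = act g ` (act h ` D)" by (rule image_act_mult[OF assms(1,2)])
qed simp

lemma image2_act_one: "Q \<subseteq> W \<Longrightarrow> (`) (act \<one>) ` Q = Q"
  using image_act_one wall_sub by (metis (no_types, lifting) image_cong image_ident subsetD)

lemma stab_subgroup:
  assumes "Q \<subseteq> W"
  shows "subgroup (stab Q) G"
proof (rule subgroupI)
  show "stab Q \<subseteq> carrier G" by (auto simp: stab_def)
  show "stab Q \<noteq> {}" using image2_act_one[OF assms] by (auto simp: stab_def)
next
  fix g assume "g \<in> stab Q"
  then have g: "g \<in> carrier G" "(`) (act g) ` Q = Q" by (auto simp: stab_def)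
  have "(`) (act (inv g)) ` ((`) (act g) ` Q) = Q"
    using image2_act_mult[of "inv g" g Q] g(1) assms image2_act_one by simp
  then show "inv g \<in> stab Q" using g by (simp add: stab_def)
next
  fix g h assume "g \<in> stab Q" "h \<in> stab Q"
  then show "g \<otimes> h \<in> stab Q" using image2_act_mult[of g h Q] assms by (simp add: stab_def)
qed

section \<open>The orbit of a cyclic group relative to a half-space\<close>

abbreviation pt :: "'g \<Rightarrow> int \<Rightarrow> 'v" where
  "pt a n \<equiv> act (a [^] n) x0"

definition shift :: "'g \<Rightarrow> int \<Rightarrow> 'v set \<Rightarrow> 'v set" where
  "shift a n D = act (a [^] n) ` D"

lemma pt_in: "a \<in> carrier G \<Longrightarrow> pt a n \<in> V"
  using act_in base by simp

lemma shift_wall: "a \<in> carrier G \<Longrightarrow> D \<in> W \<Longrightarrow> shift a n D \<in> W"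
  using act_wall by (simp add: shift_def)

lemma shift_shift: "a \<in> carrier G \<Longrightarrow> D \<in> W \<Longrightarrow> shift a m (shift a n D) = shift a (m + n) D"
  unfolding shift_def using image_act_mult[of "a [^] m" "a [^] n" D] wall_sub by (simp add: int_pow_mult)

lemma shift_0: "D \<in> W \<Longrightarrow> shift a 0 D = D"
  unfolding shift_def using image_act_one wall_sub by simp

lemma act_pt_in_shift:
  assumes "a \<in> carrier G" "D \<in> W" "y \<in> V"
  shows "act (a [^] (m::int)) y \<in> shift a n D \<longleftrightarrow> act (a [^] (m - n)) y \<in> D"
proof -
  have "act (a [^] m) y \<in> shift a n D \<longleftrightarrow> act (inv (a [^] n)) (act (a [^] m) y) \<in> D"
    unfolding shift_def using mem_act[of "a [^] n" D "act (a [^] m) y"] assms wall_sub act_in by simp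
  also have "act (inv (a [^] n)) (act (a [^] m) y) = act (inv (a [^] n) \<otimes> a [^] m) y"
    using act_mult assms by simp
  also have "inv (a [^] n) \<otimes> a [^] m = a [^] (m - n)"
    using assms(1) int_pow_mult[of a "-n" m] by (simp add: int_pow_neg)
  finally show ?thesis .
qed

lemmas pt_in_shift = act_pt_in_shift[OF _ _ base]

text \<open>Takes the place of skewering by an axis, but is expressed by the orbit of the base
  vertex alone: it is outside \<open>D\<close> at all early times and inside at all late
  times.\<close>

definition up :: "'g \<Rightarrow> 'v set \<Rightarrow> bool" where
  "up a D \<longleftrightarrow> (\<exists>K. \<forall>k\<ge>K. pt a k \<in> D \<and> pt a (- k) \<notin> D)"

definition crossers :: "'g \<Rightarrow> 'v set set" where
  "crossers a = {D \<in> W. (x0 \<in> D) \<noteq> (pt a 1 \<in> D)}"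

lemma finite_crossers: "a \<in> carrier G \<Longrightarrow> finite (crossers a)"
proof -
  assume a: "a \<in> carrier G"
  have "crossers a \<subseteq> sep x0 (pt a 1) W \<union> sep (pt a 1) x0 W" by (auto simp: crossers_def sep_def)
  then show ?thesis
    using finite_sep'[OF order.refl base pt_in[OF a, of 1]] finite_sep'[OF order.refl pt_in[OF a, of 1] base]
    by (meson finite_UnI finite_subset)
qed

text \<open>Moves a crossing at time \<open>j\<close> to time 0, so every half-space crossed by the
  orbit is a translate of one of the finitely many \<open>crossers\<close>.\<close>

lemma shift_crosser:
  assumes "a \<in> carrier G" "D \<in> W" "(pt a j \<in> D) \<noteq> (pt a (j + 1) \<in> D)"
  shows "shift a (- j) D \<in> crossers a"
  using pt_in_shift[OF assms(1,2), of 0 "-j"] pt_in_shift[OF assms(1,2), of 1 "-j"] assms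
    shift_wall[OF assms(1,2)] act_one[OF base] by (simp add: crossers_def add.commute)

lemma change_between:
  fixes f :: "int \<Rightarrow> bool"
  assumes "m \<le> n" "f m" "\<not> f n"
  obtains j where "m \<le> j" "j < n" "f j" "\<not> f (j + 1)"
proof -
  have "\<exists>j. m \<le> j \<and> j < n \<and> f j \<and> \<not> f (j + 1)" using assms
  proof (induction n rule: int_ge_induct)
    case (step i)
    then show ?case by (cases "f i") (auto intro: exI[of _ i] less_trans)
  qed simp
  then show thesis using that by blast
qed

lemma change_between':
  fixes f :: "int \<Rightarrow> bool"
  assumes "f m \<noteq> f n"
  obtains j where "f j \<noteq> f (j + 1)"
proof (cases "m \<le> n")
  case True
  show thesis
  proof (cases "f m")
    case True then show thesis using change_between[OF \<open>m \<le> n\<close>, of f] assms that by metis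
  next
    case False then show thesis using change_between[OF \<open>m \<le> n\<close>, of "\<lambda>i. \<not> f i"] assms that by metis
  qed
next
  case False
  then have le: "n \<le> m" by simp
  show thesis
  proof (cases "f n")
    case True then show thesis using change_between[OF le, of f] assms that by metis
  next
    case False then show thesis using change_between[OF le, of "\<lambda>i. \<not> f i"] assms that by metis
  qed
qed

lemma inj_on_neg: "inj (f :: int \<Rightarrow> 'c) \<Longrightarrow> inj_on (\<lambda>j. f (- j)) S"
  by (rule inj_onI) (metis injD neg_equal_iff_equal)

text \<open>If two translates of \<open>D\<close> coincide, the set of times spent in
  \<open>D\<close> is periodic, contrary to the different behaviour at both ends.\<close>

lemma up_nonperiodic:
  assumes a: "a \<in> carrier G" and D: "D \<in> W" and up: "up a D"
  shows "inj (\<lambda>k. shift a k D)"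
proof (rule ccontr)
  assume "\<not> inj (\<lambda>k. shift a k D)"
  then obtain k l where kl: "k < l" "shift a k D = shift a l D"
    unfolding inj_def by (metis linorder_neqE_linordered_idom)
  define p where "p = l - k"
  have p: "p > 0" using kl by (simp add: p_def)
  have "shift a p D = D"
    using shift_shift[OF a D, of "-k" l] shift_shift[OF a D, of "-k" k] kl shift_0[OF D] by (simp add: p_def)
  then have per: "pt a (m - p) \<in> D \<longleftrightarrow> pt a m \<in> D" for m using pt_in_shift[OF a D, of m p] by simp
  have per': "pt a (m - int n * p) \<in> D \<longleftrightarrow> pt a m \<in> D" for m n
  proof (induction n)
    case (Suc n)
    then show ?case using per[of "m - int n * p"] by (simp add: algebra_simps)
  qed simp
  obtain K where K: "\<And>k. k \<ge> K \<Longrightarrow> pt a k \<in> D \<and> pt a (- k) \<notin> D" using up by (auto simp: up_def)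
  let ?K = "max K 1"
  have "pt a ?K \<in> D" using K by simp
  \<comment> \<open>A time congruent to \<open>?K\<close> modulo the period \<open>p\<close> that is
    so early that the orbit is still outside \<open>D\<close>.\<close>
  moreover define e where "e = ?K - int (nat (2 * ?K)) * p"
  have "e \<le> - ?K"
  proof -
    have "2 * ?K * 1 \<le> 2 * ?K * p" using p by (intro mult_left_mono) auto
    then show ?thesis by (simp add: e_def)
  qed
  then have "K \<le> - e" by simp
  from K[OF this] have "pt a e \<notin> D" by simp
  ultimately show False using per'[of ?K "nat (2 * ?K)"] unfolding e_def by blast
qed

lemma eventually_outside_finite:
  assumes "finite (S :: int set)"
  obtains K where "K > 0" "\<And>k. k \<ge> K \<Longrightarrow> k \<notin> S \<and> - k \<notin> S"
proof -
  obtain M where M: "\<forall>x\<in>S. \<bar>x\<bar> \<le> M"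
    using finite_imageI[OF assms, of abs] Max_ge by (metis imageI)
  show thesis by (rule that[of "\<bar>M\<bar> + 1"]) (use M in force)+
qed

text \<open>Replacing \<open>D\<close> by its translate amounts to following the orbit of
  \<open>y = act (inv b) x0\<close> instead of that of \<open>x0\<close>. At a time when
  \<open>D\<close> distinguishes the two orbits, a translate of \<open>D\<close> separates
  \<open>x0\<close> from \<open>y\<close>; there are finitely many such translates and, by
  \<open>up_nonperiodic\<close>, finitely many such times.\<close>

lemma up_translate:
  assumes a: "a \<in> carrier G" and b: "b \<in> carrier G" and ab: "a \<otimes> b = b \<otimes> a" and D: "D \<in> W" and up: "up a D"
  shows "up a (act b ` D)"
proof -
  define y where "y = act (inv b) x0"
  have y: "y \<in> V" using act_in b base by (simp add: y_def)
  have ib: "a [^] (k::int) \<otimes> inv b = inv b \<otimes> a [^] k" for k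
  proof -
    have "inv b \<otimes> a = inv b \<otimes> (a \<otimes> b) \<otimes> inv b" using a b by (simp add: m_assoc)
    also have "\<dots> = a \<otimes> inv b" unfolding ab using a b by (simp add: m_assoc[symmetric])
    finally show ?thesis using commute_int_pow[of a "inv b" k] a b by simp
  qed
  have mem: "pt a k \<in> act b ` D \<longleftrightarrow> act (a [^] k) y \<in> D" for k
    using mem_act[OF b wall_sub[OF D] pt_in[OF a], of k] act_mult[of "inv b" "a [^] k" x0]
      act_mult[of "a [^] k" "inv b" x0] a b base ib[of k] by (simp add: y_def)
  let ?S = "{k. (act (a [^] k) y \<in> D) \<noteq> (pt a k \<in> D)}"
  have "(\<lambda>k. shift a (- k) D) ` ?S \<subseteq> sep x0 y W \<union> sep y x0 W"
  proof
    fix D' assume "D' \<in> (\<lambda>k. shift a (- k) D) ` ?S"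
    then obtain k where k: "D' = shift a (- k) D" "(act (a [^] k) y \<in> D) \<noteq> (pt a k \<in> D)" by blast
    have "y \<in> D' \<longleftrightarrow> act (a [^] k) y \<in> D" "x0 \<in> D' \<longleftrightarrow> pt a k \<in> D"
      using act_pt_in_shift[OF a D y, of 0 "-k"] pt_in_shift[OF a D, of 0 "-k"] k(1) act_one[OF y] act_one[OF base]
      by simp_all
    then show "D' \<in> sep x0 y W \<union> sep y x0 W" using k shift_wall[OF a D] by (auto simp: sep_def)
  qed
  then have "finite ((\<lambda>k. shift a (- k) D) ` ?S)"
    using finite_sep'[OF order.refl base y] finite_sep'[OF order.refl y base] by (meson finite_UnI finite_subset)
  moreover have "inj_on (\<lambda>k. shift a (- k) D) ?S"
    by (rule inj_on_neg[OF up_nonperiodic[OF a D up]])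
  ultimately have "finite ?S" by (rule finite_imageD)
  then obtain K where K: "\<And>k. k \<ge> K \<Longrightarrow> k \<notin> ?S \<and> - k \<notin> ?S" using eventually_outside_finite by blast
  obtain K' where K': "\<And>k. k \<ge> K' \<Longrightarrow> pt a k \<in> D \<and> pt a (- k) \<notin> D" using up by (auto simp: up_def)
  show ?thesis unfolding up_def
  proof (intro exI[of _ "max K K'"] allI impI)
    fix k assume "k \<ge> max K K'"
    then show "pt a k \<in> act b ` D \<and> pt a (- k) \<notin> act b ` D"
      using K[of k] K'[of k] mem by auto
  qed
qed

lemma eps_pow:
  assumes "a \<in> stab Q" "Q \<subseteq> W"
  shows "eps Q (a [^] (i::int)) = i * eps Q a"
  by (rule int_hom_pow[OF stab_subgroup[OF assms(2)] _ assms(1)])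
    (use eps_mult assms(2) in \<open>auto simp: stab_def\<close>)

text \<open>In a long window from \<open>-n\<close> to \<open>n\<close> no half-space of
  \<open>Q\<close> is left on balance, while \<open>D0\<close> is entered; so the flow through the
  window is positive, and it equals \<open>2 * n * eps Q a\<close>.\<close>

lemma up_flow_pos:
  assumes a: "a \<in> stab Q" and Q: "Q \<subseteq> W" "Q \<noteq> {}" and up: "\<And>D. D \<in> Q \<Longrightarrow> up a D"
  shows "eps Q a > 0"
proof -
  have aG: "a \<in> carrier G" using a by (simp add: stab_def)
  have shiftQ: "shift a n D \<in> Q" if "D \<in> Q" for n D
  proof -
    have "a [^] n \<in> stab Q" using subgroup_int_pow_closed[OF stab_subgroup[OF Q(1)] a] .
    then show ?thesis using that unfolding stab_def shift_def by blast
  qed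
  have "\<exists>K. \<forall>D\<in>crossers a \<inter> Q. \<forall>k\<ge>K. pt a k \<in> D \<and> pt a (- k) \<notin> D"
  proof -
    obtain f where f: "\<And>D. D \<in> Q \<Longrightarrow> \<forall>k\<ge>f D. pt a k \<in> D \<and> pt a (- k) \<notin> D"
      using up unfolding up_def by metis
    let ?M = "Max (f ` (crossers a \<inter> Q))"
    have fin: "finite (f ` (crossers a \<inter> Q))" using finite_crossers[OF aG] by blast
    have "f D \<le> ?M" if "D \<in> crossers a \<inter> Q" for D using Max_ge[OF fin] that by blast
    then have "\<forall>D\<in>crossers a \<inter> Q. \<forall>k\<ge>?M. pt a k \<in> D \<and> pt a (- k) \<notin> D"
      using f by (meson IntD2 order_trans)
    then show ?thesis by blast
  qed
  then obtain K where K: "\<And>D k. D \<in> crossers a \<Longrightarrow> D \<in> Q \<Longrightarrow> k \<ge> K \<Longrightarrow> pt a k \<in> D \<and> pt a (- k) \<notin> D" by blast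
  obtain D0 where D0: "D0 \<in> Q" using Q by blast
  obtain K0 where K0: "\<And>k. k \<ge> K0 \<Longrightarrow> pt a k \<in> D0 \<and> pt a (- k) \<notin> D0" using up[OF D0] unfolding up_def by blast
  define n where "n = max 1 (max K K0)"
  have n: "n \<ge> K" "n \<ge> K0" "n \<ge> 1" by (auto simp: n_def)
  have "sep (pt a n) (pt a (- n)) Q = {}"
  proof (rule ccontr)
    assume "sep (pt a n) (pt a (- n)) Q \<noteq> {}"
    then obtain D where D: "D \<in> Q" "pt a (- n) \<in> D" "pt a n \<notin> D" by (auto simp: sep_def)
    have DW: "D \<in> W" using D Q by blast
    have "-n \<le> n" using n by simp
    then obtain j where j: "-n \<le> j" "j < n" "pt a j \<in> D" "pt a (j + 1) \<notin> D"
      using change_between[of "-n" n "\<lambda>k. pt a k \<in> D"] D by blast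
    let ?D = "shift a (- j) D"
    have cr: "?D \<in> crossers a" "?D \<in> Q" using shift_crosser[OF aG DW] j shiftQ[OF D(1)] by blast+
    have "pt a (- (n + j)) \<in> ?D" "pt a (n - j) \<notin> ?D"
      using pt_in_shift[OF aG DW, of "- (n + j)" "-j"] pt_in_shift[OF aG DW, of "n - j" "-j"] D by simp_all
    \<comment> \<open>A half-space left on balance is left at some time \<open>j\<close>, and its
      translate by \<open>-j\<close> is a crosser, whose position is settled beyond time
      \<open>K\<close>. But \<open>n + j\<close> and \<open>n - j\<close> cannot both be smaller
      than \<open>K\<close>, as they add up to \<open>2 * n\<close>.\<close>
    then have "\<not> n + j \<ge> K" "\<not> n - j \<ge> K" using K[OF cr, of "n + j"] K[OF cr, of "n - j"] by blast+
    then show False using n by linarith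
  qed
  moreover have "D0 \<in> sep (pt a (- n)) (pt a n) Q" using K0[OF n(2)] D0 by (simp add: sep_def)
  then have "card (sep (pt a (- n)) (pt a n) Q) > 0"
    using finite_sep'[OF Q(1) pt_in[OF aG] pt_in[OF aG]] card_gt_0_iff by blast
  ultimately have "flow Q (pt a (- n)) (pt a n) > 0" by (simp add: flow_def)
  moreover have "flow Q (pt a (- n)) (pt a n) = 2 * n * eps Q a"
    using flow_add[OF Q(1) pt_in[OF aG] base pt_in[OF aG], of "-n" n] flow_sym[of Q "pt a (- n)" x0]
      eps_pow[OF a Q(1), of n] eps_pow[OF a Q(1), of "-n"] by (simp add: eps_def)
  ultimately show ?thesis using n by (simp add: zero_less_mult_iff)
qed

text \<open>
  The times that the orbit of \<open>a\<close> spends in \<open>D\<close> form a periodic, finite or cofinite set here, so only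
  boundedly many translates of \<open>D\<close> can separate two points of the orbit.
\<close>

lemma bounded_translates:
  assumes a: "a \<in> carrier G" and D: "D \<in> W" and nu: "\<not> up a D" "\<not> up (inv a) D"
  shows "\<exists>B. \<forall>N. finite {shift a j D | j. (pt a (- j) \<in> D) \<noteq> (pt a (N - j) \<in> D)} \<and>
    card {shift a j D | j. (pt a (- j) \<in> D) \<noteq> (pt a (N - j) \<in> D)} \<le> B"
proof -
  let ?T = "\<lambda>N. {j. (pt a (- j) \<in> D) \<noteq> (pt a (N - j) \<in> D)}"
  have T: "{shift a j D | j. (pt a (- j) \<in> D) \<noteq> (pt a (N - j) \<in> D)} = (\<lambda>j. shift a j D) ` ?T N" for N
    by blast
  show ?thesis
  proof (cases "inj (\<lambda>k. shift a k D)")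
    case False
    then obtain k l where kl: "k < l" "shift a k D = shift a l D"
      unfolding inj_def by (metis linorder_neqE_linordered_idom)
    define p where "p = l - k"
    have p: "p > 0" using kl by (simp add: p_def)
    have "shift a p D = D"
      using shift_shift[OF a D, of "-k" l] shift_shift[OF a D, of "-k" k] kl shift_0[OF D] by (simp add: p_def)
    then have per: "shift a (m + p) D = shift a m D" for m using shift_shift[OF a D, of m p] by simp
    have pern: "shift a (m + int n * p) D = shift a m D" for m n
    proof (induction n)
      case (Suc n)
      then show ?case using per[of "m + int n * p"] by (simp add: algebra_simps)
    qed simp
    have "shift a j D \<in> (\<lambda>j. shift a j D) ` {0..<p}" for j
    proof -
      have "shift a j D = shift a (j mod p) D"
      proof (cases "j div p \<ge> 0")
        case True
        then have "j = j mod p + int (nat (j div p)) * p" by simp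
        then show ?thesis using pern[of "j mod p" "nat (j div p)"] by simp
      next
        case False
        then have "j mod p = j + int (nat (- (j div p))) * p" by (simp add: minus_div_mult_eq_mod[symmetric])
        then show ?thesis using pern[of j "nat (- (j div p))"] by simp
      qed
      then show ?thesis using p by auto
    qed
    then have sub: "(\<lambda>j. shift a j D) ` ?T N \<subseteq> (\<lambda>j. shift a j D) ` {0..<p}" for N by blast
    show ?thesis unfolding T
    proof (intro exI[of _ "card ((\<lambda>j. shift a j D) ` {0..<p})"] allI conjI)
      fix N
      show "finite ((\<lambda>j. shift a j D) ` ?T N)" by (rule finite_subset[OF sub]) simp
      show "card ((\<lambda>j. shift a j D) ` ?T N) \<le> card ((\<lambda>j. shift a j D) ` {0..<p})"
        by (rule card_mono[OF _ sub]) simp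
    qed
  next
    case True
    let ?C = "{j. (pt a j \<in> D) \<noteq> (pt a (j + 1) \<in> D)}"
    have "(\<lambda>j. shift a (- j) D) ` ?C \<subseteq> crossers a" using shift_crosser[OF a D] by blast
    then have "finite ((\<lambda>j. shift a (- j) D) ` ?C)" using finite_crossers[OF a] finite_subset by blast
    moreover have "inj_on (\<lambda>j. shift a (- j) D) ?C" by (rule inj_on_neg[OF True])
    ultimately have "finite ?C" by (rule finite_imageD)
    then obtain K where K: "K > 0" "\<And>k. k \<ge> K \<Longrightarrow> k \<notin> ?C \<and> - k \<notin> ?C"
      using eventually_outside_finite by blast
    have right: "pt a k \<in> D \<longleftrightarrow> pt a K \<in> D" if "k \<ge> K" for k
      using that
    proof (induction k rule: int_ge_induct)
      case (step i)
      then show ?case using K(2)[of i] by blast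
    qed simp
    have left: "pt a (- k) \<in> D \<longleftrightarrow> pt a (- K) \<in> D" if "k \<ge> K" for k
      using that
    proof (induction k rule: int_ge_induct)
      case (step i)
      have "- (i + 1) + 1 = - i" by simp
      then show ?case using step K(2)[of "i + 1"] by simp
    qed simp
    have inva: "pt (inv a) k = pt a (- k)" for k using a by (simp add: int_pow_inv int_pow_neg)
    \<comment> \<open>With different behaviour at the two ends, \<open>D\<close> would be
      \<open>up\<close> for \<open>a\<close> or for \<open>inv a\<close>.\<close>
    have "(pt a K \<in> D) = (pt a (- K) \<in> D)"
    proof (rule ccontr)
      assume ne: "(pt a K \<in> D) \<noteq> (pt a (- K) \<in> D)"
      show False
      proof (cases "pt a K \<in> D")
        case True
        have "pt a k \<in> D \<and> pt a (- k) \<notin> D" if "k \<ge> K" for k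
          unfolding right[OF that] left[OF that] using True ne by blast
        then have "up a D" unfolding up_def by blast
        then show False using nu by blast
      next
        case False
        have "pt (inv a) k \<in> D \<and> pt (inv a) (- k) \<notin> D" if "k \<ge> K" for k
          unfolding inva minus_minus right[OF that] left[OF that] using False ne by blast
        then have "up (inv a) D" unfolding up_def by blast
        then show False using nu by blast
      qed
    qed
    then have far: "pt a k \<in> D \<longleftrightarrow> pt a K \<in> D" if "\<bar>k\<bar> \<ge> K" for k
    proof (cases "k \<ge> 0")
      case True
      then show ?thesis using right[of k] that by simp
    next
      case False
      then have "K \<le> - k" using that by simp
      from left[OF this] show ?thesis using \<open>(pt a K \<in> D) = (pt a (- K) \<in> D)\<close> by simp
    qed
    \<comment> \<open>Two late or early times give the same answer, so one of the two must lie
      within \<open>K\<close> of 0. These two windows have fewer than \<open>4 * K\<close> elements,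
      whatever \<open>N\<close> is.\<close>
    have "?T N \<subseteq> {- K<..<K} \<union> {N - K<..<N + K}" for N
    proof
      fix j assume "j \<in> ?T N"
      then have "\<bar>- j\<bar> < K \<or> \<bar>N - j\<bar> < K" using far[of "-j"] far[of "N - j"] by force
      then show "j \<in> {- K<..<K} \<union> {N - K<..<N + K}" by auto
    qed
    then have sub: "(\<lambda>j. shift a j D) ` ?T N \<subseteq> (\<lambda>j. shift a j D) ` ({- K<..<K} \<union> {N - K<..<N + K})" for N
      by blast
    have le: "card ((\<lambda>j. shift a j D) ` ({- K<..<K} \<union> {N - K<..<N + K})) \<le> nat (4 * K)" for N
    proof -
      have "card ({- K<..<K} \<union> {N - K<..<N + K}) \<le> nat (4 * K)"
        using card_Un_le[of "{- K<..<K}" "{N - K<..<N + K}"] K(1) by simp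
      then show ?thesis using card_image_le[of "{- K<..<K} \<union> {N - K<..<N + K}" "\<lambda>j. shift a j D"] by simp
    qed
    have fin: "finite ((\<lambda>j. shift a j D) ` ({- K<..<K} \<union> {N - K<..<N + K}))" for N by simp
    show ?thesis unfolding T
    proof (intro exI[of _ "nat (4 * K)"] allI conjI)
      fix N
      show "finite ((\<lambda>j. shift a j D) ` ?T N)" by (rule finite_subset[OF sub fin])
      show "card ((\<lambda>j. shift a j D) ` ?T N) \<le> nat (4 * K)"
        by (rule order_trans[OF card_mono[OF fin sub] le])
    qed
  qed
qed

text \<open>The half-spaces that separate \<open>x0\<close> from a point of its orbit are translates
  of the finitely many \<open>crossers\<close>, and without an \<open>up\<close> half-space each of
  these supplies a bounded number of translates.\<close>

lemma bounded_or_up: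
  assumes a: "a \<in> carrier G" and unb: "\<And>B. \<exists>n::int. card (sep x0 (pt a n) W) > B"
  shows "\<exists>D\<in>W. up a D \<or> up (inv a) D"
proof (rule ccontr)
  assume n: "\<not> ?thesis"
  let ?T = "\<lambda>D N. {shift a j D | j. (pt a (- j) \<in> D) \<noteq> (pt a (N - j) \<in> D)}"
  have "\<forall>D\<in>crossers a. \<exists>B. \<forall>N. finite (?T D N) \<and> card (?T D N) \<le> B"
  proof
    fix D assume "D \<in> crossers a"
    then have D: "D \<in> W" by (simp add: crossers_def)
    show "\<exists>B. \<forall>N. finite (?T D N) \<and> card (?T D N) \<le> B"
      by (rule bounded_translates[OF a D]) (use n D in blast)+
  qed
  from bchoice[OF this] obtain B
    where B: "\<forall>D\<in>crossers a. \<forall>N. finite (?T D N) \<and> card (?T D N) \<le> B D" ..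
  have Tfin: "finite (?T D N)" and Tcard: "card (?T D N) \<le> B D" if "D \<in> crossers a" for D N
    using spec[OF bspec[OF B that], of N] by (rule conjunct1, rule conjunct2)
  have sub: "sep x0 (pt a N) W \<subseteq> (\<Union>D\<in>crossers a. ?T D N)" for N
  proof
    fix D assume "D \<in> sep x0 (pt a N) W"
    then have D: "D \<in> W" "(pt a 0 \<in> D) \<noteq> (pt a N \<in> D)" using act_one[OF base] by (auto simp: sep_def)
    obtain j where j: "(pt a j \<in> D) \<noteq> (pt a (j + 1) \<in> D)"
      using change_between'[of "\<lambda>k. pt a k \<in> D" 0 N] D(2) by blast
    let ?D = "shift a (- j) D"
    have "?D \<in> crossers a" using shift_crosser[OF a D(1) j] .
    moreover have "D = shift a j ?D" using shift_shift[OF a D(1), of j "-j"] shift_0[OF D(1)] by simp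
    moreover have "(pt a (- j) \<in> ?D) \<noteq> (pt a (N - j) \<in> ?D)"
      using pt_in_shift[OF a D(1), of "-j" "-j"] pt_in_shift[OF a D(1), of "N - j" "-j"] D(2) by simp
    ultimately show "D \<in> (\<Union>D\<in>crossers a. ?T D N)" by blast
  qed
  have "card (sep x0 (pt a N) W) \<le> (\<Sum>D\<in>crossers a. B D)" for N
  proof -
    have fin: "finite (crossers a)" using finite_crossers[OF a] .
    have "finite (\<Union>D\<in>crossers a. ?T D N)" by (rule finite_UN_I[OF fin Tfin])
    then have "card (sep x0 (pt a N) W) \<le> card (\<Union>D\<in>crossers a. ?T D N)" by (rule card_mono[OF _ sub])
    also have "\<dots> \<le> (\<Sum>D\<in>crossers a. card (?T D N))" by (rule card_UN_le[OF fin])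
    also have "\<dots> \<le> (\<Sum>D\<in>crossers a. B D)" by (rule sum_mono[OF Tcard])
    finally show ?thesis .
  qed
  then show False using unb[of "\<Sum>D\<in>crossers a. B D"] by (meson not_le)
qed

end

section \<open>Orbits of half-spaces under a normal abelian subgroup\<close>

context wall_action
begin

context
  fixes A :: "'g set" and S :: "'g set"
  assumes normal: "A \<lhd> G"
    and abelian: "a \<in> A \<Longrightarrow> b \<in> A \<Longrightarrow> a \<otimes> b = b \<otimes> a"
    and generators: "finite S" "generate G S = A"
    and unbounded: "a \<in> A \<Longrightarrow> a \<noteq> \<one> \<Longrightarrow> \<exists>n::int. card (sep x0 (pt a n) W) > B"
begin

lemma subgroup_A: "subgroup A G"
  using normal normal_imp_subgroup by blast

lemma A_carrier: "a \<in> A \<Longrightarrow> a \<in> carrier G"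
  using subgroup.mem_carrier[OF subgroup_A] .

lemma generators_sub: "S \<subseteq> A"
proof
  fix s assume "s \<in> S"
  from generate.incl[OF this, of G] show "s \<in> A" unfolding generators(2) .
qed

lemma conj_A: "g \<in> carrier G \<Longrightarrow> a \<in> A \<Longrightarrow> g \<otimes> a \<otimes> inv g \<in> A"
  using normal.inv_op_closed2[OF normal] .

definition orb :: "'v set \<Rightarrow> 'v set set" where
  "orb D = (\<lambda>b. act b ` D) ` A"

lemma orb_sub: "D \<in> W \<Longrightarrow> orb D \<subseteq> W"
  using act_wall A_carrier by (auto simp: orb_def)

lemma self_orb: "D \<in> W \<Longrightarrow> D \<in> orb D"
proof -
  assume "D \<in> W"
  from image_act_one[OF wall_sub[OF this]] have "D = act \<one> ` D" by simp
  then show ?thesis unfolding orb_def by (rule image_eqI) (rule subgroup.one_closed[OF subgroup_A])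
qed

lemma orb_act:
  assumes b: "b \<in> A" and D: "D \<in> W"
  shows "orb (act b ` D) = orb D"
proof (intro subset_antisym subsetI)
  fix D' assume "D' \<in> orb (act b ` D)"
  then obtain c where c: "c \<in> A" "D' = act c ` (act b ` D)" by (auto simp: orb_def)
  then have "D' = act (c \<otimes> b) ` D" using image_act_mult[OF A_carrier A_carrier wall_sub] b D by simp
  then show "D' \<in> orb D" unfolding orb_def using subgroup.m_closed[OF subgroup_A c(1) b] by blast
next
  fix D' assume "D' \<in> orb D"
  then obtain c where c: "c \<in> A" "D' = act c ` D" by (auto simp: orb_def)
  have ci: "c \<otimes> inv b \<in> A" using subgroup.m_closed[OF subgroup_A c(1) subgroup.m_inv_closed[OF subgroup_A b]] .
  have "act (c \<otimes> inv b) ` (act b ` D) = act (c \<otimes> inv b \<otimes> b) ` D"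
    using image_act_mult[OF A_carrier[OF ci] A_carrier[OF b] wall_sub[OF D]] by simp
  also have "c \<otimes> inv b \<otimes> b = c" using A_carrier[OF b] A_carrier[OF c(1)] by (simp add: m_assoc)
  finally have "D' = act (c \<otimes> inv b) ` (act b ` D)" using c(2) by simp
  then show "D' \<in> orb (act b ` D)" unfolding orb_def using ci by blast
qed

text \<open>Normality of \<open>A\<close>: conjugation by \<open>g\<close> permutes the elements of
  \<open>A\<close>, so \<open>G\<close> permutes the orbits of \<open>A\<close>.\<close>

lemma orb_translate:
  assumes g: "g \<in> carrier G" and D: "D \<in> W"
  shows "(`) (act g) ` orb D = orb (act g ` D)"
proof -
  have *: "act g ` (act b ` D) = act (g \<otimes> b \<otimes> inv g) ` (act g ` D)" if b: "b \<in> A" for b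
  proof -
    have "act (g \<otimes> b \<otimes> inv g) ` (act g ` D) = act (g \<otimes> b \<otimes> inv g \<otimes> g) ` D"
      using image_act_mult[OF A_carrier[OF conj_A[OF g b]] g wall_sub[OF D]] by simp
    also have "g \<otimes> b \<otimes> inv g \<otimes> g = g \<otimes> b" using g A_carrier[OF b] by (simp add: m_assoc)
    finally show ?thesis using image_act_mult[OF g A_carrier[OF b] wall_sub[OF D]] by simp
  qed
  show ?thesis
  proof (intro subset_antisym subsetI)
    fix D' assume "D' \<in> (`) (act g) ` orb D"
    then obtain b where "b \<in> A" "D' = act g ` (act b ` D)" by (auto simp: orb_def)
    then show "D' \<in> orb (act g ` D)" using * conj_A[OF g] unfolding orb_def by blast
  next
    fix D' assume "D' \<in> orb (act g ` D)"
    then obtain c where c: "c \<in> A" "D' = act c ` (act g ` D)" by (auto simp: orb_def)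
    let ?b = "inv g \<otimes> c \<otimes> g"
    have b: "?b \<in> A" using normal.inv_op_closed1[OF normal g c(1)] .
    have "g \<otimes> ?b \<otimes> inv g = c" using g A_carrier[OF c(1)] by (simp add: m_assoc[symmetric]) (simp add: m_assoc)
    then have "D' = act g ` (act ?b ` D)" using *[OF b] c(2) by simp
    then show "D' \<in> (`) (act g) ` orb D" using b unfolding orb_def by blast
  qed
qed

lemma A_stab: "D \<in> W \<Longrightarrow> b \<in> A \<Longrightarrow> b \<in> stab (orb D)"
  using orb_translate[OF A_carrier] orb_act A_carrier by (simp add: stab_def)

lemma eps_hom:
  assumes "Q \<subseteq> W" "g \<in> stab Q" "h \<in> stab Q"
  shows "eps Q (g \<otimes> h) = eps Q g + eps Q h"
  using eps_mult[of g h Q] assms by (simp add: stab_def)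

text \<open>Commutativity of \<open>A\<close> spreads \<open>up\<close> from one half-space to its
  whole orbit, where the flow is then positive. If \<open>inv a\<close> is the one that goes up, the
  sign of \<open>eps\<close> changes.\<close>

lemma detecting_orbit:
  assumes a: "a \<in> A" "a \<noteq> \<one>"
  shows "\<exists>D\<in>W. eps (orb D) a \<noteq> 0"
proof -
  have pos: "eps (orb D) b > 0" if b: "b \<in> A" and D: "D \<in> W" and up: "up b D" for b D
  proof (rule up_flow_pos[OF A_stab[OF D b] orb_sub[OF D]])
    show "orb D \<noteq> {}" using self_orb[OF D] by blast
    fix D' assume "D' \<in> orb D"
    then obtain c where "c \<in> A" "D' = act c ` D" by (auto simp: orb_def)
    then show "up b D'" using up_translate[OF A_carrier[OF b] A_carrier _ D up] abelian[OF b] by blast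
  qed
  obtain D where D: "D \<in> W" "up a D \<or> up (inv a) D"
    using bounded_or_up[OF A_carrier[OF a(1)] unbounded[OF a]] by blast
  have ia: "inv a \<in> A" using subgroup.m_inv_closed[OF subgroup_A a(1)] .
  have "eps (orb D) (inv a) = - eps (orb D) a"
    by (rule int_hom_inv[OF stab_subgroup[OF orb_sub[OF D(1)]] eps_hom[OF orb_sub[OF D(1)]] A_stab[OF D(1) a(1)]])
  then show ?thesis using D pos[OF a(1) D(1)] pos[OF ia D(1)] by (intro bexI[OF _ D(1)]) auto
qed

definition detecting_orbits :: "'v set set set" where
  "detecting_orbits = {orb D | D. D \<in> W \<and> (\<exists>b\<in>A. eps (orb D) b \<noteq> 0)}"

text \<open>If \<open>eps Q\<close> is nonzero on \<open>A\<close>, it is nonzero on a generator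
  \<open>s\<close>; then \<open>Q\<close> contains one of the finitely many half-spaces between
  \<open>x0\<close> and its image under \<open>s\<close>, and an orbit is determined by any of its
  elements.\<close>

lemma finite_detecting: "finite detecting_orbits"
proof -
  let ?C = "\<Union>s\<in>S. sep x0 (act s x0) W \<union> sep (act s x0) x0 W"
  note SA = generators_sub
  have "detecting_orbits \<subseteq> orb ` ?C"
  proof
    fix Q assume "Q \<in> detecting_orbits"
    then obtain D b where D: "D \<in> W" "Q = orb D" and b: "b \<in> A" "eps Q b \<noteq> 0"
      unfolding detecting_orbits_def by blast
    have QW: "Q \<subseteq> W" using D orb_sub by simp
    have st: "c \<in> stab Q" if "c \<in> A" for c using A_stab D that by simp
    have "\<exists>s\<in>S. eps Q s \<noteq> 0"
    proof (rule ccontr)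
      assume n: "\<not> ?thesis"
      have "eps Q c = 0" if "c \<in> generate G S" for c
        using that
      proof (induction rule: generate.induct)
        case one
        show ?case using act_one[OF base] by (simp add: eps_def)
      next
        case (incl h)
        then show ?case using n by blast
      next
        case (inv h)
        have "eps Q (inv h) = - eps Q h"
          by (rule int_hom_inv[OF stab_subgroup[OF QW] eps_hom[OF QW] st]) (use inv SA in auto)
        then show ?case using inv n by simp
      next
        case (eng h1 h2)
        then show ?case using eps_hom[OF QW st st] generators(2) by simp
      qed
      then show False using b generators(2) by blast
    qed
    then obtain s where s: "s \<in> S" "eps Q s \<noteq> 0" by blast
    then have "sep x0 (act s x0) Q \<noteq> {} \<or> sep (act s x0) x0 Q \<noteq> {}" by (auto simp: eps_def flow_def)
    then obtain D' where D': "D' \<in> Q" "D' \<in> sep x0 (act s x0) Q \<union> sep (act s x0) x0 Q"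
      unfolding sep_def by blast
    then obtain c where "c \<in> A" "D' = act c ` D" using D(2) by (auto simp: orb_def)
    then have "orb D' = Q" using orb_act D by simp
    moreover have "D' \<in> ?C" using D' QW s(1) by (auto simp: sep_def)
    ultimately show "Q \<in> orb ` ?C" by blast
  qed
  moreover have "finite ?C"
  proof (intro finite_UN_I generators(1))
    fix s assume "s \<in> S"
    then have "act s x0 \<in> V" using SA A_carrier act_in base by blast
    then show "finite (sep x0 (act s x0) W \<union> sep (act s x0) x0 W)"
      using finite_sep'[OF order.refl] base by simp
  qed
  ultimately show ?thesis using finite_surj by blast
qed

text \<open>If \<open>b\<close> is detected by \<open>Q\<close>, then its conjugate by
  \<open>g\<close> is detected by the translate of \<open>Q\<close>, as one sees from the base point
  \<open>act g x0\<close>.\<close>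

lemma detecting_translate:
  assumes g: "g \<in> carrier G" and Q: "Q \<in> detecting_orbits"
  shows "(`) (act g) ` Q \<in> detecting_orbits"
proof -
  obtain D b where D: "D \<in> W" "Q = orb D" and b: "b \<in> A" "eps Q b \<noteq> 0"
    using Q unfolding detecting_orbits_def by blast
  let ?Q = "orb (act g ` D)" and ?c = "g \<otimes> b \<otimes> inv g"
  have gD: "act g ` D \<in> W" using act_wall[OF g D(1)] .
  have gQ: "(`) (act g) ` Q = ?Q" using orb_translate[OF g D(1)] D(2) by simp
  have c: "?c \<in> A" using conj_A[OF g b(1)] .
  have x0: "act g x0 \<in> V" using act_in[OF g base] .
  have bV: "act b x0 \<in> V" using act_in[OF A_carrier[OF b(1)] base] .
  have "act ?c (act g x0) = act (?c \<otimes> g) x0" using act_mult[OF A_carrier[OF c] g base] by simp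
  also have "?c \<otimes> g = g \<otimes> b" using g A_carrier[OF b(1)] by (simp add: m_assoc)
  finally have cg: "act ?c (act g x0) = act g (act b x0)" using act_mult[OF g A_carrier[OF b(1)] base] by simp
  have "eps ?Q ?c = flow ?Q (act g x0) (act ?c (act g x0))"
    using eps_base[OF A_carrier[OF c] orb_sub[OF gD] _ x0] A_stab[OF gD c] by (simp add: stab_def)
  also have "\<dots> = flow Q x0 (act b x0)"
    using flow_act[OF g _ base bV, of Q] gQ orb_sub[OF D(1)] D(2) cg by simp
  finally have "eps ?Q ?c \<noteq> 0" using b(2) by (simp add: eps_def)
  then show ?thesis unfolding gQ detecting_orbits_def using gD c by blast
qed

definition pointwise_stab :: "'g set" where
  "pointwise_stab = {g \<in> carrier G. \<forall>Q\<in>detecting_orbits. g \<in> stab Q}"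

lemma detecting_sub: "Q \<in> detecting_orbits \<Longrightarrow> Q \<subseteq> W"
  unfolding detecting_orbits_def using orb_sub by blast

lemma subgroup_pointwise_stab: "subgroup pointwise_stab G"
proof (rule subgroupI)
  show "pointwise_stab \<subseteq> carrier G" by (auto simp: pointwise_stab_def)
  show "pointwise_stab \<noteq> {}"
    using subgroup.one_closed[OF stab_subgroup[OF detecting_sub]] by (auto simp: pointwise_stab_def)
  show "inv g \<in> pointwise_stab" if "g \<in> pointwise_stab" for g
    using that subgroup.m_inv_closed[OF stab_subgroup[OF detecting_sub]] by (simp add: pointwise_stab_def)
  show "g \<otimes> h \<in> pointwise_stab" if "g \<in> pointwise_stab" "h \<in> pointwise_stab" for g h
    using that subgroup.m_closed[OF stab_subgroup[OF detecting_sub]] by (simp add: pointwise_stab_def)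
qed

lemma A_pointwise_stab: "A \<subseteq> pointwise_stab"
  unfolding pointwise_stab_def detecting_orbits_def using A_stab A_carrier by blast

text \<open>\<open>key g\<close> records how \<open>g\<close> permutes the finitely many detecting
  orbits, and elements with the same key differ by an element of the pointwise stabiliser.\<close>

lemma finite_index_pointwise_stab:
  "\<exists>F. finite F \<and> F \<subseteq> carrier G \<and> (\<forall>g\<in>carrier G. \<exists>f\<in>F. \<exists>c\<in>pointwise_stab. g = f \<otimes> c)"
proof -
  define key where "key g = (\<lambda>Q\<in>detecting_orbits. (`) (act g) ` Q)" for g
  define rep where "rep k = (SOME g. g \<in> carrier G \<and> key g = k)" for k
  have "key ` carrier G \<subseteq> detecting_orbits \<rightarrow>\<^sub>E detecting_orbits"
    using detecting_translate by (auto simp: key_def)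
  then have fin: "finite (key ` carrier G)"
    using finite_PiE[OF finite_detecting, of "\<lambda>_. detecting_orbits"] finite_detecting finite_subset by blast
  have rep: "rep (key g) \<in> carrier G \<and> key (rep (key g)) = key g" if "g \<in> carrier G" for g
    unfolding rep_def by (rule someI[of "\<lambda>h. h \<in> carrier G \<and> key h = key g" g]) (use that in simp)
  have "\<exists>f\<in>rep ` key ` carrier G. \<exists>c\<in>pointwise_stab. g = f \<otimes> c" if g: "g \<in> carrier G" for g
  proof -
    let ?f = "rep (key g)"
    have f: "?f \<in> carrier G" "key ?f = key g" using rep[OF g] by auto
    have "inv ?f \<otimes> g \<in> stab Q" if Q: "Q \<in> detecting_orbits" for Q
    proof -
      have QW: "Q \<subseteq> W" using detecting_sub[OF Q] .
      have eq: "(`) (act ?f) ` Q = (`) (act g) ` Q" using fun_cong[OF f(2), of Q] Q by (simp add: key_def)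
      have "(`) (act (inv ?f \<otimes> g)) ` Q = (`) (act (inv ?f)) ` ((`) (act ?f) ` Q)"
        unfolding eq by (rule image2_act_mult[OF inv_closed[OF f(1)] g QW])
      also have "\<dots> = (`) (act (inv ?f \<otimes> ?f)) ` Q"
        by (rule image2_act_mult[OF inv_closed[OF f(1)] f(1) QW, symmetric])
      also have "\<dots> = Q" using image2_act_one[OF QW] f(1) by simp
      finally show ?thesis using f(1) g by (simp add: stab_def)
    qed
    then have "inv ?f \<otimes> g \<in> pointwise_stab" using f(1) g by (simp add: pointwise_stab_def)
    moreover have "g = ?f \<otimes> (inv ?f \<otimes> g)" using f(1) g by (simp add: m_assoc[symmetric])
    ultimately show ?thesis using g by blast
  qed
  moreover have "rep ` key ` carrier G \<subseteq> carrier G" using rep by blast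
  ultimately show ?thesis using finite_imageI[OF fin, of rep] by (intro exI[of _ "rep ` key ` carrier G"]) blast
qed

lemma eps_hom_stab:
  assumes "\<sigma> \<in> eps ` detecting_orbits" "g \<in> pointwise_stab" "h \<in> pointwise_stab"
  shows "\<sigma> (g \<otimes> h) = \<sigma> g + \<sigma> h"
proof -
  obtain Q where Q: "Q \<in> detecting_orbits" "\<sigma> = eps Q" using assms(1) by blast
  then show ?thesis using eps_hom[OF detecting_sub[OF Q(1)]] assms(2,3) by (simp add: pointwise_stab_def)
qed

lemma eps_detects:
  assumes a: "a \<in> A" and zero: "\<And>\<sigma>. \<sigma> \<in> eps ` detecting_orbits \<Longrightarrow> \<sigma> a = 0"
  shows "a = \<one>"
proof (rule ccontr)
  assume "a \<noteq> \<one>"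
  then obtain D where D: "D \<in> W" "eps (orb D) a \<noteq> 0" using detecting_orbit[OF a] by blast
  then have "orb D \<in> detecting_orbits" unfolding detecting_orbits_def using a by blast
  then show False using zero[of "eps (orb D)"] D(2) by blast
qed

text \<open>
  The commutator of an element of \<open>A\<close> and one of the stabiliser lies in \<open>A\<close> and is killed by all the
  homomorphisms to the integers, hence is trivial.
\<close>

lemma A_central:
  assumes a: "a \<in> A" and c: "c \<in> pointwise_stab"
  shows "a \<otimes> c = c \<otimes> a"
proof -
  have G: "a \<in> carrier G" "c \<in> carrier G" using a c A_carrier by (auto simp: pointwise_stab_def)
  have aC: "a \<in> pointwise_stab" using a A_pointwise_stab by blast
  note C = subgroup_pointwise_stab
  have ic: "inv c \<in> pointwise_stab" and ia: "inv a \<in> pointwise_stab"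
    using subgroup.m_inv_closed[OF C] aC c by blast+
  have ca: "c \<otimes> a \<in> pointwise_stab" "c \<otimes> a \<otimes> inv c \<in> pointwise_stab"
    using subgroup.m_closed[OF C] aC c ic by blast+
  let ?d = "c \<otimes> a \<otimes> inv c \<otimes> inv a"
  have dA: "?d \<in> A"
    using subgroup.m_closed[OF subgroup_A conj_A[OF G(2) a] subgroup.m_inv_closed[OF subgroup_A a]] .
  have "?d = \<one>"
  proof (rule eps_detects[OF dA])
    fix \<sigma> assume \<sigma>: "\<sigma> \<in> eps ` detecting_orbits"
    note hom = eps_hom_stab[OF \<sigma>]
    have "\<sigma> (inv c) = - \<sigma> c" "\<sigma> (inv a) = - \<sigma> a"
      using int_hom_inv[OF C hom c] int_hom_inv[OF C hom aC] by blast+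
    then show "\<sigma> ?d = 0" using hom[OF ca(2) ia] hom[OF ca(1) ic] hom[OF c aC] by simp
  qed
  then have "c \<otimes> a \<otimes> inv c = a" using inv_equality[of "c \<otimes> a \<otimes> inv c" "inv a"] G by simp
  then have "c \<otimes> a \<otimes> inv c \<otimes> c = a \<otimes> c" by simp
  then show ?thesis using G by (simp add: m_assoc)
qed

lemma virtual_direct_factor:
  "\<exists>H K. subgroup H G \<and> finite (rcosets H) \<and> A \<subseteq> H \<and>
     subgroup K G \<and> K \<subseteq> H \<and> internal_direct_product (G\<lparr>carrier := H\<rparr>) A K"
proof -
  note SA = generators_sub
  have "\<exists>K F. subgroup K G \<and> K \<subseteq> pointwise_stab \<and> generate G S \<inter> K = {\<one>} \<and> finite F \<and> F \<subseteq> pointwise_stab \<and>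
    (\<forall>c\<in>pointwise_stab. \<exists>f\<in>F. \<exists>a\<in>generate G S. \<exists>k\<in>K. c = f \<otimes> a \<otimes> k)"
  proof (rule central_virtual_complement[OF generators(1) subgroup_pointwise_stab])
    show "S \<subseteq> pointwise_stab" using SA A_pointwise_stab by blast
    show "s \<otimes> c = c \<otimes> s" if "s \<in> S" "c \<in> pointwise_stab" for s c
      using A_central that SA by blast
    show "\<sigma> (x \<otimes> y) = \<sigma> x + \<sigma> y"
      if "\<sigma> \<in> eps ` detecting_orbits" "x \<in> pointwise_stab" "y \<in> pointwise_stab" for \<sigma> x y
      using eps_hom_stab[OF that] .
    show "a = \<one>" if "a \<in> generate G S" "\<And>\<sigma>. \<sigma> \<in> eps ` detecting_orbits \<Longrightarrow> \<sigma> a = 0" for a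
      by (rule eps_detects) (use that generators(2) in simp_all)
  qed
  then obtain K F where K: "subgroup K G" "K \<subseteq> pointwise_stab" "A \<inter> K = {\<one>}"
    and F: "finite F" "F \<subseteq> pointwise_stab"
    and dec: "\<forall>c\<in>pointwise_stab. \<exists>f\<in>F. \<exists>a\<in>A. \<exists>k\<in>K. c = f \<otimes> a \<otimes> k"
    unfolding generators(2) by (elim exE conjE)
  obtain F1 where F1: "finite F1" "F1 \<subseteq> carrier G"
    "\<forall>g\<in>carrier G. \<exists>f\<in>F1. \<exists>c\<in>pointwise_stab. g = f \<otimes> c"
    using finite_index_pointwise_stab by (elim exE conjE)
  have CG: "pointwise_stab \<subseteq> carrier G" by (auto simp: pointwise_stab_def)
  show ?thesis
  proof (rule internal_direct_product_of_central[OF normal K(1) _ K(3)])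
    show "a \<otimes> k = k \<otimes> a" if "a \<in> A" "k \<in> K" for a k using A_central that K(2) by blast
    \<comment> \<open>Products of representatives: one for the pointwise stabiliser in
      \<open>G\<close>, one for the product of \<open>A\<close> and \<open>K\<close> in the
      stabiliser.\<close>
    let ?F = "(\<lambda>(f, f'). f \<otimes> f') ` (F1 \<times> F)"
    show "finite ?F" using F1(1) F(1) by simp
    show "?F \<subseteq> carrier G" using F1(2) F(2) CG by auto
    fix g assume g: "g \<in> carrier G"
    obtain f c where fc: "f \<in> F1" "c \<in> pointwise_stab" "g = f \<otimes> c" using bspec[OF F1(3) g] by blast
    obtain f' a k where d: "f' \<in> F" "a \<in> A" "k \<in> K" "c = f' \<otimes> a \<otimes> k" using bspec[OF dec fc(2)] by blast
    have "f \<in> carrier G" "f' \<in> carrier G" "a \<in> carrier G" "k \<in> carrier G"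
      using fc(1) d F1(2) F(2) CG K(2) A_carrier by blast+
    then have "g = (f \<otimes> f') \<otimes> a \<otimes> k" unfolding fc(3) d(4) by (simp add: m_assoc)
    moreover have "f \<otimes> f' \<in> ?F" using fc(1) d(1) by force
    ultimately show "\<exists>f\<in>?F. \<exists>a\<in>A. \<exists>k\<in>K. g = f \<otimes> a \<otimes> k" using d(2,3) by blast
  qed
qed

end

end

section \<open>Half-spaces of the cube complex as a system for the group action\<close>

context cat0_cube_complex
begin

lemma vertex_exists: "vertices \<Phi> \<noteq> {}"
proof -
  obtain x where "x \<in> X"
    using simply_connected topspace_complex_topology unfolding simply_connected_space_def by blast
  then obtain n \<phi> where "\<phi> \<in> \<Phi> n" using open_cubes_cover by blast
  then show ?thesis using corner_vertex[OF _ origin_corner] by blast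
qed

lemma image_halfspace_sub:
  assumes f: "cubical_automorphism X \<Phi> f" and f': "cubical_automorphism X \<Phi> f'"
    and inv: "\<And>x. x \<in> vertices \<Phi> \<Longrightarrow> f' (f x) = x" and e: "e \<in> \<Phi> 1"
  shows "f ` graph.halfspace e \<subseteq> graph.halfspace (dart_map f e)"
proof
  have le: "graph.gdist x y \<le> graph.gdist (f x) (f y)" if "x \<in> vertices \<Phi>" "y \<in> vertices \<Phi>" for x y
    using gdist_map_le[OF f', of "f x" "f y"] automorphism_vertex[OF f] inv that by simp
  fix y assume "y \<in> f ` graph.halfspace e"
  then obtain z where z: "z \<in> vertices \<Phi>" "graph.toward z e" "y = f z" by (auto simp: graph.halfspace_def)
  have V: "dart_source e \<in> vertices \<Phi>" "dart_source (dart_rev e) \<in> vertices \<Phi>"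
    using dart_source_vertex e darts.rev_in by blast+
  have "graph.gdist (f (dart_source (dart_rev e))) (f z) < graph.gdist (f (dart_source e)) (f z)"
    using gdist_map_le[OF f V(2) z(1)] le[OF V(1) z(1)] z(2) unfolding graph.toward_def by linarith
  then show "y \<in> graph.halfspace (dart_map f e)"
    using automorphism_vertex[OF f z(1)] z(3)
    by (simp add: graph.halfspace_def graph.toward_def dart_map_source dart_map_target)
qed

lemma image_halfspace:
  assumes f: "cubical_automorphism X \<Phi> f" and f': "cubical_automorphism X \<Phi> f'"
    and inv: "\<And>x. x \<in> vertices \<Phi> \<Longrightarrow> f' (f x) = x" "\<And>x. x \<in> vertices \<Phi> \<Longrightarrow> f (f' x) = x" and e: "e \<in> \<Phi> 1"
  shows "f ` graph.halfspace e = graph.halfspace (dart_map f e)"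
proof (rule subset_antisym[OF image_halfspace_sub[OF f f' inv(1) e]])
  have e': "dart_map f e \<in> \<Phi> 1" using dart_map_in[OF f e] .
  \<comment> \<open>Since \<open>f'\<close> is known to invert \<open>f\<close> on vertices only,
    the twice mapped dart is compared with \<open>e\<close> through its ends, which determine the
    half-space.\<close>
  have "dart_source (dart_map f' (dart_map f e)) = dart_source e"
    "dart_source (dart_rev (dart_map f' (dart_map f e))) = dart_source (dart_rev e)"
    using inv(1) dart_source_vertex e darts.rev_in by (simp_all add: dart_map_source dart_map_target)
  then have eq: "graph.halfspace (dart_map f' (dart_map f e)) = graph.halfspace e"
    by (simp add: graph.halfspace_def graph.toward_def)
  show "graph.halfspace (dart_map f e) \<subseteq> f ` graph.halfspace e"
  proof
    fix y assume y: "y \<in> graph.halfspace (dart_map f e)"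
    then have "f' y \<in> graph.halfspace e" using image_halfspace_sub[OF f' f inv(2) e'] eq by blast
    moreover have "f (f' y) = y" using y inv(2) by (simp add: graph.halfspace_def)
    ultimately show "y \<in> f ` graph.halfspace e" by (metis imageI)
  qed
qed

lemma elliptic_if_bounded:
  fixes G :: "('g, 'b) monoid_scheme" (structure)
  assumes "group G" and act: "cubical_action G X \<Phi> \<alpha>" and a: "a \<in> carrier G" and x0: "x0 \<in> vertices \<Phi>"
    and bd: "\<And>n::int. graph.gdist x0 (\<alpha> (a [^]\<^bsub>G\<^esub> n) x0) \<le> B"
  shows "elliptic G X \<Phi> \<alpha> a"
proof -
  interpret group G by (rule assms(1))
  interpret cubical_action G X \<Phi> \<alpha> by (rule act)
  have aut: "cubical_automorphism X \<Phi> (\<alpha> (a [^] (n::int)))" for n using cubical a by blast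
  have VX: "v \<in> X" if "v \<in> vertices \<Phi>" for v
    using that chart_in_space corners_in_cube[OF origin_corner] by (auto simp: vertices_def)
  have gen: "generate G {a} = {a [^] (k::int) | k. k \<in> UNIV}" using generate_pow[OF a] .
  show ?thesis unfolding elliptic_def
  proof
    fix x assume "x \<in> X"
    then obtain n \<phi> p where \<phi>: "\<phi> \<in> \<Phi> n" "p \<in> open_cube n" "x = \<phi> p" using open_cubes_cover by blast
    have p: "p \<in> unit_cube n" using open_in_cube[OF \<phi>(2)] .
    define v where "v = \<phi> (cube_origin n)"
    have v: "v \<in> vertices \<Phi>" unfolding v_def by (rule corner_vertex[OF \<phi>(1) origin_corner])
    \<comment> \<open>Twice the way from \<open>x\<close> to the corner \<open>v\<close> of its
      cube, twice the way from \<open>v\<close> to \<open>x0\<close>, and \<open>B\<close> between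
      the translates of \<open>x0\<close>.\<close>
    let ?B = "2 * cube_dist n p (cube_origin n) + real (2 * graph.gdist v x0 + B)"
    have bound: "complex_dist X \<Phi> (\<alpha> (a [^] (i::int)) x) (\<alpha> (a [^] (j::int)) x) \<le> ?B" for i j
    proof -
      let ?f = "\<alpha> (a [^] i)" and ?g = "\<alpha> (a [^] j)"
      have V: "?f v \<in> vertices \<Phi>" "?g v \<in> vertices \<Phi>" "?f x0 \<in> vertices \<Phi>" "?g x0 \<in> vertices \<Phi>"
        using automorphism_vertex[OF aut] v x0 by blast+
      have mid: "graph.gdist (?f x0) (?g x0) \<le> B"
      proof -
        have "a [^] j = a [^] i \<otimes> a [^] (j - i)" using a int_pow_mult[of a i "j - i"] by simp
        then have "?g x0 = ?f (\<alpha> (a [^] (j - i)) x0)" using composition_rule[OF VX[OF x0]] a by simp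
        then show ?thesis
          using gdist_map_le[OF aut[of i] x0 automorphism_vertex[OF aut[of "j - i"] x0]] bd[of "j - i"] by simp
      qed
      have "graph.gdist (?f v) (?g v) \<le> graph.gdist (?f v) (?f x0) + (graph.gdist (?f x0) (?g x0) + graph.gdist (?g x0) (?g v))"
        using graph.gdist_triangle[OF V(1,3,2)] graph.gdist_triangle[OF V(3,4,2)] by linarith
      moreover have "graph.gdist (?f v) (?f x0) \<le> graph.gdist v x0" using gdist_map_le[OF aut v x0] .
      moreover have "graph.gdist (?g x0) (?g v) \<le> graph.gdist v x0"
        using gdist_map_le[OF aut x0 v] graph.gdist_sym[OF v x0] by simp
      ultimately have "graph.gdist (?f v) (?g v) \<le> 2 * graph.gdist v x0 + B" using mid by linarith
      then have "real (graph.gdist (?f v) (?g v)) \<le> real (2 * graph.gdist v x0 + B)" by (rule of_nat_mono)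
      then show ?thesis
        using complex_dist_orbit_le[OF aut[of i] aut[of j] \<phi>(1) p v_def] \<phi>(3) by simp
    qed
    show "\<exists>B. \<forall>y\<in>orbit (G\<lparr>carrier := generate G {a}\<rparr>) \<alpha> x.
        \<forall>z\<in>orbit (G\<lparr>carrier := generate G {a}\<rparr>) \<alpha> x. complex_dist X \<Phi> y z \<le> B"
    proof (intro exI[of _ ?B] ballI)
      fix y z assume "y \<in> orbit (G\<lparr>carrier := generate G {a}\<rparr>) \<alpha> x" "z \<in> orbit (G\<lparr>carrier := generate G {a}\<rparr>) \<alpha> x"
      then obtain i j :: int where "y = \<alpha> (a [^] i) x" "z = \<alpha> (a [^] j) x"
        unfolding orbit_def gen by auto
      then show "complex_dist X \<Phi> y z \<le> ?B" using bound by simp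
    qed
  qed
qed

lemma halfspace_wall_action:
  fixes G :: "('g, 'b) monoid_scheme" (structure)
  assumes "group G" and act: "cubical_action G X \<Phi> \<alpha>" and x0: "x0 \<in> vertices \<Phi>"
  shows "wall_action G (vertices \<Phi>) \<alpha> graph.halfspaces x0"
proof -
  interpret group G by (rule assms(1))
  interpret cubical_action G X \<Phi> \<alpha> by (rule act)
  have VX: "v \<in> X" if "v \<in> vertices \<Phi>" for v
    using that chart_in_space corners_in_cube[OF origin_corner] by (auto simp: vertices_def)
  have one: "\<alpha> \<one> x = x" if "x \<in> vertices \<Phi>" for x
    using fun_cong[OF id_eq_one, of x] VX[OF that] by simp
  have mult: "\<alpha> (g \<otimes> h) x = \<alpha> g (\<alpha> h x)" if "g \<in> carrier G" "h \<in> carrier G" "x \<in> vertices \<Phi>" for g h x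
    using composition_rule[OF VX[OF that(3)] that(1,2)] .
  have inv: "\<alpha> (inv g) (\<alpha> g x) = x" "\<alpha> g (\<alpha> (inv g) x) = x" if "g \<in> carrier G" "x \<in> vertices \<Phi>" for g x
    using mult[of "inv g" g x] mult[of g "inv g" x] one that by simp_all
  show ?thesis
  proof
    show "\<alpha> g x \<in> vertices \<Phi>" if "g \<in> carrier G" "x \<in> vertices \<Phi>" for g x
      using automorphism_vertex[OF cubical[OF that(1)] that(2)] .
    show "\<alpha> (g \<otimes> h) x = \<alpha> g (\<alpha> h x)" if "g \<in> carrier G" "h \<in> carrier G" "x \<in> vertices \<Phi>" for g h x
      using mult[OF that] .
    show "\<alpha> \<one> x = x" if "x \<in> vertices \<Phi>" for x using one[OF that] .
    show "D \<subseteq> vertices \<Phi>" if "D \<in> graph.halfspaces" for D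
      using that by (auto simp: graph.halfspaces_def graph.halfspace_def)
    show "\<alpha> g ` D \<in> graph.halfspaces" if g: "g \<in> carrier G" and D: "D \<in> graph.halfspaces" for g D
    proof -
      obtain e where e: "e \<in> \<Phi> 1" "D = graph.halfspace e" using D by (auto simp: graph.halfspaces_def)
      have "\<alpha> g ` D = graph.halfspace (dart_map (\<alpha> g) e)"
        unfolding e(2) by (rule image_halfspace[OF cubical[OF g] cubical[OF inv_closed[OF g]] inv[OF g] e(1)])
      then show ?thesis using dart_map_in[OF cubical[OF g] e(1)] by (simp add: graph.halfspaces_def)
    qed
    show "finite {D \<in> graph.halfspaces. y \<in> D \<and> x \<notin> D}" if "x \<in> vertices \<Phi>" "y \<in> vertices \<Phi>" for x y
      using graph.finite_separating[OF that] .
    show "x0 \<in> vertices \<Phi>" by (rule x0)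
  qed
qed

end

theorem theorem1p8:
  fixes G :: "('g, 'b) monoid_scheme"
    and X :: "'x set"
    and \<Phi> :: "nat \<Rightarrow> ((nat \<Rightarrow> real) \<Rightarrow> 'x) set"
    and \<alpha> :: "'g \<Rightarrow> 'x \<Rightarrow> 'x"
    and A :: "'g set"
  assumes "group G"
    and "cat0_cube_complex X \<Phi>"
    and "cubical_action G X \<Phi> \<alpha>"
    and "A \<lhd> G"
    and "finitely_generated (G\<lparr>carrier := A\<rparr>)"
    and "comm_group (G\<lparr>carrier := A\<rparr>)"
    and "\<And>a. a \<in> A \<Longrightarrow> a \<noteq> \<one>\<^bsub>G\<^esub> \<Longrightarrow> \<not> elliptic G X \<Phi> \<alpha> a"
  shows "\<exists>H K. subgroup H G \<and> finite (rcosets\<^bsub>G\<^esub> H) \<and> A \<subseteq> H \<and>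
               subgroup K G \<and> K \<subseteq> H \<and> internal_direct_product (G\<lparr>carrier := H\<rparr>) A K"
proof -
  interpret group G by (rule assms(1))
  interpret cat0_cube_complex X \<Phi> by (rule assms(2))
  obtain x0 where x0: "x0 \<in> vertices \<Phi>" using vertex_exists by blast
  interpret wall_action G "vertices \<Phi>" \<alpha> graph.halfspaces x0
    by (rule halfspace_wall_action[OF assms(1,3) x0])
  have sA: "subgroup A G" using assms(4) normal_imp_subgroup by blast
  obtain S where S: "finite S" "S \<subseteq> A" "generate (G\<lparr>carrier := A\<rparr>) S = A"
    using assms(5) unfolding finitely_generated_def by auto
  have gen: "generate G S = A" using generate_consistent[OF S(2) sA] S(3) by simp
  have ab: "a \<otimes>\<^bsub>G\<^esub> b = b \<otimes>\<^bsub>G\<^esub> a" if "a \<in> A" "b \<in> A" for a b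
    using comm_groupE(4)[OF assms(6)] that by simp
  \<comment> \<open>Contrapositive of the hypothesis on \<open>A\<close>: a bound on the number of
    separating half-spaces bounds the graph distance along the orbit and so makes \<open>a\<close>
    elliptic.\<close>
  have unb: "\<exists>n::int. card (sep x0 (pt a n) graph.halfspaces) > B" if a: "a \<in> A" "a \<noteq> \<one>\<^bsub>G\<^esub>" for a B
  proof (rule ccontr)
    assume n: "\<not> ?thesis"
    have aG: "a \<in> carrier G" using subgroup.mem_carrier[OF sA a(1)] .
    have "graph.gdist x0 (pt a n) \<le> B" for n
      using graph.gdist_le_card_separating[OF x0 pt_in[OF aG, of n]] n unfolding sep_def
      by (meson le_trans not_le)
    then show False using elliptic_if_bounded[OF assms(1,3) aG x0] assms(7)[OF a] by blast
  qed
  show ?thesis by (rule virtual_direct_factor[OF assms(4) ab S(1) gen unb])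
qed

end
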